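(* Let $n\ge 3$ be an odd integer, and let $X$ be a nonsingular hypersurface of degree $d\geq 2$ in $\mathbb{P}^n$ defined over $\mathbb{F}_q$. Then \[ N_q(X) \leq \theta_q\!\left(\frac{n-1}{2}\right)\cdot\left((d-1)q^{\frac{n-1}{2}}+1\right), \] and equality holds if and only if one of the following holds: (i) $d=2$ and $X$ is the nonsingular hyperbolic quadric hypersurface, that is, $X$ is projectively equivalent over $\mathbb{F}_q$ to the hypersurface $\sum_{i=0}^{\frac{n-1}{2}} X_{2i}X_{2i+1}=0$; (ii) $q$ is a square, $d=\sqrt{q}+1$, and $X$ is a nonsingular Hermitian hypersurface, that is, $X$ is projectively equivalent over $\mathbb{F}_q$ to the hypersurface $\sum_{i=0}^{\frac{n-1}{2}}\left(X_{2i}^{\sqrt{q}}X_{2i+1}+X_{2i}X_{2i+1}^{\sqrt{q}}\right)=0$; (iii) $d=q+1$ and $X$ is a nonsingular $\mathbb{P}^n$-filling hypersurface over $\mathbb{F}_q$, that is, $X$ is projectively equivalent over $\mathbb{F}_q$ to the hypersurface $\sum_{i=0}^{\frac{n-1}{2}}\left(X_{2i}^{q}X_{2i+1}-X_{2i}X_{2i+1}^{q}\right)=0$.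
   Context: $\mathbb{F}_q$ is the finite field with $q$ elements, and $X_0,\dots,X_n$ are homogeneous coordinates of $\mathbb{P}^n$. For an integer $m\ge 0$, $\theta_q(m)=\sum_{\nu=0}^{m}q^{\nu}$ (the number of $\mathbb{F}_q$-points of $\mathbb{P}^m$). A hypersurface of degree $d$ in $\mathbb{P}^n$ defined over $\mathbb{F}_q$ is the closed subscheme $\{F=0\}$ defined by a nonzero homogeneous polynomial $F\in\mathbb{F}_q[X_0,\dots,X_n]$ of degree $d$. Nonsingularity is understood over the algebraic closure $\overline{\mathbb{F}}_q$. $X(\mathbb{F}_q)$ is the set of $\mathbb{F}_q$-points of $\mathbb{P}^n$ at which $F$ vanishes (counted without multiplicity), and $N_q(X)=|X(\mathbb{F}_q)|$. *)

theory Defs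
  imports
    "HOL-Library.Poly_Mapping"
    "HOL-Library.Cardinality"
    "HOL-Algebra.Algebraic_Closure_Type"
    "Jordan_Normal_Form.Matrix"
begin

text \<open>Multivariate polynomials in the variables \<open>X\<^sub>0, X\<^sub>1, \<dots>\<close>: finitely supported coefficient
  functions on monomials, a monomial being a finitely supported exponent function.\<close>

type_synonym 'a mpoly = "(nat \<Rightarrow>\<^sub>0 nat) \<Rightarrow>\<^sub>0 'a"

definition mp_const :: "'a::zero \<Rightarrow> 'a mpoly" where
  "mp_const c = Poly_Mapping.single 0 c"

definition mp_var :: "nat \<Rightarrow> 'a::zero_neq_one mpoly" where
  "mp_var i = Poly_Mapping.single (Poly_Mapping.single i 1) 1"

text \<open>The value of \<open>p\<close> when each variable \<open>X\<^sub>i\<close> is replaced by \<open>x i\<close> and the coefficients are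
  transported along \<open>h\<close>. It is used with \<open>h = id\<close> for values in the ground field, with
  \<open>h = to_ac\<close> for values in its algebraic closure, and with \<open>h = mp_const\<close> for the
  substitution of polynomials.\<close>

definition mp_eval :: "('a::zero \<Rightarrow> 'b::comm_semiring_1) \<Rightarrow> (nat \<Rightarrow> 'b) \<Rightarrow> 'a mpoly \<Rightarrow> 'b" where
  "mp_eval h x p =
     (\<Sum>m\<in>Poly_Mapping.keys p. h (Poly_Mapping.lookup p m) *
        (\<Prod>i\<in>Poly_Mapping.keys m. x i ^ Poly_Mapping.lookup m i))"

text \<open>The truncated exponent in \<open>m - single i 1\<close> for \<open>lookup m i = 0\<close> is harmless, since the
  coefficient is then zero.\<close>

definition mp_pderiv :: "nat \<Rightarrow> 'a::semiring_1 mpoly \<Rightarrow> 'a mpoly" where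
  "mp_pderiv i p =
     (\<Sum>m\<in>Poly_Mapping.keys p. Poly_Mapping.single (m - Poly_Mapping.single i 1)
                        (of_nat (Poly_Mapping.lookup m i) * Poly_Mapping.lookup p m))"

text \<open>A hypersurface of degree \<open>d\<close> in \<open>\<P>\<^sup>n\<close> is given by a nonzero form \<open>F\<close> of degree \<open>d\<close> in
  \<open>X\<^sub>0, \<dots>, X\<^sub>n\<close>. As closed subschemes, \<open>{F = 0}\<close> and \<open>{G = 0}\<close> coincide iff \<open>F\<close> and \<open>G\<close> differ
  by a nonzero scalar factor.\<close>

definition hypersurface_form :: "nat \<Rightarrow> nat \<Rightarrow> 'a::zero mpoly \<Rightarrow> bool" where
  "hypersurface_form n d F \<longleftrightarrow>
     F \<noteq> 0 \<and>
     (\<forall>m\<in>Poly_Mapping.keys F. Poly_Mapping.keys m \<subseteq> {..n} \<and>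
        (\<Sum>i\<in>Poly_Mapping.keys m. Poly_Mapping.lookup m i) = d)"

text \<open>The Jacobian criterion at all geometric points. The condition \<open>F = 0\<close> is not implied by the
  vanishing of the derivatives when the characteristic divides the degree.\<close>

definition nonsingular_hypersurface :: "nat \<Rightarrow> 'a::field mpoly \<Rightarrow> bool" where
  "nonsingular_hypersurface n F \<longleftrightarrow>
     \<not> (\<exists>x\<in>carrier_vec (Suc n). x \<noteq> 0\<^sub>v (Suc n) \<and>
          mp_eval to_ac (($) x) F = 0 \<and>
          (\<forall>i\<le>n. mp_eval to_ac (($) x) (mp_pderiv i F) = 0))"

text \<open>A point of \<open>\<P>\<^sup>n\<close> over \<open>'a\<close> is the set of all its homogeneous coordinate vectors.\<close>

definition proj_points :: "nat \<Rightarrow> 'a::field vec set set" where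
  "proj_points n =
     {{c \<cdot>\<^sub>v x | c. c \<noteq> 0} | x. x \<in> carrier_vec (Suc n) \<and> x \<noteq> 0\<^sub>v (Suc n)}"

definition rational_points :: "nat \<Rightarrow> 'a::field mpoly \<Rightarrow> 'a vec set set" where
  "rational_points n F = {P \<in> proj_points n. \<forall>x\<in>P. mp_eval id (($) x) F = 0}"

definition num_points :: "nat \<Rightarrow> 'a::field mpoly \<Rightarrow> nat" where
  "num_points n F = card (rational_points n F)"

definition theta :: "nat \<Rightarrow> nat \<Rightarrow> nat" where
  "theta q m = (\<Sum>\<nu>=0..m. q ^ \<nu>)"

text \<open>The form \<open>F (A X)\<close>.\<close>

definition linear_subst :: "nat \<Rightarrow> 'a::field mat \<Rightarrow> 'a mpoly \<Rightarrow> 'a mpoly" where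
  "linear_subst n A F =
     mp_eval mp_const (\<lambda>i. \<Sum>j=0..n. mp_const (A $$ (i, j)) * mp_var j) F"

definition proj_equivalent :: "nat \<Rightarrow> 'a::field mpoly \<Rightarrow> 'a mpoly \<Rightarrow> bool" where
  "proj_equivalent n F G \<longleftrightarrow>
     (\<exists>A c. A \<in> carrier_mat (Suc n) (Suc n) \<and> invertible_mat A \<and> c \<noteq> 0 \<and>
            linear_subst n A F = mp_const c * G)"

definition hyperbolic_form :: "nat \<Rightarrow> 'a::field mpoly" where
  "hyperbolic_form n = (\<Sum>i=0..(n - 1) div 2. mp_var (2 * i) * mp_var (2 * i + 1))"

text \<open>In the next form \<open>r\<close> plays the role of \<open>\<surd>q\<close>.\<close>

definition hermitian_form :: "nat \<Rightarrow> nat \<Rightarrow> 'a::field mpoly" where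
  "hermitian_form r n =
     (\<Sum>i=0..(n - 1) div 2.
        mp_var (2 * i) ^ r * mp_var (2 * i + 1) + mp_var (2 * i) * mp_var (2 * i + 1) ^ r)"

definition space_filling_form :: "nat \<Rightarrow> nat \<Rightarrow> 'a::field mpoly" where
  "space_filling_form q n =
     (\<Sum>i=0..(n - 1) div 2.
        mp_var (2 * i) ^ q * mp_var (2 * i + 1) - mp_var (2 * i) * mp_var (2 * i + 1) ^ q)"

end

theory Submission
  imports Defs "HOL-Library.Function_Algebras"
begin

text \<open>Write \<open>n = 2m + 1\<close>. The bound exceeds the number of all points of \<open>\<P>\<^sup>n\<close> if \<open>d > q + 1\<close> and equals it
  if \<open>d = q + 1\<close>; in the latter case a form without nonzero values is alternating, and its Gram
  matrix is nondegenerate by smoothness. Let \<open>d \<le> q\<close> and let \<open>L\<close> be a rational linear subspace of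
  maximal dimension \<open>k\<close> in \<open>X\<close>. A space of dimension \<open>k + 1\<close> through \<open>L\<close> meets \<open>X\<close> outside \<open>L\<close> in an affine
  hypersurface of degree at most \<open>d - 1\<close>, so Schwartz--Zippel bounds the number of points; the
  resulting bound increases with \<open>k\<close>, and \<open>k \<le> m\<close> because otherwise the \<open>n - k\<close> derivatives transversal to
  \<open>L\<close> would have a common zero on \<open>L\<close>.

  In the case of equality the affine hypersurfaces are unions of \<open>d - 1\<close> parallel hyperplanes. Hence
  translation by a point \<open>P\<close> of \<open>X\<close> preserves the values of \<open>F\<close> on the tangent space at \<open>P\<close>. This yields
  a hyperbolic basis in which \<open>F\<close> is a sum of binary forms \<open>h\<^sub>i(X\<^sub>2\<^sub>i, X\<^sub>2\<^sub>i\<^sub>+\<^sub>1)\<close>, and it forces each \<open>h\<^sub>i\<close> to be invariant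
  under a torus and under translation by its roots, which leaves only \<open>d = 2\<close> and \<open>q = (d - 1)\<^sup>2\<close>.\<close>

section \<open>Evaluation of polynomials\<close>

text \<open>All geometry takes place in the affine cone: a projective \<open>k\<close>-space is a
  subspace with \<open>q^(k+1)\<close> elements, and dimensions are read off from cardinalities.
  Tangency is expressed by \<open>B u v\<close>, the derivative of \<open>F\<close> at
  \<open>u\<close> in direction \<open>v\<close>. The obstacle is that \<open>B\<close> is linear in
  \<open>v\<close> only and of degree \<open>d - 1\<close> in \<open>u\<close>; it is a bilinear
  form for a quadric, but not in general. For \<open>d \<le> q\<close> the substitute is the
  translation property: along a direction \<open>v\<close> with \<open>F(v) = 0\<close> the
  restriction of \<open>F\<close> has degree at most \<open>d - 1 < q\<close>, so its values
  determine it, and its coefficient of index \<open>d - 1\<close> is \<open>B v u\<close>. Symmetry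
  of orthogonality between zeros of \<open>F\<close>, and additivity of the condition
  \<open>B c v = 0\<close> in \<open>c\<close>, are deduced from this. For \<open>d > 2\<close> the
  relation \<open>q = (d - 1)^2\<close> has two sources. With \<open>t = d - 1\<close>, the roots of
  a binary summand form an additive group of order \<open>t\<close>, so \<open>t\<close> divides
  \<open>q\<close>; the torus fixes a monomial \<open>X Y^t\<close> with nonzero coefficient, so
  \<open>q - 1\<close> divides \<open>t^2 - 1\<close>. The common zero on a large linear subspace is
  an instance of the projective dimension theorem. It is obtained by counting dual spaces over the
  finite field, followed by a simultaneous eigenvector over its closure.\<close>

definition mon :: "(nat \<Rightarrow> 'b::comm_semiring_1) \<Rightarrow> (nat \<Rightarrow>\<^sub>0 nat) \<Rightarrow> 'b" where
  "mon x m = (\<Prod>i\<in>Poly_Mapping.keys m. x i ^ Poly_Mapping.lookup m i)"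

definition mdeg :: "(nat \<Rightarrow>\<^sub>0 nat) \<Rightarrow> nat" where
  "mdeg m = (\<Sum>i\<in>Poly_Mapping.keys m. Poly_Mapping.lookup m i)"

lemma mon_superset:
  assumes "finite S" "Poly_Mapping.keys m \<subseteq> S"
  shows "mon x m = (\<Prod>i\<in>S. x i ^ Poly_Mapping.lookup m i)"
  unfolding mon_def using assms
  by (intro prod.mono_neutral_left) (auto simp: in_keys_iff)

lemma mdeg_superset:
  assumes "finite S" "Poly_Mapping.keys m \<subseteq> S"
  shows "mdeg m = (\<Sum>i\<in>S. Poly_Mapping.lookup m i)"
  unfolding mdeg_def using assms
  by (intro sum.mono_neutral_left) (auto simp: in_keys_iff)

lemma keys_plus_nat: "Poly_Mapping.keys (m + m' :: nat \<Rightarrow>\<^sub>0 nat) = Poly_Mapping.keys m \<union> Poly_Mapping.keys m'"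
  by (auto simp: in_keys_iff lookup_add)

lemma mon_0 [simp]: "mon x 0 = 1"
  by (simp add: mon_def)

lemma mdeg_0 [simp]: "mdeg 0 = 0"
  by (simp add: mdeg_def)

lemma mon_plus: "mon x (m + m') = mon x m * mon x m'"
proof -
  let ?S = "Poly_Mapping.keys m \<union> Poly_Mapping.keys m'"
  have "mon x (m + m') = (\<Prod>i\<in>?S. x i ^ Poly_Mapping.lookup (m + m') i)"
    by (intro mon_superset) (auto simp: keys_plus_nat)
  also have "\<dots> = (\<Prod>i\<in>?S. x i ^ Poly_Mapping.lookup m i) * (\<Prod>i\<in>?S. x i ^ Poly_Mapping.lookup m' i)"
    by (simp add: lookup_add power_add prod.distrib)
  also have "\<dots> = mon x m * mon x m'"
    by (subst (1 2) mon_superset[of ?S]) auto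
  finally show ?thesis .
qed

lemma mdeg_plus: "mdeg (m + m') = mdeg m + mdeg m'"
proof -
  let ?S = "Poly_Mapping.keys m \<union> Poly_Mapping.keys m'"
  have "mdeg (m + m') = (\<Sum>i\<in>?S. Poly_Mapping.lookup (m + m') i)"
    by (intro mdeg_superset) (auto simp: keys_plus_nat)
  also have "\<dots> = (\<Sum>i\<in>?S. Poly_Mapping.lookup m i) + (\<Sum>i\<in>?S. Poly_Mapping.lookup m' i)"
    by (simp add: lookup_add sum.distrib)
  also have "\<dots> = mdeg m + mdeg m'"
    by (subst (1 2) mdeg_superset[of ?S]) auto
  finally show ?thesis .
qed

lemma mon_single [simp]: "mon x (Poly_Mapping.single i k) = x i ^ k"
  by (cases "k = 0") (auto simp: mon_def)

lemma mdeg_single [simp]: "mdeg (Poly_Mapping.single i k) = k"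
  by (cases "k = 0") (auto simp: mdeg_def)

lemma mon_scale: "mon (\<lambda>i. c * x i) m = c ^ mdeg m * mon x m"
  by (simp add: mon_def mdeg_def power_mult_distrib prod.distrib power_sum)

lemma mon_cong: "(\<And>i. i \<in> Poly_Mapping.keys m \<Longrightarrow> x i = y i) \<Longrightarrow> mon x m = mon y m"
  by (simp add: mon_def)

lemma mp_eval_mon: "mp_eval h x p = (\<Sum>m\<in>Poly_Mapping.keys p. h (Poly_Mapping.lookup p m) * mon x m)"
  by (simp add: mp_eval_def mon_def)

text \<open>All coefficient maps used later are instances: \<open>id\<close>, \<open>to_ac\<close>,
  the embedding of constants into \<open>'b poly\<close>, evaluation of a univariate polynomial, and
  \<open>mp_eval h x\<close> itself. Substitution identities then reduce to
  \<open>mp_eval_comp\<close>.\<close>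

locale ring_morphism =
  fixes h :: "'a::comm_semiring_1 \<Rightarrow> 'b::comm_semiring_1"
  assumes h_0 [simp]: "h 0 = 0" and h_1 [simp]: "h 1 = 1"
    and h_add: "h (a + b) = h a + h b" and h_mult: "h (a * b) = h a * h b"
begin

lemma h_sum: "h (sum f A) = (\<Sum>i\<in>A. h (f i))"
  by (induction A rule: infinite_finite_induct) (auto simp: h_add)

lemma h_prod: "h (prod f A) = (\<Prod>i\<in>A. h (f i))"
  by (induction A rule: infinite_finite_induct) (auto simp: h_mult)

lemma h_power: "h (a ^ k) = h a ^ k"
  by (induction k) (auto simp: h_mult)

lemma h_of_nat: "h (of_nat k) = of_nat k"
  by (induction k) (auto simp: h_add)

lemma h_mon: "h (mon x m) = mon (\<lambda>i. h (x i)) m"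
  by (simp add: mon_def h_prod h_power)

lemma mp_eval_superset:
  assumes "finite S" "Poly_Mapping.keys p \<subseteq> S"
  shows "mp_eval h x p = (\<Sum>m\<in>S. h (Poly_Mapping.lookup p m) * mon x m)"
  unfolding mp_eval_mon using assms
  by (intro sum.mono_neutral_left) (auto simp: in_keys_iff)

lemma mp_eval_0 [simp]: "mp_eval h x 0 = 0"
  by (simp add: mp_eval_def)

lemma mp_eval_single [simp]: "mp_eval h x (Poly_Mapping.single m c) = h c * mon x m"
  by (subst mp_eval_superset[of "{m}"]) auto

lemma mp_eval_add: "mp_eval h x (p + q) = mp_eval h x p + mp_eval h x q"
proof -
  let ?S = "Poly_Mapping.keys p \<union> Poly_Mapping.keys q"
  have "mp_eval h x (p + q) = (\<Sum>m\<in>?S. h (Poly_Mapping.lookup (p + q) m) * mon x m)"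
    using Poly_Mapping.keys_add[of p q] by (intro mp_eval_superset) auto
  also have "\<dots> = (\<Sum>m\<in>?S. h (Poly_Mapping.lookup p m) * mon x m)
                   + (\<Sum>m\<in>?S. h (Poly_Mapping.lookup q m) * mon x m)"
    by (simp add: lookup_add h_add sum.distrib algebra_simps)
  also have "\<dots> = mp_eval h x p + mp_eval h x q"
    by (subst (1 2) mp_eval_superset[of ?S]) auto
  finally show ?thesis .
qed

lemma mp_eval_sum: "mp_eval h x (sum f A) = (\<Sum>i\<in>A. mp_eval h x (f i))"
  by (induction A rule: infinite_finite_induct) (auto simp: mp_eval_add)

lemma mp_eval_const [simp]: "mp_eval h x (mp_const c) = h c"
  by (simp add: mp_const_def)

lemma mp_eval_var [simp]: "mp_eval h x (mp_var i) = x i"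
  by (simp add: mp_var_def)

end

lemma mpoly_sum_single: "p = (\<Sum>m\<in>Poly_Mapping.keys p. Poly_Mapping.single m (Poly_Mapping.lookup p m))"
  by (rule poly_mapping_eqI) (auto simp: lookup_sum lookup_single when_def in_keys_iff)

context ring_morphism
begin

lemma mp_eval_mult: "mp_eval h x (p * q) = mp_eval h x p * mp_eval h x q"
proof -
  have *: "mp_eval h x (Poly_Mapping.single m c * q) = h c * mon x m * mp_eval h x q" for m c
  proof -
    have "Poly_Mapping.single m c * q =
       (\<Sum>m'\<in>Poly_Mapping.keys q. Poly_Mapping.single m c * Poly_Mapping.single m' (Poly_Mapping.lookup q m'))"
      by (subst mpoly_sum_single[of q], subst sum_distrib_left) simp
    also have "\<dots> = (\<Sum>m'\<in>Poly_Mapping.keys q. Poly_Mapping.single (m + m') (c * Poly_Mapping.lookup q m'))"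
      by (simp add: mult_single)
    finally have "mp_eval h x (Poly_Mapping.single m c * q) =
       (\<Sum>m'\<in>Poly_Mapping.keys q. h (c * Poly_Mapping.lookup q m') * mon x (m + m'))"
      by (simp add: mp_eval_sum)
    also have "\<dots> = h c * mon x m * mp_eval h x q"
      unfolding mp_eval_mon by (simp add: sum_distrib_left h_mult mon_plus algebra_simps)
    finally show ?thesis .
  qed
  have "p * q = (\<Sum>m\<in>Poly_Mapping.keys p. Poly_Mapping.single m (Poly_Mapping.lookup p m) * q)"
    by (subst mpoly_sum_single[of p], subst sum_distrib_right) simp
  then show ?thesis
    by (simp add: mp_eval_sum * mp_eval_mon[of h x p] sum_distrib_right)
qed

lemma mp_eval_1 [simp]: "mp_eval h x 1 = 1"
  using mp_eval_single[of x 0 1] by (simp del: mp_eval_single)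

lemma ring_morphism_mp_eval: "ring_morphism (mp_eval h x)"
  by standard (auto simp: mp_eval_add mp_eval_mult)

lemma mp_eval_power: "mp_eval h x (p ^ k) = mp_eval h x p ^ k"
  by (rule ring_morphism.h_power[OF ring_morphism_mp_eval])

lemma mp_eval_comp: "h (mp_eval g x p) = mp_eval (\<lambda>c. h (g c)) (\<lambda>i. h (x i)) p"
  by (simp add: mp_eval_mon h_sum h_mult h_mon)

end

lemma ring_morphism_id: "ring_morphism (id :: 'a::comm_semiring_1 \<Rightarrow> 'a)"
  by standard auto

lemma ring_morphism_to_ac: "ring_morphism (to_ac :: 'a::field \<Rightarrow> 'a alg_closure)"
  by standard auto

lemma ring_morphism_poly_const:
  assumes "ring_morphism (h :: 'a::comm_semiring_1 \<Rightarrow> 'b::comm_ring_1)"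
  shows "ring_morphism (\<lambda>c. [:h c:])"
proof -
  interpret ring_morphism h by fact
  show ?thesis by standard (auto simp: h_add h_mult one_pCons)
qed

lemma ring_morphism_poly: "ring_morphism (\<lambda>p. poly p (s :: 'b::comm_ring_1))"
  by standard auto

lemma mp_eval_mult_const:
  assumes "ring_morphism (h :: 'a::comm_ring_1 \<Rightarrow> 'b::comm_ring_1)"
  shows "mp_eval h x (mp_const c * G) = h c * mp_eval h x G"
  using assms by (simp add: ring_morphism.mp_eval_mult ring_morphism.mp_eval_const)

lemma mp_eval_diff:
  assumes "ring_morphism (h :: 'a::comm_ring_1 \<Rightarrow> 'b::comm_ring_1)"
  shows "mp_eval h x (p - q) = mp_eval h x p - mp_eval h x q"
  using ring_morphism.mp_eval_add[OF assms, of x "p - q" q] by simp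

lemma mp_eval_linear_subst:
  assumes "ring_morphism (h :: 'a::field \<Rightarrow> 'b::comm_ring_1)"
  shows "mp_eval h y (linear_subst n A F) = mp_eval h (\<lambda>i. \<Sum>j=0..n. h (A $$ (i, j)) * y j) F"
proof -
  interpret ring_morphism h by fact
  interpret e: ring_morphism "mp_eval h y" by (rule ring_morphism_mp_eval)
  show ?thesis
    by (simp add: linear_subst_def e.mp_eval_comp mp_eval_sum mp_eval_mult)
qed

lemma mp_eval_cong:
  assumes "\<And>m i. m \<in> Poly_Mapping.keys p \<Longrightarrow> i \<in> Poly_Mapping.keys m \<Longrightarrow> x i = y i"
  shows "mp_eval h x p = mp_eval h y p"
  using assms unfolding mp_eval_def by (intro sum.cong prod.cong refl arg_cong2[where f = "(*)"]) auto

section \<open>Restriction of a form to a line\<close>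

definition form :: "nat \<Rightarrow> nat \<Rightarrow> 'a::zero mpoly \<Rightarrow> bool" where
  "form n d F \<longleftrightarrow> (\<forall>m\<in>Poly_Mapping.keys F. Poly_Mapping.keys m \<subseteq> {..n} \<and> mdeg m = d)"

lemma hypersurface_form_iff: "hypersurface_form n d F \<longleftrightarrow> F \<noteq> 0 \<and> form n d F"
  by (simp add: hypersurface_form_def form_def mdeg_def)

text \<open>The restriction \<open>F(u + s v)\<close> to a line, kept as a polynomial in
  \<open>s\<close> because over a finite field values determine it only in degree below
  \<open>q\<close>. Its coefficient of index 1 is the derivative of \<open>F\<close> at
  \<open>u\<close> in direction \<open>v\<close>.\<close>

definition line_poly :: "('a::comm_ring_1 \<Rightarrow> 'b::comm_ring_1) \<Rightarrow> 'a mpoly \<Rightarrow> (nat \<Rightarrow> 'b) \<Rightarrow> (nat \<Rightarrow> 'b) \<Rightarrow> 'b poly" where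
  "line_poly h F u v = mp_eval (\<lambda>c. [:h c:]) (\<lambda>i. [:u i, v i:]) F"

lemma poly_line_poly:
  assumes "ring_morphism h"
  shows "poly (line_poly h F u v) s = mp_eval h (\<lambda>i. u i + s * v i) F"
  unfolding line_poly_def by (subst ring_morphism.mp_eval_comp[OF ring_morphism_poly]) simp

lemma form_scale:
  assumes "form n d F"
  shows "mp_eval h (\<lambda>i. c * x i) F = c ^ d * mp_eval h x F"
  using assms unfolding mp_eval_mon form_def
  by (simp add: mon_scale sum_distrib_left algebra_simps)

text \<open>The relation \<open>p(X) = X^d q(1/X)\<close>, read off coefficientwise. It encodes
  \<open>F(u + s v) = s^d F(v + u/s)\<close>: exchanging base point and direction reverses the
  coefficients. The degree bound is a separate clause, since the first one says nothing about
  coefficients of \<open>q\<close> beyond \<open>d\<close>.\<close>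

definition reciprocal :: "nat \<Rightarrow> 'b::comm_ring_1 poly \<Rightarrow> 'b poly \<Rightarrow> bool" where
  "reciprocal d p q \<longleftrightarrow> (\<forall>k. coeff p k = (if k \<le> d then coeff q (d - k) else 0)) \<and> degree q \<le> d"

lemma reciprocal_linear_mult:
  assumes "reciprocal d p q"
  shows "reciprocal (Suc d) ([:a, b:] * p) ([:b, a:] * q)"
proof -
  have 1: "coeff p k = (if k \<le> d then coeff q (d - k) else 0)" for k
    using assms by (auto simp: reciprocal_def)
  have 2: "coeff q k = 0" if "k > d" for k
    using assms that by (intro coeff_eq_0) (auto simp: reciprocal_def)
  have "coeff ([:a, b:] * p) k = (if k \<le> Suc d then coeff ([:b, a:] * q) (Suc d - k) else 0)" for k
  proof -
    consider "k = 0" | "k > Suc d" | "k = Suc d" | "0 < k" "k \<le> d" by linarith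
    then show ?thesis
    proof cases
      case 4
      then obtain j where j: "k = Suc j" by (cases k) auto
      have *: "Suc d - k = Suc (d - k)" using 4 by auto
      have "d - j = Suc (d - k)" using 4 j by auto
      then show ?thesis using 4 unfolding * by (simp add: j 1 algebra_simps)
    qed (auto simp: 1 2 coeff_pCons split: nat.splits)
  qed
  moreover have "degree ([:b, a:] * q) \<le> Suc d"
  proof -
    have "degree ([:b, a:] * q) \<le> degree [:b, a:] + degree q" by (rule degree_mult_le)
    also have "\<dots> \<le> Suc d" using assms by (auto simp: reciprocal_def)
    finally show ?thesis .
  qed
  ultimately show ?thesis unfolding reciprocal_def by blast
qed

lemma reciprocal_power_mult:
  assumes "reciprocal d p q"
  shows "reciprocal (k + d) ([:a, b:] ^ k * p) ([:b, a:] ^ k * q)"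
proof (induction k)
  case (Suc k)
  have "[:a, b:] ^ Suc k * p = [:a, b:] * ([:a, b:] ^ k * p)"
       "[:b, a:] ^ Suc k * q = [:b, a:] * ([:b, a:] ^ k * q)" by (simp_all only: power_Suc mult.assoc)
  then show ?case using reciprocal_linear_mult[OF Suc] by simp
qed (use assms in auto)

lemma reciprocal_mon: "reciprocal (mdeg m) (mon (\<lambda>i. [:u i, v i:]) m) (mon (\<lambda>i. [:v i, u i:]) m)"
proof -
  have "finite S \<Longrightarrow> reciprocal (\<Sum>i\<in>S. f i) (\<Prod>i\<in>S. [:u i, v i:] ^ f i) (\<Prod>i\<in>S. [:v i, u i:] ^ f i)" for S f
  proof (induction S rule: finite_induct)
    case empty
    then show ?case by (auto simp: reciprocal_def coeff_1)
  next
    case (insert i S)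
    then show ?case using reciprocal_power_mult[OF insert.IH] by simp
  qed
  then show ?thesis by (simp add: mon_def mdeg_def)
qed

lemma reciprocal_line_poly:
  assumes "form n d F"
  shows "reciprocal d (line_poly h F u v) (line_poly h F v u)"
proof -
  have *: "reciprocal d (mon (\<lambda>i. [:u i, v i:]) m) (mon (\<lambda>i. [:v i, u i:]) m)" if "m \<in> Poly_Mapping.keys F" for m
    using reciprocal_mon[of m u v] assms that by (auto simp: form_def)
  have "coeff (line_poly h F u v) k = (if k \<le> d then coeff (line_poly h F v u) (d - k) else 0)" for k
    using * unfolding line_poly_def mp_eval_mon reciprocal_def by (simp add: coeff_sum)
  moreover have "degree (line_poly h F v u) \<le> d"
    unfolding line_poly_def mp_eval_mon
  proof (rule degree_sum_le)
    fix m assume m: "m \<in> Poly_Mapping.keys F"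
    have "degree ([:h (Poly_Mapping.lookup F m):] * mon (\<lambda>i. [:v i, u i:]) m)
        \<le> degree (mon (\<lambda>i. [:v i, u i:]) m)"
      by (simp add: degree_smult_le)
    also have "\<dots> \<le> d" using *[OF m] by (simp add: reciprocal_def)
    finally show "degree ([:h (Poly_Mapping.lookup F m):] * mon (\<lambda>i. [:v i, u i:]) m) \<le> d" .
  qed auto
  ultimately show ?thesis unfolding reciprocal_def by blast
qed

lemma degree_line_poly: "form n d F \<Longrightarrow> degree (line_poly h F u v) \<le> d"
  using reciprocal_line_poly[of n d F h v u] by (simp add: reciprocal_def)

lemma coeff_line_poly_swap:
  "form n d F \<Longrightarrow> k \<le> d \<Longrightarrow> coeff (line_poly h F u v) k = coeff (line_poly h F v u) (d - k)"
  using reciprocal_line_poly[of n d F h u v] by (simp add: reciprocal_def)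

lemma coeff_0_line_poly:
  assumes "ring_morphism h"
  shows "coeff (line_poly h F u v) 0 = mp_eval h u F"
  using poly_line_poly[OF assms, of F u v 0] by (simp add: poly_0_coeff_0)

text \<open>Index 1 is the derivative at \<open>0\<close>, so this is the product rule for the
  factors \<open>u i + s v i\<close>. A truncated exponent does no harm, as it comes with the factor
  \<open>of_nat 0\<close>.\<close>

lemma coeff_1_mon:
  fixes u v :: "nat \<Rightarrow> 'b::idom"
  assumes "Poly_Mapping.keys m \<subseteq> {..n}"
  shows "coeff (mon (\<lambda>i. [:u i, v i:]) m) 1
    = (\<Sum>i\<le>n. v i * (of_nat (Poly_Mapping.lookup m i) * mon u (m - Poly_Mapping.single i 1)))"
proof -
  have c1: "coeff p 1 = poly (pderiv p) 0" for p :: "'b poly"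
    by (simp add: poly_0_coeff_0 coeff_pderiv)
  have "coeff (mon (\<lambda>i. [:u i, v i:]) m) 1
      = poly (pderiv (\<Prod>i\<le>n. [:u i, v i:] ^ Poly_Mapping.lookup m i)) 0"
    using assms unfolding c1 by (simp add: mon_superset[of "{..n}"])
  also have "\<dots> = (\<Sum>i\<le>n. (\<Prod>j\<in>{..n} - {i}. u j ^ Poly_Mapping.lookup m j)
        * (of_nat (Poly_Mapping.lookup m i) * u i ^ (Poly_Mapping.lookup m i - 1) * v i))"
    by (simp add: pderiv_prod poly_sum poly_prod pderiv_power pderiv_pCons algebra_simps)
  also have "\<dots> = (\<Sum>i\<le>n. v i * (of_nat (Poly_Mapping.lookup m i) * mon u (m - Poly_Mapping.single i 1)))"
  proof (rule sum.cong[OF refl])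
    fix i assume i: "i \<in> {..n}"
    have k: "Poly_Mapping.keys (m - Poly_Mapping.single i 1) \<subseteq> {..n}"
    proof
      fix j assume "j \<in> Poly_Mapping.keys (m - Poly_Mapping.single i 1)"
      then have "Poly_Mapping.lookup m j \<noteq> 0" by (auto simp: in_keys_iff lookup_minus)
      then have "j \<in> Poly_Mapping.keys m" by (simp add: in_keys_iff)
      then show "j \<in> {..n}" using assms by blast
    qed
    have "mon u (m - Poly_Mapping.single i 1)
        = u i ^ (Poly_Mapping.lookup m i - 1) * (\<Prod>j\<in>{..n} - {i}. u j ^ Poly_Mapping.lookup m j)"
      using i by (subst mon_superset[OF _ k], simp, subst prod.remove[of "{..n}" i])
        (auto simp: lookup_minus lookup_single when_def intro!: prod.cong)
    then show "(\<Prod>j\<in>{..n} - {i}. u j ^ Poly_Mapping.lookup m j)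
        * (of_nat (Poly_Mapping.lookup m i) * u i ^ (Poly_Mapping.lookup m i - 1) * v i)
        = v i * (of_nat (Poly_Mapping.lookup m i) * mon u (m - Poly_Mapping.single i 1))"
      by (simp add: algebra_simps)
  qed
  finally show ?thesis .
qed

lemma mp_eval_pderiv:
  assumes "ring_morphism (h :: 'a::comm_ring_1 \<Rightarrow> 'b::comm_ring_1)"
  shows "mp_eval h u (mp_pderiv i F) = (\<Sum>m\<in>Poly_Mapping.keys F.
     h (Poly_Mapping.lookup F m) * (of_nat (Poly_Mapping.lookup m i) * mon u (m - Poly_Mapping.single i 1)))"
proof -
  interpret ring_morphism h by fact
  show ?thesis
    by (simp add: mp_pderiv_def mp_eval_sum h_mult h_of_nat algebra_simps)
qed

lemma coeff_1_line_poly: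
  fixes h :: "'a::comm_ring_1 \<Rightarrow> 'b::idom"
  assumes h: "ring_morphism h" and F: "form n d F"
  shows "coeff (line_poly h F u v) 1 = (\<Sum>i\<le>n. v i * mp_eval h u (mp_pderiv i F))"
proof -
  have "coeff (line_poly h F u v) 1 = (\<Sum>m\<in>Poly_Mapping.keys F. h (Poly_Mapping.lookup F m) *
      (\<Sum>i\<le>n. v i * (of_nat (Poly_Mapping.lookup m i) * mon u (m - Poly_Mapping.single i 1))))"
    unfolding line_poly_def mp_eval_mon coeff_sum
    using F coeff_1_mon[of _ n u v] by (intro sum.cong) (auto simp: form_def)
  also have "\<dots> = (\<Sum>i\<le>n. v i * mp_eval h u (mp_pderiv i F))"
    unfolding mp_eval_pderiv[OF h] sum_distrib_left
    by (subst sum.swap) (simp add: algebra_simps)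
  finally show ?thesis .
qed

section \<open>Common zeros of forms\<close>

lemma two_le_card_field: "2 \<le> CARD('a::{field,finite})"
proof -
  have "card {0, 1::'a} \<le> CARD('a)" by (rule card_mono) auto
  then show ?thesis by simp
qed

definition exps :: "nat \<Rightarrow> nat \<Rightarrow> (nat \<Rightarrow>\<^sub>0 nat) set" where
  "exps k D = {m. Poly_Mapping.keys m \<subseteq> {..<k} \<and> mdeg m = D}"

lemma lookup_le_mdeg: "Poly_Mapping.lookup m i \<le> mdeg m"
proof (cases "i \<in> Poly_Mapping.keys m")
  case True
  then show ?thesis unfolding mdeg_def by (intro member_le_sum) auto
qed (auto simp: in_keys_iff)

lemma finite_exps: "finite (exps k D)"
proof -
  have "finite (Poly_Mapping.lookup ` exps k D)"
  proof (rule finite_subset)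
    show "Poly_Mapping.lookup ` exps k D \<subseteq> {f. \<forall>i. (i \<in> {..<k} \<longrightarrow> f i \<in> {..D}) \<and> (i \<notin> {..<k} \<longrightarrow> f i = 0)}"
      using lookup_le_mdeg by (force simp: exps_def in_keys_iff)
    show "finite {f. \<forall>i. (i \<in> {..<k} \<longrightarrow> f i \<in> {..D}) \<and> (i \<notin> {..<k} \<longrightarrow> f i = (0::nat))}"
      by (rule finite_set_of_finite_funs) auto
  qed
  then show ?thesis
    by (rule finite_imageD) (auto simp: inj_on_def intro: poly_mapping_eqI)
qed

lemma exps_plus: "m + m' \<in> exps k D \<longleftrightarrow>
    Poly_Mapping.keys m \<subseteq> {..<k} \<and> Poly_Mapping.keys m' \<subseteq> {..<k} \<and> mdeg m + mdeg m' = D"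
  by (auto simp: exps_def keys_plus_nat mdeg_plus)

text \<open>The exponents of \<open>X\<^sub>1, ..., X\<^sub>k\<^sub>-\<^sub>1\<close> are chosen
  freely up to \<open>t\<close>; their sum is at most \<open>t (k - 1)\<close>, and
  \<open>X\<^sub>0\<close> takes up the rest. Only the order of growth \<open>D^(k - 1)\<close>
  matters later.\<close>

lemma card_exps_ge:
  assumes "k \<ge> 2"
  shows "(t + 1) ^ (k - 1) \<le> card (exps k (t * (k - 1)))"
proof -
  define S where "S = {f. \<forall>i. (i \<in> {1..<k} \<longrightarrow> f i \<in> {..t}) \<and> (i \<notin> {1..<k} \<longrightarrow> f i = (0::nat))}"
  have "bij_betw (\<lambda>f. restrict f {1..<k}) S ({1..<k} \<rightarrow>\<^sub>E {..t})"
    by (intro bij_betwI[where g = "\<lambda>f i. if i \<in> {1..<k} then f i else 0"])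
       (auto simp: S_def PiE_def extensional_def fun_eq_iff restrict_def)
  then have cS: "card S = (t + 1) ^ (k - 1)"
    by (simp add: bij_betw_same_card card_PiE)
  define g where "g f = (\<Sum>i\<in>{1..<k}. Poly_Mapping.single i (f i)) +
      Poly_Mapping.single 0 (t * (k - 1) - (\<Sum>i\<in>{1..<k}. f i))" for f :: "nat \<Rightarrow> nat"
  have lk: "Poly_Mapping.lookup (g f) i = f i" if "i \<in> {1..<k}" for f i
    using that by (simp add: g_def lookup_add lookup_sum lookup_single when_def)
  have inj: "inj_on g S"
  proof (rule inj_onI, rule ext)
    fix f f' i assume a: "f \<in> S" "f' \<in> S" "g f = g f'"
    show "f i = f' i"
    proof (cases "i \<in> {1..<k}")
      case True
      then show ?thesis using lk[OF True, of f] lk[OF True, of f'] a(3) by simp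
    qed (use a in \<open>auto simp: S_def\<close>)
  qed
  have "g f \<in> exps k (t * (k - 1))" if "f \<in> S" for f
  proof -
    have "(\<Sum>i\<in>{1..<k}. f i) \<le> (\<Sum>i\<in>{1..<k}. t)"
      using that by (intro sum_mono) (auto simp: S_def)
    then have le: "(\<Sum>i\<in>{1..<k}. f i) \<le> t * (k - 1)" by (simp add: mult.commute)
    have md: "mdeg (\<Sum>i\<in>A. Poly_Mapping.single i (f i)) = (\<Sum>i\<in>A. f i)" for A
      by (induction A rule: infinite_finite_induct) (auto simp: mdeg_plus)
    have "Poly_Mapping.keys (g f) \<subseteq> {..<k}"
    proof
      fix i assume "i \<in> Poly_Mapping.keys (g f)"
      then have "Poly_Mapping.lookup (g f) i \<noteq> 0" by (simp add: in_keys_iff)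
      then show "i \<in> {..<k}" using assms
        by (cases "i < k") (auto simp: g_def lookup_add lookup_sum lookup_single when_def)
    qed
    then show ?thesis using le by (simp add: exps_def g_def mdeg_plus md)
  qed
  then have "card S \<le> card (exps k (t * (k - 1)))"
    by (intro card_inj_on_le[OF inj]) (auto simp: finite_exps)
  then show ?thesis by (simp add: cS)
qed

text \<open>Macaulay duality: a function on the monomials of degree \<open>D\<close> is a linear functional on
  the forms of that degree, and a form acts by contraction.\<close>

definition dual_forms :: "nat \<Rightarrow> nat \<Rightarrow> ((nat \<Rightarrow>\<^sub>0 nat) \<Rightarrow> 'b::comm_ring_1) set" where
  "dual_forms k D = {c. \<forall>m. m \<notin> exps k D \<longrightarrow> c m = 0}"

definition contract :: "nat \<Rightarrow> nat \<Rightarrow> ((nat \<Rightarrow>\<^sub>0 nat) \<Rightarrow> 'b::comm_ring_1) \<Rightarrow> ((nat \<Rightarrow>\<^sub>0 nat) \<Rightarrow> 'b) \<Rightarrow> (nat \<Rightarrow>\<^sub>0 nat) \<Rightarrow> 'b" where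
  "contract k e a c = (\<lambda>m. \<Sum>\<mu>\<in>exps k e. a \<mu> * c (\<mu> + m))"

text \<open>Contraction by the variable \<open>X\<^sub>i\<close>, the transpose of multiplication by
  it.\<close>

definition shift :: "nat \<Rightarrow> ((nat \<Rightarrow>\<^sub>0 nat) \<Rightarrow> 'b) \<Rightarrow> (nat \<Rightarrow>\<^sub>0 nat) \<Rightarrow> 'b" where
  "shift i c = (\<lambda>m. c (Poly_Mapping.single i 1 + m))"

section \<open>Contraction and shift operators\<close>

lemma contract_dual_forms:
  assumes "c \<in> dual_forms k D"
  shows "contract k e a c \<in> dual_forms k (D - e)" and "D < e \<Longrightarrow> contract k e a c = 0"
proof -
  have *: "contract k e a c m = 0" if "m \<notin> exps k (D - e) \<or> D < e" for m
    unfolding contract_def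
  proof (rule sum.neutral, rule ballI)
    fix \<mu> assume "\<mu> \<in> exps k e"
    then have "\<mu> + m \<notin> exps k D" using that unfolding exps_plus by (auto simp: exps_def)
    then show "a \<mu> * c (\<mu> + m) = 0" using assms by (simp add: dual_forms_def)
  qed
  then show "contract k e a c \<in> dual_forms k (D - e)" and "D < e \<Longrightarrow> contract k e a c = 0"
    by (auto simp: dual_forms_def fun_eq_iff)
qed

lemma shift_dual_forms: "i < k \<Longrightarrow> c \<in> dual_forms k (Suc D) \<Longrightarrow> shift i c \<in> dual_forms k D"
proof -
  assume a: "i < k" "c \<in> dual_forms k (Suc D)"
  have "c (Poly_Mapping.single i 1 + m) = 0" if "m \<notin> exps k D" for m
  proof -
    have "Poly_Mapping.single i 1 + m \<notin> exps k (Suc D)"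
      using that unfolding exps_plus by (auto simp: exps_def)
    then show ?thesis using a(2) by (simp add: dual_forms_def)
  qed
  then show ?thesis unfolding dual_forms_def shift_def by blast
qed

lemma contract_shift: "contract k e a (shift i c) = shift i (contract k e a c)"
  by (simp add: contract_def shift_def add_ac)

lemma contract_diff: "contract k e a (c - c') = contract k e a c - contract k e a c'"
  by (simp add: contract_def fun_eq_iff right_diff_distrib sum_subtractf)

lemma contract_add: "contract k e a (c + c') = contract k e a c + contract k e a c'"
  by (simp add: contract_def fun_eq_iff distrib_left sum.distrib)

lemma contract_scale: "contract k e a (\<lambda>m. s * c m) = (\<lambda>m. s * contract k e a c m)"
  by (simp add: contract_def fun_eq_iff sum_distrib_left mult_ac)

lemma contract_0 [simp]: "contract k e a 0 = 0"
  by (simp add: contract_def fun_eq_iff)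

lemma shift_commute: "shift i (shift j c) = shift j (shift i c)"
  by (simp add: shift_def fun_eq_iff add_ac)

lemma shift_diff: "shift i (c - c') = shift i c - shift i (c' :: _ \<Rightarrow> 'b::ab_group_add)"
  by (simp add: shift_def fun_eq_iff)

lemma shift_add: "shift i (c + c') = shift i c + shift i (c' :: _ \<Rightarrow> 'b::ab_group_add)"
  by (simp add: shift_def fun_eq_iff)

lemma shift_scale: "shift i (\<lambda>m. s * c m) = (\<lambda>m. s * shift i c m)"
  by (simp add: shift_def)

lemma shift_0 [simp]: "shift i 0 = 0"
  by (simp add: shift_def fun_eq_iff)

text \<open>Every monomial of positive degree is divisible by a variable. Repeated use brings a
  nonzero functional down to any smaller degree.\<close>

lemma dual_forms_nonzero_shift:
  assumes "c \<in> dual_forms k (Suc D)" "c \<noteq> 0"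
  shows "\<exists>i<k. shift i c \<noteq> 0"
proof -
  obtain m where m: "c m \<noteq> 0" using assms(2) by (auto simp: fun_eq_iff)
  then have me: "m \<in> exps k (Suc D)" using assms(1) by (auto simp: dual_forms_def)
  then have "m \<noteq> 0" by (auto simp: exps_def)
  then obtain i where i: "i \<in> Poly_Mapping.keys m" by fastforce
  have "Poly_Mapping.single i 1 + (m - Poly_Mapping.single i 1) = m"
    using i by (intro poly_mapping_eqI) (auto simp: lookup_add lookup_minus lookup_single when_def in_keys_iff)
  then have "shift i c (m - Poly_Mapping.single i 1) \<noteq> 0" using m by (simp add: shift_def)
  then show ?thesis using i me by (auto simp: exps_def fun_eq_iff)
qed

lemma dual_forms_diff: "c \<in> dual_forms k D \<Longrightarrow> c' \<in> dual_forms k D \<Longrightarrow> c - c' \<in> dual_forms k D"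
  by (auto simp: dual_forms_def)

lemma dual_forms_fun_set:
  "(dual_forms k D :: (_ \<Rightarrow> 'a::comm_ring_1) set) =
    {f. \<forall>m. (m \<in> exps k D \<longrightarrow> f m \<in> UNIV) \<and> (m \<notin> exps k D \<longrightarrow> f m = 0)}"
  by (auto simp: dual_forms_def)

lemma finite_dual_forms: "finite (dual_forms k D :: (_ \<Rightarrow> 'a::{comm_ring_1,finite}) set)"
  unfolding dual_forms_fun_set by (rule finite_set_of_finite_funs) (auto simp: finite_exps)

lemma card_dual_forms: "card (dual_forms k D :: (_ \<Rightarrow> 'a::{comm_ring_1,finite}) set) = CARD('a) ^ card (exps k D)"
proof -
  have "bij_betw (\<lambda>f. restrict f (exps k D)) (dual_forms k D :: (_ \<Rightarrow> 'a) set) (exps k D \<rightarrow>\<^sub>E UNIV)"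
    by (intro bij_betwI[where g = "\<lambda>f i. if i \<in> exps k D then f i else 0"])
       (auto simp: dual_forms_def PiE_def extensional_def fun_eq_iff restrict_def)
  then show ?thesis by (simp add: bij_betw_same_card card_PiE finite_exps)
qed

text \<open>Each fibre of \<open>\<phi>\<close> on \<open>A\<close> lies in a translate of
  \<open>K\<close>. This replaces the count by kernel and image of a homomorphism, and asks for no
  group structure on \<open>A\<close> or on the target.\<close>

lemma card_le_mult_kernel:
  fixes \<phi> :: "'x::ab_group_add \<Rightarrow> 'y"
  assumes "finite B" "finite K" "\<phi> ` A \<subseteq> B" "\<And>a a'. a \<in> A \<Longrightarrow> a' \<in> A \<Longrightarrow> \<phi> a = \<phi> a' \<Longrightarrow> a - a' \<in> K"
  shows "card A \<le> card K * card B"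
proof -
  have "card {a\<in>A. \<phi> a = b} \<le> card K" for b
  proof (cases "{a\<in>A. \<phi> a = b} = {}")
    case False
    then obtain a' where a': "a' \<in> A" "\<phi> a' = b" by blast
    have "(\<lambda>a. a - a') ` {a\<in>A. \<phi> a = b} \<subseteq> K"
    proof
      fix x assume "x \<in> (\<lambda>a. a - a') ` {a\<in>A. \<phi> a = b}"
      then obtain a where "a \<in> A" "\<phi> a = b" "x = a - a'" by auto
      then show "x \<in> K" using a' assms(4)[of a a'] by simp
    qed
    then show ?thesis
      using card_inj_on_le[of "\<lambda>a. a - a'", OF _ _ assms(2)] by (simp add: inj_on_def)
  next
    case True then show ?thesis by (metis card.empty le0)
  qed
  note fibre = this
  have "A = (\<Union>b\<in>B. {a\<in>A. \<phi> a = b})" using assms(3) by auto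
  then have "card A \<le> (\<Sum>b\<in>B. card {a\<in>A. \<phi> a = b})"
    using card_UN_le[OF assms(1)] by metis
  also have "\<dots> \<le> (\<Sum>b\<in>B. card K)" by (intro sum_mono fibre)
  finally show ?thesis by (simp add: mult.commute)
qed

text \<open>The degree \<open>D\<close> part of Macaulay's inverse system: the functionals vanishing
  on the degree \<open>D\<close> part of the ideal generated by \<open>a 0, ..., a (r - 1)\<close>,
  that is, the dual of the quotient ring in that degree.\<close>

definition inverse_system :: "nat \<Rightarrow> nat \<Rightarrow> (nat \<Rightarrow> (nat \<Rightarrow>\<^sub>0 nat) \<Rightarrow> 'b::comm_ring_1) \<Rightarrow> nat \<Rightarrow> nat \<Rightarrow> ((nat \<Rightarrow>\<^sub>0 nat) \<Rightarrow> 'b) set" where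
  "inverse_system k e a r D = {c \<in> dual_forms k D. \<forall>i<r. contract k e (a i) c = 0}"

lemma finite_inverse_system: "finite (inverse_system k e (a :: nat \<Rightarrow> _ \<Rightarrow> 'a::{comm_ring_1,finite}) r D)"
  unfolding inverse_system_def by (rule finite_subset[OF _ finite_dual_forms]) auto

lemma contract_commute: "contract k e a (contract k e b c) = contract k e b (contract k e a c)"
  unfolding contract_def sum_distrib_left
  by (rule ext, subst sum.swap) (simp add: algebra_simps)

text \<open>Contraction by \<open>a i\<close> maps the system of the first \<open>i\<close> forms in
  degree \<open>D\<close> into degree \<open>D - e\<close>, and two elements with the same image
  differ by an element of the system of the first \<open>i + 1\<close> forms. Descending in steps of
  \<open>e\<close> sums these contributions, so each dropped form raises the order of growth of the
  dimension by at most one.\<close>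

lemma inverse_system_growth:
  fixes a :: "nat \<Rightarrow> (nat \<Rightarrow>\<^sub>0 nat) \<Rightarrow> 'a::{field,finite}"
  assumes "\<And>D. D \<ge> D0 \<Longrightarrow> inverse_system k e a r D \<subseteq> {0}" and e: "e \<ge> 1" and "j \<le> r"
  shows "\<exists>C. \<forall>D. card (inverse_system k e a (r - j) D) \<le> CARD('a) ^ (C * (D + 1) ^ j)"
  using \<open>j \<le> r\<close>
proof (induction j)
  case 0
  note q2 = two_le_card_field[where 'a = 'a]
  define C where "C = (\<Sum>D<D0. card (inverse_system k e a r D))"
  have "card (inverse_system k e a r D) \<le> CARD('a) ^ C" for D
  proof (cases "D < D0")
    case True
    then have "card (inverse_system k e a r D) \<le> C"
      unfolding C_def by (intro member_le_sum) auto
    also have "\<dots> \<le> CARD('a) ^ C"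
      by (meson q2 self_le_ge2_pow)
    finally show ?thesis .
  next
    case False
    then have "card (inverse_system k e a r D) \<le> card {0 :: (nat \<Rightarrow>\<^sub>0 nat) \<Rightarrow> 'a}"
      using card_mono[OF _ assms(1)[of D]] by simp
    also have "\<dots> \<le> CARD('a) ^ C" using q2 by simp
    finally show ?thesis .
  qed
  then show ?case by auto
next
  case (Suc j)
  note q2 = two_le_card_field[where 'a = 'a]
  obtain C where C: "\<And>D. card (inverse_system k e a (r - j) D) \<le> CARD('a) ^ (C * (D + 1) ^ j)" using Suc by auto
  define i where "i = r - Suc j"
  have ri: "r - j = Suc i" using Suc.prems by (auto simp: i_def)
  have "card (inverse_system k e a i D) \<le> CARD('a) ^ (C * (D + 1) ^ Suc j)" for D
  proof (induction D rule: less_induct)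
    case (less D)
    show ?case
    proof (cases "D < e")
      case True
      then have "inverse_system k e a i D = inverse_system k e a (r - j) D"
        unfolding ri inverse_system_def using contract_dual_forms(2) by (auto simp: less_Suc_eq)
      moreover have "C * (D + 1) ^ j \<le> C * (D + 1) ^ Suc j" by simp
      ultimately show ?thesis using C[of D]
        by (metis (no_types, lifting) order_trans power_increasing zero_less_card_finite Suc_leI One_nat_def)
    next
      case False
      have "card (inverse_system k e a i D) \<le>
          card (inverse_system k e a (r - j) D) * card (inverse_system k e a i (D - e))"
      proof (rule card_le_mult_kernel[where \<phi> = "contract k e (a i)"])
        show "contract k e (a i) ` inverse_system k e a i D \<subseteq> inverse_system k e a i (D - e)"
          unfolding inverse_system_def
          by (auto simp: contract_dual_forms(1) contract_commute[of k e _ "a i"])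
      next
        fix c c' assume "c \<in> inverse_system k e a i D" "c' \<in> inverse_system k e a i D"
           "contract k e (a i) c = contract k e (a i) c'"
        then show "c - c' \<in> inverse_system k e a (r - j) D"
          unfolding ri inverse_system_def by (auto simp: contract_diff less_Suc_eq dual_forms_diff)
      qed (rule finite_inverse_system)+
      also have "\<dots> \<le> CARD('a) ^ (C * (D + 1) ^ j) * CARD('a) ^ (C * (D - e + 1) ^ Suc j)"
        using C[of D] less.IH[of "D - e"] False e by (intro mult_mono) auto
      also have "\<dots> = CARD('a) ^ (C * ((D + 1) ^ j + (D - e + 1) ^ Suc j))"
        by (simp add: power_add[symmetric] algebra_simps)
      also have "\<dots> \<le> CARD('a) ^ (C * (D + 1) ^ Suc j)"
      proof (rule power_increasing)
        have "(D - e + 1) ^ Suc j \<le> D * (D + 1) ^ j"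
          unfolding power_Suc using False e by (intro mult_mono power_mono) auto
        then show "C * ((D + 1) ^ j + (D - e + 1) ^ Suc j) \<le> C * (D + 1) ^ Suc j" by simp
      qed (use q2 in auto)
      finally show ?thesis .
    qed
  qed
  then show ?case unfolding i_def by blast
qed

text \<open>Otherwise the growth estimate, with all \<open>r\<close> forms dropped, bounds the
  number of monomials of degree \<open>D\<close> in \<open>k\<close> variables by a multiple of
  \<open>(D + 1)^r\<close>. That number has order \<open>D^(k - 1)\<close>, and
  \<open>k - 1 > r\<close>.\<close>

lemma inverse_system_nonzero:
  fixes a :: "nat \<Rightarrow> (nat \<Rightarrow>\<^sub>0 nat) \<Rightarrow> 'a::{field,finite}"
  assumes e: "e \<ge> 1" and k: "k \<ge> r + 2"
  shows "\<exists>D\<ge>D0. \<exists>c\<in>inverse_system k e a r D. c \<noteq> 0"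
proof (rule ccontr)
  assume "\<not> ?thesis"
  then have *: "inverse_system k e a r D \<subseteq> {0}" if "D \<ge> D0" for D using that by blast
  obtain C where C: "\<And>D. card (inverse_system k e a 0 D) \<le> CARD('a) ^ (C * (D + 1) ^ r)"
    using inverse_system_growth[OF * e order_refl] by auto
  note q2 = two_le_card_field[where 'a = 'a]
  \<comment> \<open>The constant is absorbed into \<open>t\<close>: at degree
    \<open>t (k - 1)\<close> the upper bound becomes \<open>t (t + 1)^r\<close>, which is less than
    \<open>(t + 1)^(r + 1)\<close>.\<close>
  define t where "t = C * (k - 1) ^ r"
  have "CARD('a) ^ card (exps k (t * (k - 1))) \<le> CARD('a) ^ (C * (t * (k - 1) + 1) ^ r)"
    using C[of "t * (k - 1)"] card_dual_forms[where 'a = 'a, of k "t * (k - 1)"]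
    by (simp add: inverse_system_def)
  then have "card (exps k (t * (k - 1))) \<le> C * (t * (k - 1) + 1) ^ r"
    using q2 by simp
  then have "(t + 1) ^ (k - 1) \<le> C * (t * (k - 1) + 1) ^ r"
    using card_exps_ge[of k t] k by simp
  also have "\<dots> \<le> C * ((t + 1) * (k - 1)) ^ r"
    using k by (intro mult_left_mono power_mono) auto
  also have "\<dots> = t * (t + 1) ^ r"
  proof -
    have "C * ((t + 1) * (k - 1)) ^ r = (C * (k - 1) ^ r) * (t + 1) ^ r"
      by (simp only: power_mult_distrib mult_ac)
    then show ?thesis by (simp only: t_def[symmetric])
  qed
  also have "\<dots> < (t + 1) ^ Suc r" by simp
  also have "\<dots> \<le> (t + 1) ^ (k - 1)" using k by (intro power_increasing) auto
  finally show False by simp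
qed

section \<open>From large degree to a simultaneous eigenvector\<close>

lemma shift_pow_dual_forms:
  "i < k \<Longrightarrow> c \<in> dual_forms k (D + s) \<Longrightarrow> (shift i ^^ s) c \<in> dual_forms k D"
proof (induction s arbitrary: D)
  case (Suc s)
  then have "(shift i ^^ s) c \<in> dual_forms k (Suc D)" using Suc.IH[of "Suc D"] by simp
  then show ?case using shift_dual_forms[OF Suc.prems(1)] by simp
qed simp

lemma shift_pow_commute: "(shift i ^^ s) (shift j c) = shift j ((shift i ^^ s) c)"
  by (induction s) (auto simp: shift_commute)

lemma shift_pow_pow_commute: "(shift i ^^ s) ((shift j ^^ t) c) = (shift j ^^ t) ((shift i ^^ s) c)"
  by (induction t) (auto simp: shift_pow_commute)

lemma shift_pow_diff: "(shift i ^^ s) (c - c') = (shift i ^^ s) c - (shift i ^^ s) (c' :: _ \<Rightarrow> 'b::ab_group_add)"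
  by (induction s) (simp_all only: funpow.simps comp_apply id_apply shift_diff)

lemma shift_pow_0 [simp]: "(shift i ^^ s) 0 = 0"
  by (induction s) (simp_all only: funpow.simps comp_apply id_apply shift_0)

text \<open>In an inverse system with no bound on the degree, a maximal set \<open>J\<close> of variables can be killed.
  Any variable \<open>p\<close> outside \<open>J\<close> then acts injectively in large degrees, so that the
  pieces have bounded size; pigeonhole on the elements \<open>X\<^sub>i^j X\<^sub>p^(N - j) v\<close> gives the relation in the lemma.\<close>

lemma inverse_system_relations:
  fixes a :: "nat \<Rightarrow> (nat \<Rightarrow>\<^sub>0 nat) \<Rightarrow> 'a::{field,finite}"
  assumes e: "e \<ge> 1" and k: "k \<ge> r + 2"
  shows "\<exists>N p. p < k \<and> (\<forall>D. \<exists>D'\<ge>D. \<exists>v\<in>inverse_system k e a r D'. v \<noteq> 0 \<and>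
     (\<forall>i<k. \<exists>s t. s < t \<and> t \<le> N \<and> (shift i ^^ t) v = (shift i ^^ s) ((shift p ^^ (t - s)) v)))"
proof -
  define G where "G J D = {c \<in> inverse_system k e a r D. \<forall>j\<in>J. shift j c = 0}" for J D
  define NZ where "NZ J \<longleftrightarrow> (\<forall>D. \<exists>c\<in>G J D. c \<noteq> 0)" for J
  have G_shift: "shift i c \<in> G J D" if "c \<in> G J (Suc D)" "i < k" for i c J D
    using that unfolding G_def inverse_system_def
    by (auto simp: shift_dual_forms contract_shift shift_commute[of _ i])
  have G_dual: "c \<in> dual_forms k D" if "c \<in> G J D" for c J D
    using that by (auto simp: G_def inverse_system_def)
  have G_down: "\<exists>c\<in>G J D. c \<noteq> 0" if "c \<in> G J D'" "c \<noteq> 0" "D \<le> D'" for c J D D'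
    using that(3,1,2)
  proof (induction D' arbitrary: c rule: dec_induct)
    case (step D')
    obtain i where "i < k" "shift i c \<noteq> 0"
      using dual_forms_nonzero_shift[OF G_dual[OF step.prems(1)] step.prems(2)] by blast
    then show ?case using step.IH G_shift[OF step.prems(1)] by blast
  qed auto
  have "NZ {}"
    unfolding NZ_def
  proof
    fix D
    obtain D' c where "D' \<ge> D" "c \<in> G {} D'" "c \<noteq> 0"
      using inverse_system_nonzero[OF e k, of D a] by (auto simp: G_def)
    then show "\<exists>c\<in>G {} D. c \<noteq> 0" using G_down by blast
  qed
  have notall: "\<not> NZ {..<k}"
  proof
    assume "NZ {..<k}"
    then obtain c where c: "c \<in> G {..<k} (Suc 0)" "c \<noteq> 0" unfolding NZ_def by blast
    obtain i where "i < k" "shift i c \<noteq> 0"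
      using dual_forms_nonzero_shift[OF G_dual[OF c(1)] c(2)] by blast
    then show False using c(1) by (auto simp: G_def)
  qed
  have fin: "finite {J. J \<subseteq> {..<k} \<and> NZ J}"
    by (rule finite_subset[of _ "Pow {..<k}"]) auto
  have "{} \<in> {J. J \<subseteq> {..<k} \<and> NZ J}" using \<open>NZ {}\<close> by simp
  then have "{J. J \<subseteq> {..<k} \<and> NZ J} \<noteq> {}" by blast
  from finite_has_maximal[OF fin this]
  obtain J where J': "J \<in> {J. J \<subseteq> {..<k} \<and> NZ J}"
    and Jm: "\<forall>J'\<in>{J. J \<subseteq> {..<k} \<and> NZ J}. J \<subseteq> J' \<longrightarrow> J = J'" ..
  have J: "J \<subseteq> {..<k}" "NZ J" using J' by simp_all
  have Jmax: "J = J'" if "J' \<subseteq> {..<k}" "NZ J'" "J \<subseteq> J'" for J'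
    using Jm that by simp
  have "J \<noteq> {..<k}" using notall J by blast
  then obtain p where p: "p < k" "p \<notin> J" using J by blast
  \<comment> \<open>By maximality of \<open>J\<close>, from some degree \<open>D0\<close> on no
    nonzero element of \<open>G J\<close> is killed by \<open>X\<^sub>p\<close>.\<close>
  have "\<not> NZ (insert p J)" using Jmax[of "insert p J"] p J by blast
  then obtain D0 where D0: "\<And>c. c \<in> G (insert p J) D0 \<Longrightarrow> c = 0" unfolding NZ_def by blast
  have inj0: "c = 0" if "c \<in> G J D" "shift p c = 0" "D \<ge> D0" for c D
  proof (rule ccontr)
    assume "c \<noteq> 0"
    moreover have "c \<in> G (insert p J) D" using that by (auto simp: G_def)
    ultimately show False using G_down[OF _ _ that(3), of c "insert p J"] D0 by blast
  qed
  have G_diff: "c - c' \<in> G J D" if "c \<in> G J D" "c' \<in> G J D" for c c' D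
    using that by (auto simp: G_def inverse_system_def dual_forms_diff contract_diff shift_diff)
  have G_fin: "finite (G J D)" for D
    unfolding G_def by (rule finite_subset[OF _ finite_inverse_system[of k e a r D]]) auto
  have G_pow: "(shift i ^^ s) c \<in> G J D" if "c \<in> G J (D + s)" "i < k" for i s c D
    using that
  proof (induction s arbitrary: D)
    case (Suc s)
    then have "(shift i ^^ s) c \<in> G J (Suc D)" by simp
    then show ?case using G_shift Suc.prems by simp
  qed auto
  have inj_pow: "c = 0" if "c \<in> G J (D + s)" "(shift p ^^ s) c = 0" "D \<ge> D0" for c D s
    using that
  proof (induction s arbitrary: c)
    case (Suc s)
    have "shift p c \<in> G J (D + s)" using G_shift[of c J "D + s" p] Suc.prems p by simp
    moreover have "(shift p ^^ s) (shift p c) = 0" using Suc.prems(2) unfolding funpow_Suc_right comp_apply .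
    ultimately have "shift p c = 0" using Suc.IH Suc.prems by blast
    then show ?case using inj0 Suc.prems by (meson le_add1 order_trans)
  qed auto
  \<comment> \<open>Powers of \<open>shift p\<close> embed all higher degrees into degree
    \<open>D0\<close>, so one number bounds all sizes. Its independence of the degree later allows
    passing to eigenvectors at a bounded cost in degree.\<close>
  define N where "N = card (G J D0)"
  have card_le: "card (G J (D0 + s)) \<le> N" for s
    unfolding N_def
  proof (rule card_inj_on_le[where f = "shift p ^^ s"])
    show "inj_on (shift p ^^ s) (G J (D0 + s))"
    proof (rule inj_onI)
      fix c c' assume cc: "c \<in> G J (D0 + s)" "c' \<in> G J (D0 + s)" "(shift p ^^ s) c = (shift p ^^ s) c'"
      then have "(shift p ^^ s) (c - c') = 0" unfolding shift_pow_diff by simp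
      then have "c - c' = 0" by (rule inj_pow[OF G_diff[OF cc(1,2)]]) simp
      then show "c = c'" by simp
    qed
  qed (auto simp: G_pow p G_fin)
  have rel: "\<exists>s t. s < t \<and> t \<le> N \<and> (shift i ^^ t) v = (shift i ^^ s) ((shift p ^^ (t - s)) v)"
    if v: "v \<in> G J (D0 + E + N)" and i: "i < k" for v i E
  proof -
    define \<phi> where "\<phi> j = (shift i ^^ j) ((shift p ^^ (N - j)) v)" for j
    have "\<phi> ` {..N} \<subseteq> G J (D0 + E)"
    proof
      fix x assume "x \<in> \<phi> ` {..N}"
      then obtain j where j: "j \<le> N" "x = \<phi> j" by auto
      have "D0 + E + N = (D0 + E + j) + (N - j)" using j by simp
      then have "(shift p ^^ (N - j)) v \<in> G J (D0 + E + j)" using G_pow v p by metis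
      then show "x \<in> G J (D0 + E)" unfolding j \<phi>_def using G_pow i by blast
    qed
    then have "card (\<phi> ` {..N}) \<le> N"
      using card_mono[OF G_fin] card_le le_trans by blast
    then have "\<not> inj_on \<phi> {..N}" using card_image[of \<phi> "{..N}"] by auto
    then obtain s t where st: "s \<le> N" "t \<le> N" "s < t" "\<phi> s = \<phi> t"
      unfolding inj_on_def by (metis atMost_iff nat_neq_iff)
    \<comment> \<open>The coincidence of two of the \<open>N + 1\<close> elements carries the common
      factor \<open>X\<^sub>p^(N - t)\<close>, which injectivity of \<open>shift p\<close>
      cancels.\<close>
    define c where "c = (shift i ^^ t) v - (shift i ^^ s) ((shift p ^^ (t - s)) v)"
    have "(shift p ^^ (N - t)) c = \<phi> t - \<phi> s"
    proof -
      have "N - s = (N - t) + (t - s)" using st by simp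
      then have "(shift p ^^ (N - s)) v = (shift p ^^ (N - t)) ((shift p ^^ (t - s)) v)"
        by (metis comp_apply funpow_add)
      then show ?thesis
        by (simp add: c_def \<phi>_def shift_pow_diff shift_pow_pow_commute[where i = p and j = i])
    qed
    then have z: "(shift p ^^ (N - t)) c = 0" using st by simp
    have "c \<in> G J (D0 + E + (N - t))"
      unfolding c_def
    proof (rule G_diff)
      show "(shift i ^^ t) v \<in> G J (D0 + E + (N - t))"
        using v st i by (intro G_pow) (auto simp: algebra_simps)
      have "D0 + E + N = (D0 + E + (N - t) + s) + (t - s)" using st by simp
      then have "(shift p ^^ (t - s)) v \<in> G J (D0 + E + (N - t) + s)" using G_pow v p by metis
      then show "(shift i ^^ s) ((shift p ^^ (t - s)) v) \<in> G J (D0 + E + (N - t))"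
        using G_pow i by blast
    qed
    then have "c = 0" using inj_pow z by (meson le_add1)
    then show ?thesis using st by (auto simp: c_def)
  qed
  have "\<exists>D'\<ge>D. \<exists>v\<in>inverse_system k e a r D'. v \<noteq> 0 \<and>
     (\<forall>i<k. \<exists>s t. s < t \<and> t \<le> N \<and> (shift i ^^ t) v = (shift i ^^ s) ((shift p ^^ (t - s)) v))" for D
  proof -
    obtain v where v: "v \<in> G J (D0 + D + N)" "v \<noteq> 0" using J unfolding NZ_def by blast
    have "v \<in> inverse_system k e a r (D0 + D + N)" using v by (simp add: G_def)
    moreover have "D0 + D + N \<ge> D" by simp
    ultimately show ?thesis using v(2) rel[OF v(1)] by blast
  qed
  then show ?thesis using p(1) by blast
qed

text \<open>The form \<open>\<pi>(X\<^sub>i, X\<^sub>p)\<close> obtained from \<open>\<pi>\<close> by homogenization.\<close>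

definition hom_shift :: "nat \<Rightarrow> nat \<Rightarrow> 'b::comm_ring_1 poly \<Rightarrow> ((nat \<Rightarrow>\<^sub>0 nat) \<Rightarrow> 'b) \<Rightarrow> (nat \<Rightarrow>\<^sub>0 nat) \<Rightarrow> 'b" where
  "hom_shift i p \<pi> c = (\<lambda>m. \<Sum>l\<le>degree \<pi>. coeff \<pi> l * (shift i ^^ l) ((shift p ^^ (degree \<pi> - l)) c) m)"

text \<open>Homogenization turns the factor \<open>X - \<alpha>\<close> into the operator
  \<open>X\<^sub>i - \<alpha> X\<^sub>p\<close>.\<close>

lemma hom_shift_linear_factor:
  fixes \<rho> :: "'b::field poly"
  assumes "\<rho> \<noteq> 0"
  shows "hom_shift i p ([:- \<alpha>, 1:] * \<rho>) c =
    shift i (hom_shift i p \<rho> c) - (\<lambda>m. \<alpha> * shift p (hom_shift i p \<rho> c) m)"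
proof (rule ext)
  fix m
  let ?T = "\<lambda>l s. (shift i ^^ l) ((shift p ^^ s) c) m"
  have d: "degree ([:- \<alpha>, 1:] * \<rho>) = Suc (degree \<rho>)"
    using assms by (subst degree_mult_eq) auto
  let ?d = "degree \<rho>"
  have 1: "shift i (hom_shift i p \<rho> c) m = (\<Sum>l\<le>?d. coeff \<rho> l * ?T (Suc l) (?d - l))"
    by (simp add: hom_shift_def shift_def)
  have sp: "shift p ((shift i ^^ l) ((shift p ^^ s) c)) = (shift i ^^ l) ((shift p ^^ (Suc s)) c)" for l s
    by (simp add: shift_pow_commute)
  have 2: "shift p (hom_shift i p \<rho> c) m = (\<Sum>l\<le>?d. coeff \<rho> l * ?T l (Suc (?d - l)))"
    unfolding sp[symmetric] by (simp add: hom_shift_def shift_def)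
  have "hom_shift i p ([:- \<alpha>, 1:] * \<rho>) c m = (\<Sum>l\<le>Suc ?d. coeff ([:- \<alpha>, 1:] * \<rho>) l * ?T l (Suc ?d - l))"
    unfolding hom_shift_def d ..
  also have "\<dots> = (\<Sum>l\<le>Suc ?d. (case l of 0 \<Rightarrow> 0 | Suc l' \<Rightarrow> coeff \<rho> l') * ?T l (Suc ?d - l))
      - (\<Sum>l\<le>Suc ?d. \<alpha> * coeff \<rho> l * ?T l (Suc ?d - l))"
    unfolding sum_subtractf[symmetric]
    by (intro sum.cong refl) (auto simp: coeff_pCons algebra_simps split: nat.splits)
  also have "(\<Sum>l\<le>Suc ?d. (case l of 0 \<Rightarrow> 0 | Suc l' \<Rightarrow> coeff \<rho> l') * ?T l (Suc ?d - l))
      = (\<Sum>l\<le>?d. coeff \<rho> l * ?T (Suc l) (?d - l))"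
    by (subst sum.atMost_Suc_shift) simp
  also have "(\<Sum>l\<le>Suc ?d. \<alpha> * coeff \<rho> l * ?T l (Suc ?d - l))
      = (\<Sum>l\<le>?d. \<alpha> * coeff \<rho> l * ?T l (Suc (?d - l)))"
    by (simp add: coeff_eq_0 Suc_diff_le)
  also have "\<dots> = \<alpha> * (\<Sum>l\<le>?d. coeff \<rho> l * ?T l (Suc (?d - l)))"
    by (simp only: sum_distrib_left mult_ac)
  finally show "hom_shift i p ([:- \<alpha>, 1:] * \<rho>) c m =
      (shift i (hom_shift i p \<rho> c) - (\<lambda>m. \<alpha> * shift p (hom_shift i p \<rho> c) m)) m"
    by (simp add: 1 2)
qed

lemma hom_shift_closed:
  assumes c: "c \<in> M" and zero: "0 \<in> M"
    and shift: "\<And>i c. c \<in> M \<Longrightarrow> shift i c \<in> M"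
    and add: "\<And>c c'. c \<in> M \<Longrightarrow> c' \<in> M \<Longrightarrow> c + c' \<in> M"
    and scale: "\<And>s c. c \<in> M \<Longrightarrow> (\<lambda>m. s * c m) \<in> M"
  shows "hom_shift i p \<pi> c \<in> M"
proof -
  have pw: "(shift i ^^ l) c \<in> M" if "c \<in> M" for i l c
    using that by (induction l) (auto intro: shift)
  have "(\<lambda>m. \<Sum>l\<in>A. coeff \<pi> l * (shift i ^^ l) ((shift p ^^ (degree \<pi> - l)) c) m) \<in> M" if "finite A" for A
    using that
  proof (induction A rule: finite_induct)
    case empty
    then show ?case using zero by (simp add: zero_fun_def)
  next
    case (insert l A)
    have "(\<lambda>m. coeff \<pi> l * (shift i ^^ l) ((shift p ^^ (degree \<pi> - l)) c) m) \<in> M"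
      by (intro scale pw c)
    from add[OF this insert.IH] show ?case using insert.hyps by (simp add: plus_fun_def)
  qed
  then show ?thesis by (simp add: hom_shift_def)
qed

lemma hom_shift_dual_forms:
  assumes "c \<in> dual_forms k (D + degree \<pi>)" "i < k" "p < k"
  shows "hom_shift i p \<pi> c \<in> dual_forms k D"
proof -
  have "(shift i ^^ l) ((shift p ^^ (degree \<pi> - l)) c) \<in> dual_forms k D" if "l \<le> degree \<pi>" for l
  proof -
    have "D + degree \<pi> = D + l + (degree \<pi> - l)" using that by simp
    then show ?thesis using assms shift_pow_dual_forms by metis
  qed
  then show ?thesis unfolding hom_shift_def dual_forms_def by simp
qed

text \<open>The minimal polynomial argument: linear factors are stripped off \<open>\<pi>\<close>
  until the remaining factor no longer kills \<open>v\<close>; the factor removed last supplies the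
  eigenvalue. The degree of \<open>\<rho>\<close> controls how much degree is lost.\<close>

lemma eigenvector_of_relation:
  fixes v :: "(nat \<Rightarrow>\<^sub>0 nat) \<Rightarrow> 'b::alg_closed_field"
  assumes v: "v \<noteq> 0" and \<pi>: "\<pi> \<noteq> 0" "hom_shift i p \<pi> v = 0"
  shows "\<exists>\<rho> \<alpha>. degree \<rho> < degree \<pi> \<and> hom_shift i p \<rho> v \<noteq> 0 \<and>
     shift i (hom_shift i p \<rho> v) = (\<lambda>m. \<alpha> * shift p (hom_shift i p \<rho> v) m)"
  using \<pi>
proof (induction "degree \<pi>" arbitrary: \<pi> rule: less_induct)
  case less
  have "degree \<pi> > 0"
  proof (rule ccontr)
    assume "\<not> degree \<pi> > 0"
    then obtain s where s: "\<pi> = [:s:]" using degree_eq_zeroE by blast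
    then have "hom_shift i p \<pi> v = (\<lambda>m. s * v m)" by (simp add: hom_shift_def)
    then show False using less.prems s v by (auto simp: fun_eq_iff)
  qed
  then obtain \<alpha> where "poly \<pi> \<alpha> = 0" using alg_closed_imp_poly_has_root by blast
  then obtain \<rho> where \<rho>: "\<pi> = [:- \<alpha>, 1:] * \<rho>" by (metis dvdE poly_eq_0_iff_dvd)
  have \<rho>0: "\<rho> \<noteq> 0" using \<rho> less.prems by auto
  then have d: "degree \<pi> = Suc (degree \<rho>)" unfolding \<rho> by (subst degree_mult_eq) auto
  have *: "shift i (hom_shift i p \<rho> v) = (\<lambda>m. \<alpha> * shift p (hom_shift i p \<rho> v) m)"
    using less.prems(2) unfolding \<rho> hom_shift_linear_factor[OF \<rho>0] by (simp add: fun_eq_iff)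
  show ?case
  proof (cases "hom_shift i p \<rho> v = 0")
    case True
    then show ?thesis using less.hyps[of \<rho>] d \<rho>0 by (metis lessI less_Suc_eq)
  qed (use d * in auto)
qed

text \<open>Each variable \<open>X\<^sub>i\<close> of \<open>m\<close> can be traded for
  \<open>\<alpha> i X\<^sub>p\<close>. Thus a simultaneous eigenvector is, up to a scalar,
  evaluation at the point \<open>\<alpha>\<close>.\<close>

lemma eval_from_eigenvector:
  fixes w :: "(nat \<Rightarrow>\<^sub>0 nat) \<Rightarrow> 'b::comm_ring_1"
  assumes eig: "\<And>i. i < k \<Longrightarrow> shift i w = (\<lambda>m. \<alpha> i * shift p w m)"
  shows "Poly_Mapping.keys m \<subseteq> {..<k} \<Longrightarrow>
     w (m + Poly_Mapping.single p s) = mon \<alpha> m * w (Poly_Mapping.single p (s + mdeg m))"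
proof (induction "mdeg m" arbitrary: m s)
  case 0
  then have "m = 0"
    by (metis lookup_le_mdeg le_zero_eq lookup_zero poly_mapping_eqI)
  then show ?case by simp
next
  case (Suc D)
  then have "m \<noteq> 0" by auto
  then obtain i where i: "i \<in> Poly_Mapping.keys m" by fastforce
  define m' where "m' = m - Poly_Mapping.single i 1"
  have m: "m = Poly_Mapping.single i 1 + m'" unfolding m'_def
    using i by (intro poly_mapping_eqI) (auto simp: lookup_add lookup_minus lookup_single when_def in_keys_iff)
  have D: "D = mdeg m'" using Suc.hyps(2) unfolding m by (simp add: mdeg_plus)
  have k': "Poly_Mapping.keys m' \<subseteq> {..<k}" "i < k"
    using Suc.prems unfolding m keys_plus_nat by auto
  have "w (m + Poly_Mapping.single p s) = shift i w (m' + Poly_Mapping.single p s)"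
    unfolding m shift_def by (simp add: add_ac)
  also have "\<dots> = \<alpha> i * shift p w (m' + Poly_Mapping.single p s)" using eig[OF k'(2)] by simp
  also have "shift p w (m' + Poly_Mapping.single p s) = w (m' + Poly_Mapping.single p (Suc s))"
    unfolding shift_def by (metis add.left_commute plus_1_eq_Suc single_add)
  also have "\<dots> = mon \<alpha> m' * w (Poly_Mapping.single p (Suc s + mdeg m'))"
    using Suc.hyps(1)[OF D k'(1)] .
  finally show ?case unfolding m by (simp add: mon_plus mdeg_plus)
qed

text \<open>A functional of large degree annihilated by the forms is turned into a simultaneous
  eigenvector of the shifts, that is, into evaluation at a point; annihilation then says that the
  forms vanish there. The two extra variables come from the growth comparison, which needs
  \<open>k - 1 > r\<close>.\<close>

theorem common_zero_of_forms:
  fixes a :: "nat \<Rightarrow> (nat \<Rightarrow>\<^sub>0 nat) \<Rightarrow> 'a::{field,finite}"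
  assumes e: "e \<ge> 1" and k: "k \<ge> r + 2"
  shows "\<exists>\<alpha> :: nat \<Rightarrow> 'a alg_closure. (\<exists>i<k. \<alpha> i \<noteq> 0) \<and>
     (\<forall>i<r. (\<Sum>\<mu>\<in>exps k e. to_ac (a i \<mu>) * mon \<alpha> \<mu>) = 0)"
proof -
  obtain N p where p: "p < k" and rel: "\<And>D. \<exists>D'\<ge>D. \<exists>v\<in>inverse_system k e a r D'. v \<noteq> 0 \<and>
     (\<forall>i<k. \<exists>s t. s < t \<and> t \<le> N \<and> (shift i ^^ t) v = (shift i ^^ s) ((shift p ^^ (t - s)) v))"
    using inverse_system_relations[OF e k, of a] by metis
  \<comment> \<open>Each of the \<open>k\<close> variables costs at most \<open>N\<close> degrees;
    at least \<open>e\<close> must remain for contraction with the forms to be meaningful.\<close>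
  obtain D v where D: "D \<ge> k * N + e" and v: "v \<in> inverse_system k e a r D" "v \<noteq> 0"
    and "\<forall>i<k. \<exists>s t. s < t \<and> t \<le> N \<and> (shift i ^^ t) v = (shift i ^^ s) ((shift p ^^ (t - s)) v)"
    using rel by blast
  then obtain S T where st: "\<And>i. i < k \<Longrightarrow> S i < T i" "\<And>i. i < k \<Longrightarrow> T i \<le> N"
      "\<And>i. i < k \<Longrightarrow> (shift i ^^ T i) v = (shift i ^^ S i) ((shift p ^^ (T i - S i)) v)"
    by metis
  define b where "b i \<mu> = to_ac (a i \<mu>)" for i \<mu>
  \<comment> \<open>The relation between powers of \<open>X\<^sub>i\<close> and
    \<open>X\<^sub>p\<close>, dehomogenized.\<close>
  define \<pi> where "\<pi> i = monom 1 (T i) - (monom 1 (S i) :: 'a alg_closure poly)" for i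
  have cpi: "coeff (\<pi> i) l = (if l = T i then 1 else if l = S i then -1 else 0)" if "i < k" for i l
    using st(1)[OF that] by (auto simp: \<pi>_def)
  have dpi: "degree (\<pi> i) = T i" if "i < k" for i
  proof (rule antisym)
    show "degree (\<pi> i) \<le> T i" using cpi[OF that] st(1)[OF that] by (intro degree_le) auto
    show "T i \<le> degree (\<pi> i)" using cpi[OF that] by (intro le_degree) auto
  qed
  have hpi: "hom_shift i p (\<pi> i) c = (shift i ^^ T i) c - (shift i ^^ S i) ((shift p ^^ (T i - S i)) c)"
    if i: "i < k" for i c
  proof (rule ext)
    fix m
    have "hom_shift i p (\<pi> i) c m = (\<Sum>l\<in>{S i, T i}. coeff (\<pi> i) l * (shift i ^^ l) ((shift p ^^ (T i - l)) c) m)"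
      unfolding hom_shift_def dpi[OF i] using st(1)[OF i]
      by (intro sum.mono_neutral_right) (auto simp: cpi[OF i])
    then show "hom_shift i p (\<pi> i) c m = ((shift i ^^ T i) c - (shift i ^^ S i) ((shift p ^^ (T i - S i)) c)) m"
      using st(1)[OF i] by (simp add: cpi[OF i])
  qed
  define v0 where "v0 = (\<lambda>m. to_ac (v m))"
  have sh0: "(shift i ^^ l) (\<lambda>m. to_ac (c m)) = (\<lambda>m. to_ac ((shift i ^^ l) c m))"
    for i l and c :: "(nat \<Rightarrow>\<^sub>0 nat) \<Rightarrow> 'a"
    by (induction l) (auto simp: shift_def)
  have ctr0: "contract k e (b l) (\<lambda>m. to_ac (c m)) = (\<lambda>m. to_ac (contract k e (a l) c m))"
    for l and c :: "(nat \<Rightarrow>\<^sub>0 nat) \<Rightarrow> 'a"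
    by (simp add: contract_def b_def to_ac_sum)
  define M where "M I \<alpha> = {w. (\<forall>l<r. contract k e (b l) w = 0) \<and> (\<forall>i<k. hom_shift i p (\<pi> i) w = 0) \<and>
      (\<forall>i<I. shift i w = (\<lambda>m. \<alpha> i * shift p w m))}" for I :: nat and \<alpha>
  have pwadd: "(shift i ^^ l) (c + c') = (shift i ^^ l) c + (shift i ^^ l) c'"
    for i l and c c' :: "(nat \<Rightarrow>\<^sub>0 nat) \<Rightarrow> 'a alg_closure"
    by (induction l) (simp_all only: funpow.simps comp_apply id_apply shift_add)
  have pwscale: "(shift i ^^ l) (\<lambda>m. s * c m) = (\<lambda>m. s * (shift i ^^ l) c m)"
    for i l s and c :: "(nat \<Rightarrow>\<^sub>0 nat) \<Rightarrow> 'a alg_closure"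
    by (induction l) (simp_all only: funpow.simps comp_apply id_apply shift_scale)
  have M_shift: "shift j w \<in> M I \<alpha>" if "w \<in> M I \<alpha>" for j w I \<alpha>
  proof -
    have "hom_shift i p (\<pi> i) (shift j w) = shift j (hom_shift i p (\<pi> i) w)" if "i < k" for i
      by (simp add: hpi[OF that] shift_pow_commute shift_diff)
    moreover have "shift i (shift j w) = (\<lambda>m. \<alpha> i * shift p (shift j w) m)" if "i < I" for i
    proof -
      have "shift i w = (\<lambda>m. \<alpha> i * shift p w m)" using \<open>w \<in> M I \<alpha>\<close> \<open>i < I\<close> by (auto simp: M_def)
      then have "shift j (shift i w) = shift j (\<lambda>m. \<alpha> i * shift p w m)" by simp
      also have "\<dots> = (\<lambda>m. \<alpha> i * shift j (shift p w) m)" by (simp add: shift_scale)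
      finally show ?thesis by (simp add: shift_commute)
    qed
    ultimately show ?thesis using that by (simp add: M_def contract_shift)
  qed
  have M_add: "w + w' \<in> M I \<alpha>" if "w \<in> M I \<alpha>" "w' \<in> M I \<alpha>" for w w' I \<alpha>
  proof -
    have "hom_shift i p (\<pi> i) (w + w') = hom_shift i p (\<pi> i) w + hom_shift i p (\<pi> i) w'" if "i < k" for i
      by (simp add: hpi[OF that] pwadd)
    then show ?thesis using that
      by (auto simp: M_def contract_add shift_add fun_eq_iff algebra_simps)
  qed
  have M_scale: "(\<lambda>m. s * w m) \<in> M I \<alpha>" if "w \<in> M I \<alpha>" for s w I \<alpha>
  proof -
    have "hom_shift i p (\<pi> i) (\<lambda>m. s * w m) = (\<lambda>m. s * hom_shift i p (\<pi> i) w m)" if "i < k" for i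
      by (simp add: hpi[OF that] pwscale fun_eq_iff algebra_simps)
    then show ?thesis using that
      by (auto simp: M_def contract_scale shift_scale fun_eq_iff)
  qed
  have M_0: "0 \<in> M I \<alpha>" for I \<alpha>
    by (auto simp: M_def hpi fun_eq_iff shift_def)
  \<comment> \<open>The variables are treated one at a time. Since \<open>M I \<alpha>\<close> is
    stable under all shifts and linear combinations, the eigenvalue equations already gained survive
    the next step.\<close>
  have "\<exists>\<alpha> D' w. D \<le> D' + I * N \<and> w \<in> dual_forms k D' \<and> w \<noteq> 0 \<and> w \<in> M I \<alpha>" if "I \<le> k" for I
    using that
  proof (induction I)
    case 0
    have "v0 \<in> dual_forms k D" using v by (auto simp: v0_def inverse_system_def dual_forms_def)
    moreover have "v0 \<noteq> 0" using v by (auto simp: v0_def fun_eq_iff)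
    moreover have "v0 \<in> M 0 (\<lambda>_. 0)"
      using v st(3) by (auto simp: M_def v0_def ctr0 hpi sh0 inverse_system_def fun_eq_iff)
    ultimately show ?case by (intro exI[of _ "\<lambda>_. 0"] exI[of _ D] exI[of _ v0]) auto
  next
    case (Suc I)
    then obtain \<alpha> D' w where w: "D \<le> D' + I * N" "w \<in> dual_forms k D'" "w \<noteq> 0" "w \<in> M I \<alpha>"
      using Suc_leD by blast
    have I: "I < k" using Suc.prems by simp
    have "\<pi> I \<noteq> 0" using cpi[OF I, of "T I"] by auto
    moreover have "hom_shift I p (\<pi> I) w = 0" using w I by (auto simp: M_def)
    ultimately obtain \<rho> \<beta> where \<rho>: "degree \<rho> < degree (\<pi> I)" "hom_shift I p \<rho> w \<noteq> 0"
        "shift I (hom_shift I p \<rho> w) = (\<lambda>m. \<beta> * shift p (hom_shift I p \<rho> w) m)"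
      using eigenvector_of_relation[OF w(3)] by blast
    let ?w = "hom_shift I p \<rho> w"
    have "degree \<rho> \<le> N" using \<rho>(1) dpi[OF I] st(2)[OF I] by simp
    moreover have "Suc I * N \<le> k * N" using Suc.prems by (intro mult_right_mono) auto
    ultimately have D'': "D' \<ge> degree \<rho>" "D \<le> (D' - degree \<rho>) + Suc I * N" using w(1) D by auto
    have "?w \<in> dual_forms k (D' - degree \<rho>)"
      using D'' w I p by (intro hom_shift_dual_forms) auto
    moreover have "?w \<in> M I \<alpha>"
      by (rule hom_shift_closed[OF w(4) M_0]) (auto intro: M_shift M_add M_scale)
    then have "?w \<in> M (Suc I) (\<alpha>(I := \<beta>))" using \<rho>(3) by (auto simp: M_def less_Suc_eq)
    ultimately show ?case using D''(2) \<rho>(2) by blast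
  qed
  from this[of k] obtain \<alpha> D' w where w: "D \<le> D' + k * N" "w \<in> dual_forms k D'" "w \<noteq> 0" "w \<in> M k \<alpha>" by blast
  have D'e: "D' \<ge> e" using w(1) D by auto
  have eig: "\<And>i. i < k \<Longrightarrow> shift i w = (\<lambda>m. \<alpha> i * shift p w m)" using w by (auto simp: M_def)
  obtain D'' where D'': "D' = Suc D''" using D'e e by (cases D') auto
  have "shift p w \<noteq> 0"
  proof
    assume "shift p w = 0"
    then have "shift i w = 0" if "i < k" for i using eig[OF that] by (auto simp: fun_eq_iff)
    then show False using dual_forms_nonzero_shift w(2,3) unfolding D'' by blast
  qed
  then obtain m where "shift p w m \<noteq> 0" by (auto simp: fun_eq_iff)
  \<comment> \<open>The equation for \<open>i = p\<close> itself normalizes this coordinate, which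
    makes the point nonzero.\<close>
  moreover have "shift p w m = \<alpha> p * shift p w m" using fun_cong[OF eig[OF p], of m] by simp
  ultimately have "\<alpha> p = 1" by (metis mult_cancel_right1 mult.commute mult_cancel_left)
  have ev: "w (m + Poly_Mapping.single p s) = mon \<alpha> m * w (Poly_Mapping.single p (s + mdeg m))"
    if "Poly_Mapping.keys m \<subseteq> {..<k}" for m s
    using eval_from_eigenvector[OF eig that] .
  obtain m where m: "w m \<noteq> 0" using w(3) by (auto simp: fun_eq_iff)
  then have me: "m \<in> exps k D'" using w(2) by (auto simp: dual_forms_def)
  have \<omega>: "w (Poly_Mapping.single p D') \<noteq> 0"
    using ev[of m 0] m me by (auto simp: exps_def)
  have "(\<Sum>\<mu>\<in>exps k e. to_ac (a l \<mu>) * mon \<alpha> \<mu>) = 0" if "l < r" for l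
  proof -
    have "0 = contract k e (b l) w (Poly_Mapping.single p (D' - e))"
      using w(4) that by (simp add: M_def)
    also have "\<dots> = (\<Sum>\<mu>\<in>exps k e. b l \<mu> * (mon \<alpha> \<mu> * w (Poly_Mapping.single p D')))"
      unfolding contract_def using D'e by (intro sum.cong refl) (auto simp: ev exps_def)
    also have "\<dots> = (\<Sum>\<mu>\<in>exps k e. to_ac (a l \<mu>) * mon \<alpha> \<mu>) * w (Poly_Mapping.single p D')"
      by (simp add: b_def sum_distrib_left mult_ac)
    finally show ?thesis using \<omega> by simp
  qed
  then show ?thesis using \<open>\<alpha> p = 1\<close> p by (intro exI[of _ \<alpha>]) auto
qed

section \<open>Linear algebra over a finite field by counting\<close>

text \<open>As simp rules these would eta-expand sums and differences of vectors.\<close>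

declare plus_fun_apply [simp del] zero_fun_apply [simp del] minus_apply [simp del] uminus_apply [simp del]

lemmas pointwise = fun_eq_iff plus_fun_apply zero_fun_apply minus_apply uminus_apply

definition scl :: "'a::times \<Rightarrow> (nat \<Rightarrow> 'a) \<Rightarrow> nat \<Rightarrow> 'a" (infixr "\<star>" 75) where
  "c \<star> v = (\<lambda>i. c * v i)"

lemma scl_apply [simp]: "(c \<star> v) i = c * v i"
  by (simp add: scl_def)

lemma scl_simps [simp]:
  fixes v :: "nat \<Rightarrow> 'a::comm_ring_1"
  shows "1 \<star> v = v" "0 \<star> v = 0" "c \<star> (0 :: nat \<Rightarrow> 'a) = 0" "a \<star> b \<star> v = (a * b) \<star> v"
  by (auto simp: pointwise)

lemma scl_add: "c \<star> (u + v) = c \<star> u + c \<star> (v :: nat \<Rightarrow> 'a::comm_ring_1)"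
  by (auto simp: pointwise algebra_simps)

lemma add_scl: "(a + b) \<star> v = a \<star> v + b \<star> (v :: nat \<Rightarrow> 'a::comm_ring_1)"
  by (auto simp: pointwise algebra_simps)

text \<open>Vectors are functions on \<open>nat\<close> that vanish from \<open>k\<close> on:
  \<open>mp_eval\<close> applies to them directly, and the set is finite over a finite
  field.\<close>

definition vecs :: "nat \<Rightarrow> (nat \<Rightarrow> 'a::zero) set" where
  "vecs k = {x. \<forall>i\<ge>k. x i = 0}"

lemma vecs_fun_set: "vecs k = {f. \<forall>i. (i \<in> {..<k} \<longrightarrow> f i \<in> UNIV) \<and> (i \<notin> {..<k} \<longrightarrow> f i = 0)}"
  by (auto simp: vecs_def)

lemma finite_vecs: "finite (vecs k :: (nat \<Rightarrow> 'a::{zero,finite}) set)"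
  unfolding vecs_fun_set by (rule finite_set_of_finite_funs) auto

lemma card_vecs: "card (vecs k :: (nat \<Rightarrow> 'a::{zero,finite}) set) = CARD('a) ^ k"
proof -
  have "bij_betw (\<lambda>f. restrict f {..<k}) (vecs k :: (nat \<Rightarrow> 'a) set) ({..<k} \<rightarrow>\<^sub>E UNIV)"
    by (intro bij_betwI[where g = "\<lambda>f i. if i < k then f i else 0"])
       (auto simp: vecs_def PiE_def extensional_def fun_eq_iff restrict_def)
  then show ?thesis by (simp add: bij_betw_same_card card_PiE)
qed

lemma vecs_0: "vecs 0 = {0 :: nat \<Rightarrow> 'a::zero}"
  by (auto simp: vecs_def pointwise)

definition lincomb :: "(nat \<Rightarrow> nat \<Rightarrow> 'a::comm_ring_1) \<Rightarrow> nat \<Rightarrow> (nat \<Rightarrow> 'a) \<Rightarrow> nat \<Rightarrow> 'a" where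
  "lincomb b k t = (\<lambda>i. \<Sum>j<k. t j * b j i)"

lemma lincomb_apply: "lincomb b k t i = (\<Sum>j<k. t j * b j i)"
  by (simp add: lincomb_def)

lemma lincomb_cong: "(\<And>j. j < k \<Longrightarrow> s j = t j) \<Longrightarrow> (\<And>j. j < k \<Longrightarrow> b j = b' j) \<Longrightarrow> lincomb b k s = lincomb b' k t"
  by (simp add: lincomb_def)

lemma lincomb_Suc: "lincomb b (Suc k) t = lincomb b k t + t k \<star> b k"
  by (simp add: lincomb_def pointwise)

lemma lincomb_unit: "j < k \<Longrightarrow> lincomb b k (\<lambda>i. if i = j then 1 else 0) = b j"
  by (simp add: lincomb_def pointwise if_distrib[of "\<lambda>x. x * _"] cong: if_cong)

definition lin_subspace :: "nat \<Rightarrow> (nat \<Rightarrow> 'a::comm_ring_1) set \<Rightarrow> bool" where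
  "lin_subspace N S \<longleftrightarrow> S \<subseteq> vecs N \<and> 0 \<in> S \<and> (\<forall>u\<in>S. \<forall>v\<in>S. u + v \<in> S) \<and> (\<forall>c. \<forall>u\<in>S. c \<star> u \<in> S)"

lemma lin_subspaceD:
  assumes "lin_subspace N S"
  shows "u \<in> S \<Longrightarrow> u \<in> vecs N" "0 \<in> S" "u \<in> S \<Longrightarrow> v \<in> S \<Longrightarrow> u + v \<in> S" "u \<in> S \<Longrightarrow> c \<star> u \<in> S"
  using assms unfolding lin_subspace_def by (auto simp: subset_iff)

lemma lin_subspace_diff:
  fixes S :: "(nat \<Rightarrow> 'a::comm_ring_1) set"
  assumes "lin_subspace N S" "u \<in> S" "v \<in> S" shows "u - v \<in> S"
proof -
  have "u + (-1) \<star> v \<in> S" using assms by (intro lin_subspaceD(3,4)[OF assms(1)])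
  moreover have "u + (-1) \<star> v = u - v" by (simp add: pointwise)
  ultimately show ?thesis by simp
qed

lemma lin_subspace_vecs: "lin_subspace N (vecs N)"
  by (auto simp: lin_subspace_def vecs_def pointwise)

lemma finite_lin_subspace: "lin_subspace N (S :: (nat \<Rightarrow> 'a::{field,finite}) set) \<Longrightarrow> finite S"
  unfolding lin_subspace_def by (meson finite_vecs finite_subset)

lemma lincomb_in_subspace:
  assumes "lin_subspace N S" "\<And>j. j < k \<Longrightarrow> b j \<in> S"
  shows "lincomb b k t \<in> S"
  using assms(2)
proof (induction k)
  case 0
  have "lincomb b 0 t = 0" by (simp add: lincomb_def pointwise)
  then show ?case using lin_subspaceD(2)[OF assms(1)] by simp
next
  case (Suc k)
  then show ?case unfolding lincomb_Suc using lin_subspaceD(3,4)[OF assms(1)] by simp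
qed

text \<open>In this form the size of a span is immediate, and dimension can be handled throughout as
  the exponent of \<open>q\<close> in a cardinality.\<close>

definition indep :: "nat \<Rightarrow> (nat \<Rightarrow> nat \<Rightarrow> 'a::comm_ring_1) \<Rightarrow> bool" where
  "indep k b \<longleftrightarrow> inj_on (lincomb b k) (vecs k)"

lemma truncate_vecs: "(\<lambda>i. if i < k then t i else 0) \<in> vecs k"
  by (simp add: vecs_def)

lemma lincomb_truncate: "lincomb b k (\<lambda>i. if i < k then t i else 0) = lincomb b k t"
  by (rule lincomb_cong) auto

lemma indep_extend:
  fixes b :: "nat \<Rightarrow> nat \<Rightarrow> 'a::field"
  assumes b: "indep k b" and v: "v \<notin> lincomb b k ` vecs k"
  shows "indep (Suc k) (b(k := v))"
proof -
  let ?b = "b(k := v)"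
  have e: "lincomb ?b (Suc k) t = lincomb b k t + t k \<star> v" for t
    unfolding lincomb_Suc by (simp add: lincomb_cong[of k t t ?b b])
  have "s = t" if st: "s \<in> vecs (Suc k)" "t \<in> vecs (Suc k)" "lincomb ?b (Suc k) s = lincomb ?b (Suc k) t" for s t
  proof -
    have eq: "lincomb b k s + s k \<star> v = lincomb b k t + t k \<star> v" using st(3) unfolding e .
    have k: "s k = t k"
    proof (rule ccontr)
      assume ne: "s k \<noteq> t k"
      define r where "r = (\<lambda>i. (t i - s i) / (s k - t k))"
      have "v = lincomb b k r"
      proof (rule ext)
        fix i
        have "lincomb b k s i + s k * v i = lincomb b k t i + t k * v i"
          using fun_cong[OF eq, of i] by (simp add: pointwise)
        then have "v i = (lincomb b k t i - lincomb b k s i) / (s k - t k)"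
          using ne by (simp add: field_simps)
        also have "\<dots> = lincomb b k r i"
          by (simp add: lincomb_def r_def sum_subtractf[symmetric] sum_divide_distrib left_diff_distrib)
        finally show "v i = lincomb b k r i" .
      qed
      also have "\<dots> = lincomb b k (\<lambda>i. if i < k then r i else 0)" by (simp add: lincomb_truncate)
      finally show False using v truncate_vecs by blast
    qed
    have "lincomb b k (\<lambda>i. if i < k then s i else 0) = lincomb b k (\<lambda>i. if i < k then t i else 0)"
      using eq unfolding k lincomb_truncate by simp
    then have "(\<lambda>i. if i < k then s i else 0) = (\<lambda>i. if i < k then t i else 0)"
      using b truncate_vecs unfolding indep_def inj_on_def by blast
    then have lt: "s i = t i" if "i < k" for i using that by (metis (full_types))
    show ?thesis
    proof (rule ext)
      fix i
      show "s i = t i"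
        using lt[of i] k st(1,2) by (cases i k rule: linorder_cases) (auto simp: vecs_def)
    qed
  qed
  then show ?thesis unfolding indep_def by (rule inj_onI)
qed

lemma card_span:
  fixes b :: "nat \<Rightarrow> nat \<Rightarrow> 'a::{field,finite}"
  shows "indep k b \<Longrightarrow> card (lincomb b k ` vecs k) = CARD('a) ^ k"
  by (simp add: indep_def card_image card_vecs)

lemma extend_to_basis:
  fixes b :: "nat \<Rightarrow> nat \<Rightarrow> 'a::{field,finite}"
  assumes S: "lin_subspace N S"
  shows "indep k b \<Longrightarrow> (\<And>j. j < k \<Longrightarrow> b j \<in> S) \<Longrightarrow>
    \<exists>r b'. k \<le> r \<and> indep r b' \<and> (\<forall>j<k. b' j = b j) \<and> (\<forall>j<r. b' j \<in> S) \<and> lincomb b' r ` vecs r = S"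
proof (induction "card S - CARD('a) ^ k" arbitrary: k b rule: less_induct)
  case less
  have sub: "lincomb b k ` vecs k \<subseteq> S"
    using lincomb_in_subspace[OF S] less.prems(2) by blast
  show ?case
  proof (cases "lincomb b k ` vecs k = S")
    case True
    then show ?thesis using less.prems by (intro exI[of _ k] exI[of _ b]) auto
  next
    case False
    then obtain v where v: "v \<in> S" "v \<notin> lincomb b k ` vecs k" using sub by blast
    have "card (lincomb b k ` vecs k) < card S"
      using False sub by (intro psubset_card_mono finite_lin_subspace[OF S]) blast
    then have lt: "CARD('a) ^ k < card S" by (simp add: card_span[OF less.prems(1)])
    have "CARD('a) ^ k < CARD('a) ^ Suc k" using two_le_card_field[where 'a = 'a] by simp
    then have *: "card S - CARD('a) ^ Suc k < card S - CARD('a) ^ k" using lt by linarith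
    have "(b(k := v)) j \<in> S" if "j < Suc k" for j
      using that v less.prems(2)[of j] by (cases "j = k") auto
    from less.hyps[OF * indep_extend[OF less.prems(1) v(2)] this]
    obtain r b' where r: "Suc k \<le> r" "indep r b'" "\<forall>j<Suc k. b' j = (b(k := v)) j"
      "\<forall>j<r. b' j \<in> S" "lincomb b' r ` vecs r = S" by blast
    have "b' j = b j" if "j < k" for j
      using r(3)[rule_format, of j] that by simp
    then show ?thesis using r(1,2,4,5) by (metis Suc_leD)
  qed
qed

lemma indep_0: "indep 0 b"
  by (simp add: indep_def vecs_0)

lemma basis_exists:
  fixes S :: "(nat \<Rightarrow> 'a::{field,finite}) set"
  assumes "lin_subspace N S"
  obtains r b where "indep r b" "\<And>j. j < r \<Longrightarrow> b j \<in> S" "lincomb b r ` vecs r = S" "card S = CARD('a) ^ r"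
proof -
  obtain r b' where "indep r b'" "\<forall>j<r. b' j \<in> S" "lincomb b' r ` vecs r = S"
    using extend_to_basis[OF assms indep_0] by blast
  then show ?thesis using that card_span by metis
qed

lemma card_power_inject: "CARD('a::{field,finite}) ^ i = CARD('a) ^ j \<longleftrightarrow> i = j"
  using two_le_card_field[where 'a = 'a] by simp

section \<open>Polynomial functions and the Schwartz--Zippel bound\<close>

text \<open>Functions given by polynomials of total degree at most \<open>e\<close>, expanded in the
  last variable with coefficients of degree at most \<open>e - i\<close>. The recursion is the one
  on which the Schwartz--Zippel induction runs.\<close>

primrec poly_fun :: "nat \<Rightarrow> nat \<Rightarrow> ((nat \<Rightarrow> 'a::comm_ring_1) \<Rightarrow> 'a) \<Rightarrow> bool" where
  "poly_fun 0 e f \<longleftrightarrow> (\<exists>c. f = (\<lambda>t. c))"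
| "poly_fun (Suc k) e f \<longleftrightarrow>
     (\<exists>g. (\<forall>i\<le>e. poly_fun k (e - i) (g i)) \<and> f = (\<lambda>t. \<Sum>i\<le>e. g i t * t k ^ i))"

lemma poly_fun_zero: "poly_fun k e (\<lambda>t. 0)"
proof (induction k arbitrary: e)
  case (Suc k)
  then show ?case by (auto intro!: exI[of _ "\<lambda>i t. 0"])
qed auto

lemma poly_fun_add: "poly_fun k e f \<Longrightarrow> poly_fun k e g \<Longrightarrow> poly_fun k e (\<lambda>t. f t + g t)"
proof (induction k arbitrary: e f g)
  case (Suc k)
  then obtain f' g' where "\<forall>i\<le>e. poly_fun k (e - i) (f' i)" "f = (\<lambda>t. \<Sum>i\<le>e. f' i t * t k ^ i)"
     "\<forall>i\<le>e. poly_fun k (e - i) (g' i)" "g = (\<lambda>t. \<Sum>i\<le>e. g' i t * t k ^ i)" by auto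
  then show ?case using Suc.IH
    by (auto intro!: exI[of _ "\<lambda>i t. f' i t + g' i t"] simp: sum.distrib algebra_simps)
qed auto

lemma poly_fun_scale: "poly_fun k e f \<Longrightarrow> poly_fun k e (\<lambda>t. c * f t)"
proof (induction k arbitrary: e f)
  case (Suc k)
  then obtain f' where "\<forall>i\<le>e. poly_fun k (e - i) (f' i)" "f = (\<lambda>t. \<Sum>i\<le>e. f' i t * t k ^ i)" by auto
  then show ?case using Suc.IH
    by (auto intro!: exI[of _ "\<lambda>i t. c * f' i t"] simp: sum_distrib_left algebra_simps)
qed auto

lemma poly_fun_mono: "poly_fun k e f \<Longrightarrow> e \<le> e' \<Longrightarrow> poly_fun k e' f"
proof (induction k arbitrary: e e' f)
  case (Suc k)
  then obtain f' where f': "\<forall>i\<le>e. poly_fun k (e - i) (f' i)" "f = (\<lambda>t. \<Sum>i\<le>e. f' i t * t k ^ i)" by auto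
  define g where "g i = (if i \<le> e then f' i else (\<lambda>t. 0))" for i
  have "f = (\<lambda>t. \<Sum>i\<le>e'. g i t * t k ^ i)"
  proof
    fix t
    show "f t = (\<Sum>i\<le>e'. g i t * t k ^ i)" unfolding f'(2)
      by (rule sum.mono_neutral_cong_left) (use Suc.prems(2) in \<open>auto simp: g_def\<close>)
  qed
  moreover have "poly_fun k (e' - i) (g i)" if "i \<le> e'" for i
  proof (cases "i \<le> e")
    case True
    then have "poly_fun k (e - i) (f' i)" using f'(1) by blast
    then have "poly_fun k (e' - i) (f' i)" by (rule Suc.IH) (use Suc.prems(2) in auto)
    then show ?thesis using True by (simp add: g_def)
  qed (simp add: g_def poly_fun_zero)
  ultimately show ?case by auto
qed auto

lemma poly_fun_sum: "(\<And>i. i \<in> A \<Longrightarrow> poly_fun k e (f i)) \<Longrightarrow> poly_fun k e (\<lambda>t. \<Sum>i\<in>A. f i t)"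
  by (induction A rule: infinite_finite_induct) (auto intro: poly_fun_add poly_fun_zero)

lemma poly_fun_const: "poly_fun k e (\<lambda>t. c)"
proof (induction k arbitrary: e)
  case (Suc k)
  have "(\<lambda>t. c) = (\<lambda>t :: nat \<Rightarrow> 'a. \<Sum>i\<le>e. (if i = 0 then c else 0) * t k ^ i)"
    by (simp add: if_distrib[of "\<lambda>x. x * _"] cong: if_cong)
  moreover have "poly_fun k (e - i) (\<lambda>t. if i = 0 then c else 0)" for i
    using Suc by (cases "i = 0") (auto simp: poly_fun_zero)
  ultimately show ?case by (auto intro!: exI[of _ "\<lambda>i t. if i = 0 then c else 0"])
qed auto

lemma poly_fun_mult_var: "poly_fun k e f \<Longrightarrow> j < k \<Longrightarrow> poly_fun k (Suc e) (\<lambda>t. t j * f t)"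
proof (induction k arbitrary: e f)
  case (Suc k)
  then obtain f' where f': "\<forall>i\<le>e. poly_fun k (e - i) (f' i)" "f = (\<lambda>t. \<Sum>i\<le>e. f' i t * t k ^ i)" by auto
  show ?case
  proof (cases "j = k")
    case True
    define g where "g i = (case i of 0 \<Rightarrow> (\<lambda>t. 0) | Suc i' \<Rightarrow> f' i')" for i
    have "(\<lambda>t. t j * f t) = (\<lambda>t. \<Sum>i\<le>Suc e. g i t * t k ^ i)"
      unfolding f'(2) True by (subst sum.atMost_Suc_shift) (simp add: g_def sum_distrib_left algebra_simps)
    moreover have "poly_fun k (Suc e - i) (g i)" if "i \<le> Suc e" for i
      using that f'(1) by (cases i) (auto simp: g_def poly_fun_zero)
    ultimately show ?thesis by auto
  next
    case False
    define g where "g i = (if i \<le> e then (\<lambda>t. t j * f' i t) else (\<lambda>t. 0))" for i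
    have "(\<lambda>t. t j * f t) = (\<lambda>t. \<Sum>i\<le>Suc e. g i t * t k ^ i)"
      unfolding f'(2) by (simp add: g_def sum_distrib_left algebra_simps)
    moreover have "poly_fun k (Suc e - i) (g i)" if "i \<le> Suc e" for i
    proof (cases "i \<le> e")
      case True
      then have "poly_fun k (Suc (e - i)) (\<lambda>t. t j * f' i t)"
        using f'(1) Suc.prems False by (intro Suc.IH) auto
      then show ?thesis using True by (simp add: g_def Suc_diff_le)
    qed (simp add: g_def poly_fun_zero)
    ultimately show ?thesis by auto
  qed
qed auto

lemma poly_fun_mult_lincomb:
  assumes "poly_fun k e f"
  shows "poly_fun k (Suc e) (\<lambda>t. lincomb b k t i * f t)"
proof -
  have "poly_fun k (Suc e) (\<lambda>t. \<Sum>j<k. b j i * (t j * f t))"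
    by (intro poly_fun_sum poly_fun_scale poly_fun_mult_var) (use assms in auto)
  then show ?thesis by (simp add: lincomb_def sum_distrib_left algebra_simps)
qed

lemma poly_fun_cong: "poly_fun k e f \<Longrightarrow> (\<And>j. j < k \<Longrightarrow> s j = t j) \<Longrightarrow> f s = f t"
proof (induction k arbitrary: e f)
  case (Suc k)
  then obtain f' where f': "\<forall>i\<le>e. poly_fun k (e - i) (f' i)" "f = (\<lambda>t. \<Sum>i\<le>e. f' i t * t k ^ i)" by auto
  then have "f' i s = f' i t" if "i \<le> e" for i
    using Suc.IH[of "e - i" "f' i"] Suc.prems(2) that by simp
  then show ?case unfolding f'(2) using Suc.prems(2)[of k] by simp
qed auto

lemma card_poly_roots_le:
  fixes p :: "'a::{field,finite} poly"
  shows "p \<noteq> 0 \<Longrightarrow> card {x. poly p x = 0} \<le> degree p"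
  by (rule card_poly_roots_bound)

text \<open>Let \<open>m\<close> be the largest index whose coefficient \<open>g m\<close> is not
  the zero function. Over a zero of \<open>g m\<close> the fibre has at most \<open>q\<close> zeros,
  over any other point at most \<open>m\<close>; the shares \<open>(e - m) q^k\<close> and
  \<open>m q^k\<close> add up. The factor \<open>CARD('a)\<close> on the left avoids a negative
  exponent for \<open>k = 0\<close>.\<close>

lemma schwartz_zippel:
  fixes f :: "(nat \<Rightarrow> 'a::{field,finite}) \<Rightarrow> 'a"
  assumes "poly_fun k e f" "\<exists>t. f t \<noteq> 0"
  shows "card {t \<in> vecs k. f t = 0} * CARD('a) \<le> e * CARD('a) ^ k"
  using assms
proof (induction k arbitrary: e f)
  case 0
  then obtain c where "f = (\<lambda>t. c)" "c \<noteq> 0" by auto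
  then show ?case by simp
next
  case (Suc k)
  then obtain g where g: "\<forall>i\<le>e. poly_fun k (e - i) (g i)" and f: "f = (\<lambda>t. \<Sum>i\<le>e. g i t * t k ^ i)" by auto
  let ?q = "CARD('a)"
  let ?I = "{i. i \<le> e \<and> (\<exists>t. g i t \<noteq> 0)}"
  have "?I \<noteq> {}"
  proof
    assume "?I = {}"
    then have "g i t = 0" if "i \<le> e" for i t using that by blast
    then show False using Suc.prems(2) unfolding f by simp
  qed
  define m where "m = Max ?I"
  have fin: "finite ?I" by simp
  have "m \<in> ?I" unfolding m_def using Max_in[OF fin \<open>?I \<noteq> {}\<close>] .
  then have m: "m \<le> e" "\<exists>t. g m t \<noteq> 0" by auto
  have gm: "g i t = 0" if "i \<le> e" "m < i" for i t
    using that Max_ge[OF fin, of i] unfolding m_def by (metis (mono_tags, lifting) leD mem_Collect_eq)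
  define Z where "Z = {t \<in> vecs k. g m t = 0}"
  have IH: "card Z * ?q \<le> (e - m) * ?q ^ k"
    unfolding Z_def using Suc.IH g m by blast
  have ft: "f (t(k := x)) = (\<Sum>i\<le>m. g i t * x ^ i)" if "t \<in> vecs k" for t x
  proof -
    have "g i (t(k := x)) = g i t" if "i \<le> e" for i
      by (rule poly_fun_cong[of k "e - i"]) (use g that in auto)
    then have "f (t(k := x)) = (\<Sum>i\<le>e. g i t * x ^ i)" unfolding f by simp
    also have "\<dots> = (\<Sum>i\<le>m. g i t * x ^ i)"
      using m(1) gm by (intro sum.mono_neutral_right) (auto simp: not_le)
    finally show ?thesis .
  qed
  have fibre: "card {x. f (t(k := x)) = 0} \<le> (if t \<in> Z then ?q else m)" if t: "t \<in> vecs k" for t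
  proof (cases "t \<in> Z")
    case True
    then show ?thesis by (simp add: card_mono)
  next
    case False
    then have nz: "g m t \<noteq> 0" using t by (simp add: Z_def)
    define p where "p = (\<Sum>i\<le>m. monom (g i t) i)"
    have cp: "coeff p i = (if i \<le> m then g i t else 0)" for i
      by (simp add: p_def coeff_sum)
    have "p \<noteq> 0" using nz cp[of m] by auto
    moreover have "degree p \<le> m" by (rule degree_le) (simp add: cp)
    moreover have "poly p x = f (t(k := x))" for x
      by (simp add: p_def poly_sum poly_monom ft[OF t])
    ultimately have "card {x. f (t(k := x)) = 0} \<le> m"
      using card_poly_roots_le[of p] by simp
    then show ?thesis using False by simp
  qed
  have bij: "bij_betw (\<lambda>(t, x). t(k := x)) (SIGMA t:vecs k. {x. f (t(k := x)) = 0}) {t \<in> vecs (Suc k). f t = 0}"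
  proof (rule bij_betwI[where g = "\<lambda>t. (t(k := 0), t k)"])
    show "(\<lambda>(t, x). t(k := x)) \<in> (SIGMA t:vecs k. {x. f (t(k := x)) = 0}) \<rightarrow> {t \<in> vecs (Suc k). f t = 0}"
      by (auto simp: vecs_def)
    show "(\<lambda>t. (t(k := 0), t k)) \<in> {t \<in> vecs (Suc k). f t = 0} \<rightarrow> (SIGMA t:vecs k. {x. f (t(k := x)) = 0})"
    proof
      fix t assume t: "t \<in> {t \<in> vecs (Suc k). f t = 0}"
      have "(t(k := 0)) i = 0" if "i \<ge> k" for i
        using t that by (cases "i = k") (auto simp: vecs_def)
      then show "(t(k := 0), t k) \<in> (SIGMA t:vecs k. {x. f (t(k := x)) = 0})"
        using t by (simp add: vecs_def)
    qed
    show "\<And>x. x \<in> (SIGMA t:vecs k. {x. f (t(k := x)) = 0}) \<Longrightarrow> (\<lambda>t. (t(k := 0), t k)) ((\<lambda>(t, x). t(k := x)) x) = x"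
      by (auto simp: vecs_def)
  qed auto
  have "card {t \<in> vecs (Suc k). f t = 0} = (\<Sum>t\<in>vecs k. card {x. f (t(k := x)) = 0})"
    using bij_betw_same_card[OF bij] finite_vecs[where 'a = 'a] by (simp add: card_SigmaI)
  also have "\<dots> \<le> (\<Sum>t\<in>vecs k. if t \<in> Z then ?q else m)" by (intro sum_mono fibre)
  also have "\<dots> \<le> (\<Sum>t\<in>vecs k. (if t \<in> Z then ?q else 0) + m)" by (intro sum_mono) auto
  also have "\<dots> = card Z * ?q + ?q ^ k * m"
  proof -
    have "vecs k \<inter> Z = Z" by (auto simp: Z_def)
    then show ?thesis
      using finite_vecs[where 'a = 'a, of k] by (simp add: sum.distrib card_vecs sum.If_cases)
  qed
  finally have "card {t \<in> vecs (Suc k). f t = 0} \<le> (e - m) * ?q ^ k + ?q ^ k * m" using IH by linarith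
  also have "\<dots> = e * ?q ^ k" proof -
    obtain c where "e = m + c" using m(1) le_Suc_ex by blast
    then show ?thesis by (simp add: add_mult_distrib)
  qed
  finally show ?case by simp
qed

text \<open>The coefficient of \<open>s^j\<close> in \<open>F(v + s l)\<close> has degree
  \<open>j\<close> in \<open>l\<close>. A degree bound valid on all lines through \<open>v\<close>
  thereby becomes a bound on the total degree in the coordinates of \<open>l\<close>.\<close>

lemma poly_fun_coeff_line_poly:
  fixes F :: "'a::comm_ring_1 mpoly"
  shows "poly_fun k j (\<lambda>t. coeff (line_poly id F v (lincomb b k t)) j)"
proof -
  define PF where "PF f \<longleftrightarrow> (\<forall>j. poly_fun k j (\<lambda>t. coeff (f t) j))" for f :: "(nat \<Rightarrow> 'a) \<Rightarrow> 'a poly"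
  have mul: "PF (\<lambda>t. [:a, lincomb b k t i:] * f t)" if "PF f" for a i f
    unfolding PF_def
  proof
    fix j
    show "poly_fun k j (\<lambda>t. coeff ([:a, lincomb b k t i:] * f t) j)"
    proof (cases j)
      case 0
      then show ?thesis using that by (simp add: PF_def poly_fun_scale)
    next
      case (Suc j')
      have "poly_fun k j (\<lambda>t. a * coeff (f t) j + lincomb b k t i * coeff (f t) j')"
        unfolding Suc by (intro poly_fun_add poly_fun_scale poly_fun_mult_lincomb)
          (use that in \<open>auto simp: PF_def\<close>)
      then show ?thesis by (simp add: Suc)
    qed
  qed
  have one: "PF (\<lambda>t. 1)"
    by (auto simp: PF_def poly_fun_const)
  have pow: "PF (\<lambda>t. [:a, lincomb b k t i:] ^ s * f t)" if "PF f" for a i f s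
    using that
  proof (induction s)
    case (Suc s)
    then show ?case using mul[of "\<lambda>t. [:a, lincomb b k t i:] ^ s * f t" a i] by (simp only: power_Suc mult.assoc)
  qed simp
  have prod: "finite A \<Longrightarrow> PF (\<lambda>t. \<Prod>i\<in>A. [:v i, lincomb b k t i:] ^ h i)" for A h
    by (induction A rule: finite_induct) (auto simp: one pow simp del: mult_pCons_left)
  have "PF (\<lambda>t. line_poly id F v (lincomb b k t))"
    unfolding PF_def line_poly_def mp_eval_mon coeff_sum
  proof (intro allI poly_fun_sum)
    fix j m
    have "PF (\<lambda>t. mon (\<lambda>i. [:v i, lincomb b k t i:]) m)" unfolding mon_def by (rule prod) simp
    then show "poly_fun k j (\<lambda>t. coeff ([:id (Poly_Mapping.lookup F m):] * mon (\<lambda>i. [:v i, lincomb b k t i:]) m) j)"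
      by (simp add: PF_def poly_fun_scale)
  qed
  then show ?thesis by (simp add: PF_def)
qed

section \<open>Isotropic subspaces and the upper bound\<close>

lemma poly_zero_if_vanishing:
  fixes p :: "'a::{field,finite} poly"
  assumes "degree p < CARD('a)" "\<And>s. poly p s = 0"
  shows "p = 0"
proof (rule ccontr)
  assume "p \<noteq> 0"
  from card_poly_roots_le[OF this] show False using assms by simp
qed

lemma poly_eq_if_same_values:
  fixes p r :: "'a::{field,finite} poly"
  assumes "degree p < CARD('a)" "degree r < CARD('a)" "\<And>s. poly p s = poly r s"
  shows "p = r"
proof -
  have "degree (p - r) < CARD('a)" using assms by (meson degree_diff_less)
  then have "p - r = 0" by (rule poly_zero_if_vanishing) (simp add: assms(3))
  then show ?thesis by simp
qed

definition adjoin :: "(nat \<Rightarrow> 'a::comm_ring_1) set \<Rightarrow> (nat \<Rightarrow> 'a) \<Rightarrow> (nat \<Rightarrow> 'a) set" where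
  "adjoin S v = {l + c \<star> v | l c. l \<in> S}"

lemma lin_subspace_adjoin:
  assumes S: "lin_subspace N S" and v: "v \<in> vecs N"
  shows "lin_subspace N (adjoin S v)"
  unfolding lin_subspace_def
proof (intro conjI ballI allI)
  show "adjoin S v \<subseteq> vecs N"
  proof
    fix x assume "x \<in> adjoin S v"
    then obtain l c where "x = l + c \<star> v" "l \<in> S" unfolding adjoin_def by blast
    then show "x \<in> vecs N" using lin_subspaceD(1)[OF S] v lin_subspaceD(3,4)[OF lin_subspace_vecs] by blast
  qed
  have "0 = 0 + 0 \<star> v" by (simp add: pointwise)
  then show "0 \<in> adjoin S v" using lin_subspaceD(2)[OF S] unfolding adjoin_def by blast
next
  fix x y assume "x \<in> adjoin S v" "y \<in> adjoin S v"
  then obtain l c l' c' where *: "x = l + c \<star> v" "l \<in> S" "y = l' + c' \<star> v" "l' \<in> S"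
    unfolding adjoin_def by blast
  then have "x + y = (l + l') + (c + c') \<star> v" by (simp add: pointwise algebra_simps)
  then show "x + y \<in> adjoin S v" using lin_subspaceD(3)[OF S] * unfolding adjoin_def by blast
next
  fix a x assume "x \<in> adjoin S v"
  then obtain l c where *: "x = l + c \<star> v" "l \<in> S" unfolding adjoin_def by blast
  then have "a \<star> x = a \<star> l + (a * c) \<star> v" by (simp add: pointwise algebra_simps)
  then show "a \<star> x \<in> adjoin S v" using lin_subspaceD(4)[OF S] * unfolding adjoin_def by blast
qed

lemma card_adjoin:
  fixes S :: "(nat \<Rightarrow> 'a::{field,finite}) set"
  assumes S: "lin_subspace N S" and v: "v \<notin> S"
  shows "card (adjoin S v) = card S * CARD('a)"
proof -
  have "bij_betw (\<lambda>(l, c). l + c \<star> v) (S \<times> UNIV) (adjoin S v)"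
    unfolding bij_betw_def
  proof
    show "inj_on (\<lambda>(l, c). l + c \<star> v) (S \<times> UNIV)"
    proof (rule inj_onI, clarify)
      fix l c l' c' assume l: "l \<in> S" "l' \<in> S" and eq: "l + c \<star> v = l' + c' \<star> v"
      have "c = c'"
      proof (rule ccontr)
        assume ne: "c \<noteq> c'"
        have "v = (1 / (c - c')) \<star> (l' - l)"
        proof (rule ext)
          fix i
          have "l i + c * v i = l' i + c' * v i" using fun_cong[OF eq, of i] by (simp add: pointwise)
          then have "(c - c') * v i = l' i - l i" by (simp add: algebra_simps)
          then show "v i = ((1 / (c - c')) \<star> (l' - l)) i" using ne by (simp add: pointwise field_simps)
        qed
        then show False using v lin_subspaceD(4)[OF S lin_subspace_diff[OF S l(2,1)]] by metis
      qed
      then show "l = l' \<and> c = c'" using eq by simp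
    qed
    show "(\<lambda>(l, c). l + c \<star> v) ` (S \<times> UNIV) = adjoin S v" unfolding adjoin_def by auto
  qed
  from bij_betw_same_card[OF this] show ?thesis by (simp add: card_cartesian_product)
qed

lemma adjoin_contains: "lin_subspace N S \<Longrightarrow> v \<in> adjoin S v"
proof -
  assume "lin_subspace N S"
  moreover have "v = 0 + 1 \<star> v" by simp
  ultimately show ?thesis unfolding adjoin_def using lin_subspaceD(2) by blast
qed

locale finite_form =
  fixes F :: "'a::{field,finite} mpoly" and n d :: nat
  assumes form: "form n d F" and d2: "2 \<le> d"
begin

definition val :: "(nat \<Rightarrow> 'a) \<Rightarrow> 'a" where "val x = mp_eval id x F"

definition L :: "(nat \<Rightarrow> 'a) \<Rightarrow> (nat \<Rightarrow> 'a) \<Rightarrow> 'a poly" where "L u v = line_poly id F u v"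

text \<open>The derivative of \<open>F\<close> at \<open>u\<close> in direction \<open>v\<close>:
  linear in \<open>v\<close>, but homogeneous of degree \<open>d - 1\<close> in
  \<open>u\<close>.\<close>

definition B :: "(nat \<Rightarrow> 'a) \<Rightarrow> (nat \<Rightarrow> 'a) \<Rightarrow> 'a" where "B u v = coeff (L u v) 1"

lemma poly_L: "poly (L u v) s = val (u + s \<star> v)"
  by (simp add: L_def val_def poly_line_poly[OF ring_morphism_id] plus_fun_def)

lemma coeff_0_L: "coeff (L u v) 0 = val u"
  using coeff_0_line_poly[OF ring_morphism_id, of F u v] by (simp add: L_def val_def)

lemma degree_L: "degree (L u v) \<le> d"
  unfolding L_def by (rule degree_line_poly[OF form])

lemma coeff_d_L: "coeff (L u v) d = val v"
  using coeff_line_poly_swap[OF form order_refl, of id u v] coeff_0_L[of v u] by (simp add: L_def)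

text \<open>Exchange of base point and direction. If \<open>val v = 0\<close> this is the leading
  candidate among the coefficients, so tangency at \<open>v\<close> shows up as a drop of the
  degree.\<close>

lemma coeff_d1_L: "coeff (L u v) (d - 1) = B v u"
proof -
  have "d - (d - 1) = 1" using d2 by simp
  then show ?thesis
    using coeff_line_poly_swap[OF form, of "d - 1" id u v] by (simp add: L_def B_def)
qed

lemma B_sum: "B u v = (\<Sum>i\<le>n. v i * mp_eval id u (mp_pderiv i F))"
  unfolding B_def L_def by (rule coeff_1_line_poly[OF ring_morphism_id form])

lemma B_add: "B u (v + w) = B u v + B u w"
  by (simp add: B_sum plus_fun_apply algebra_simps sum.distrib)

lemma B_scl: "B u (c \<star> v) = c * B u v"
  by (simp add: B_sum sum_distrib_left algebra_simps)

lemma B_zero [simp]: "B u 0 = 0"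
  by (simp add: B_sum zero_fun_apply)

lemma B_diff: "B u (v - w) = B u v - B u w"
  by (simp add: B_sum minus_apply algebra_simps sum_subtractf)

lemma val_scl: "val (c \<star> u) = c ^ d * val u"
  unfolding val_def scl_def by (rule form_scale[OF form])

lemma val_0 [simp]: "val 0 = 0"
proof -
  have "val (0 \<star> 0) = 0" unfolding val_scl using d2 by simp
  then show ?thesis by simp
qed

lemma degree_L_isotropic:
  assumes "val v = 0" shows "degree (L u v) \<le> d - 1"
proof (rule degree_le, intro allI impI)
  fix i assume "i > d - 1"
  then consider "i = d" | "i > d" by linarith
  then show "coeff (L u v) i = 0"
    using assms coeff_d_L[of u v] degree_L[of u v] by cases (auto intro: coeff_eq_0)
qed

lemma degree_L_isotropic2:
  assumes "val v = 0" "B v u = 0" shows "degree (L u v) \<le> d - 2"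
proof (rule degree_le, intro allI impI)
  fix i assume "i > d - 2"
  then consider "i = d - 1" | "i > d - 1" by linarith
  then show "coeff (L u v) i = 0"
    using assms coeff_d1_L[of u v] degree_L_isotropic[of v u] by cases (auto intro: coeff_eq_0)
qed

lemma B_scl_left: "B (c \<star> u) v = c ^ (d - 1) * B u v"
proof -
  have "L v (c \<star> u) = pcompose (L v u) [:0, c:]"
  proof -
    have "line_poly id F v (c \<star> u) = mp_eval (\<lambda>a. pcompose [:id a:] [:0, c:]) (\<lambda>i. pcompose [:v i, u i:] [:0, c:]) F"
      by (simp add: line_poly_def pcompose_pCons mult.commute)
    also have "\<dots> = pcompose (line_poly id F v u) [:0, c:]"
      unfolding line_poly_def
      by (rule ring_morphism.mp_eval_comp[symmetric])
         (standard, auto simp: pcompose_add pcompose_mult pcompose_1)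
    finally show ?thesis by (simp add: L_def)
  qed
  then show ?thesis
    using coeff_d1_L[of v "c \<star> u"] coeff_d1_L[of v u] by (simp add: coeff_pcompose_linear)
qed

section \<open>Zeros in cosets of isotropic subspaces\<close>

definition isotropic :: "(nat \<Rightarrow> 'a) set \<Rightarrow> bool" where
  "isotropic S \<longleftrightarrow> lin_subspace (Suc n) S \<and> (\<forall>x\<in>S. val x = 0)"

text \<open>At \<open>s = 1\<close> the line polynomial is the sum of its coefficients. Those beyond
  index \<open>e\<close> vanish, so \<open>val (v + l)\<close> has degree at most \<open>e\<close>
  in the coordinates of \<open>l\<close>.\<close>

lemma coset_zeros_aux:
  assumes S: "lin_subspace (Suc n) S" and v: "\<exists>l\<in>S. val (v + l) \<noteq> 0"
    and e: "\<And>l. l \<in> S \<Longrightarrow> degree (L v l) \<le> e"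
  shows "card {l \<in> S. val (v + l) = 0} * CARD('a) \<le> e * card S"
proof -
  obtain k b where b: "indep k b" "\<And>j. j < k \<Longrightarrow> b j \<in> S" "lincomb b k ` vecs k = S" "card S = CARD('a) ^ k"
    by (rule basis_exists[OF S]) blast
  define f where "f t = val (v + lincomb b k t)" for t
  have inS: "lincomb b k t \<in> S" for t using lincomb_in_subspace[OF S b(2)] .
  have "f t = (\<Sum>j\<le>e. coeff (L v (lincomb b k t)) j)" for t
  proof -
    have "f t = poly (L v (lincomb b k t)) 1" by (simp add: poly_L f_def)
    also have "\<dots> = (\<Sum>j\<le>degree (L v (lincomb b k t)). coeff (L v (lincomb b k t)) j)"
      by (simp add: poly_altdef)
    also have "\<dots> = (\<Sum>j\<le>e. coeff (L v (lincomb b k t)) j)"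
      using e[OF inS[of t]] by (intro sum.mono_neutral_left) (auto simp: coeff_eq_0)
    finally show ?thesis .
  qed
  then have f: "f = (\<lambda>t. \<Sum>j\<le>e. coeff (L v (lincomb b k t)) j)" by blast
  have "poly_fun k e f"
    unfolding f L_def
    by (intro poly_fun_sum poly_fun_mono[OF poly_fun_coeff_line_poly]) simp
  moreover have "\<exists>t. f t \<noteq> 0" using v b(3) unfolding f_def by force
  ultimately have "card {t \<in> vecs k. f t = 0} * CARD('a) \<le> e * CARD('a) ^ k" by (rule schwartz_zippel)
  moreover have "card {l \<in> S. val (v + l) = 0} = card {t \<in> vecs k. f t = 0}"
  proof -
    have "{l \<in> S. val (v + l) = 0} = lincomb b k ` {t \<in> vecs k. f t = 0}"
      using b(3) by (auto simp: f_def)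
    moreover have "inj_on (lincomb b k) {t \<in> vecs k. f t = 0}"
      using b(1) unfolding indep_def by (rule inj_on_subset) auto
    ultimately show ?thesis by (simp add: card_image)
  qed
  ultimately show ?thesis using b(4) by simp
qed

lemma coset_zeros:
  assumes S: "isotropic S" and v: "\<exists>l\<in>S. val (v + l) \<noteq> 0"
  shows "card {l \<in> S. val (v + l) = 0} * CARD('a) \<le> (d - 1) * card S"
  using assms degree_L_isotropic by (intro coset_zeros_aux) (auto simp: isotropic_def)

text \<open>If \<open>v\<close> is tangent at all of \<open>S\<close>, the terms of degree
  \<open>d - 1\<close> disappear as well. The improved bound is incompatible with equality and
  yields nondegeneracy in \<open>B_nonzero_exists\<close>.\<close>

lemma coset_zeros_degenerate:
  assumes S: "isotropic S" and v: "\<exists>l\<in>S. val (v + l) \<noteq> 0" and B: "\<And>l. l \<in> S \<Longrightarrow> B l v = 0"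
  shows "card {l \<in> S. val (v + l) = 0} * CARD('a) \<le> (d - 2) * card S"
  using assms degree_L_isotropic2 by (intro coset_zeros_aux) (auto simp: isotropic_def)

definition zeros :: "(nat \<Rightarrow> 'a) set" where "zeros = {x \<in> vecs (Suc n). val x = 0}"

lemma finite_zeros: "finite zeros"
  unfolding zeros_def by (rule finite_subset[OF _ finite_vecs]) auto

text \<open>Both sides count pairs of a vector \<open>l\<close> in \<open>S\<close> and a zero
  \<open>v + l\<close> outside \<open>S\<close>. Summing over vectors rather than cosets avoids
  representatives at the price of the factor \<open>card S\<close>.\<close>

lemma sum_coset_zeros:
  assumes S: "isotropic S"
  shows "(\<Sum>v\<in>vecs (Suc n) - S. card {l \<in> S. val (v + l) = 0}) = card S * (card zeros - card S)"
proof -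
  have Sub: "lin_subspace (Suc n) S" using S by (simp add: isotropic_def)
  note V = lin_subspace_vecs[of "Suc n", where 'a = 'a]
  have fS: "finite S" by (rule finite_lin_subspace[OF Sub])
  have bij: "bij_betw (\<lambda>(v, l). (l, v + l)) (SIGMA v:vecs (Suc n) - S. {l \<in> S. val (v + l) = 0}) (S \<times> (zeros - S))"
  proof (rule bij_betwI[where g = "\<lambda>(l, x). (x - l, l)"])
    show "(\<lambda>(v, l). (l, v + l)) \<in> (SIGMA v:vecs (Suc n) - S. {l \<in> S. val (v + l) = 0}) \<rightarrow> S \<times> (zeros - S)"
    proof (rule funcsetI, elim SigmaE)
      fix p v l assume p: "p = (v, l)" and "v \<in> vecs (Suc n) - S" "l \<in> {l \<in> S. val (v + l) = 0}"
      then have *: "v \<in> vecs (Suc n)" "v \<notin> S" "l \<in> S" "val (v + l) = 0" by auto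
      have "v + l \<in> vecs (Suc n)" using lin_subspaceD(3)[OF V] * lin_subspaceD(1)[OF Sub] by blast
      moreover have "v + l \<notin> S"
      proof
        assume "v + l \<in> S"
        then have "(v + l) - l \<in> S" using lin_subspace_diff[OF Sub] * by blast
        then show False using * by simp
      qed
      ultimately show "(case p of (v, l) \<Rightarrow> (l, v + l)) \<in> S \<times> (zeros - S)" using * p by (simp add: zeros_def)
    qed
    show "(\<lambda>(l, x). (x - l, l)) \<in> S \<times> (zeros - S) \<rightarrow> (SIGMA v:vecs (Suc n) - S. {l \<in> S. val (v + l) = 0})"
    proof (rule funcsetI, elim SigmaE)
      fix p l x assume p: "p = (l, x)" and *: "l \<in> S" and "x \<in> zeros - S"
      then have **: "x \<in> zeros" "x \<notin> S" by auto
      note * = * **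
      have "x - l \<in> vecs (Suc n)" using lin_subspace_diff[OF V] * lin_subspaceD(1)[OF Sub] by (simp add: zeros_def)
      moreover have "x - l \<notin> S"
      proof
        assume "x - l \<in> S"
        then have "(x - l) + l \<in> S" using lin_subspaceD(3)[OF Sub] * by blast
        then show False using * by simp
      qed
      ultimately show "(case p of (l, x) \<Rightarrow> (x - l, l)) \<in> (SIGMA v:vecs (Suc n) - S. {l \<in> S. val (v + l) = 0})"
        using * p by (simp add: zeros_def)
    qed
  qed auto
  have "(\<Sum>v\<in>vecs (Suc n) - S. card {l \<in> S. val (v + l) = 0})
      = card (SIGMA v:vecs (Suc n) - S. {l \<in> S. val (v + l) = 0})"
    using finite_vecs[where 'a = 'a] fS by (subst card_SigmaI) auto
  also have "\<dots> = card (S \<times> (zeros - S))" by (rule bij_betw_same_card[OF bij])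
  also have "\<dots> = card S * (card zeros - card S)"
  proof -
    have "S \<subseteq> zeros" using S lin_subspaceD(1)[OF Sub] by (auto simp: zeros_def isotropic_def)
    then show ?thesis using fS by (simp add: card_cartesian_product card_Diff_subset)
  qed
  finally show ?thesis .
qed

lemma isotropic_subset_zeros: "isotropic S \<Longrightarrow> S \<subseteq> zeros"
  by (auto simp: isotropic_def zeros_def dest: lin_subspaceD(1))

text \<open>A coset of zeros would by homogeneity make the span of \<open>S\<close> and
  \<open>v\<close> isotropic, against maximality.\<close>

lemma coset_nonzero_of_maximal:
  assumes S: "isotropic S" and max: "\<And>S'. isotropic S' \<Longrightarrow> card S' \<le> card S"
    and v: "v \<in> vecs (Suc n)" "v \<notin> S"
  shows "\<exists>l\<in>S. val (v + l) \<noteq> 0"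
proof (rule ccontr)
  assume *: "\<not> (\<exists>l\<in>S. val (v + l) \<noteq> 0)"
  have Sub: "lin_subspace (Suc n) S" using S by (simp add: isotropic_def)
  have "val (l + c \<star> v) = 0" if "l \<in> S" for l c
  proof (cases "c = 0")
    case True
    then show ?thesis using S that by (simp add: isotropic_def)
  next
    case False
    have "l + c \<star> v = c \<star> (v + (1 / c) \<star> l)" using False by (simp add: pointwise field_simps)
    moreover have "val (v + (1 / c) \<star> l) = 0" using * lin_subspaceD(4)[OF Sub that] by blast
    ultimately show ?thesis by (simp add: val_scl)
  qed
  then have "isotropic (adjoin S v)"
    using lin_subspace_adjoin[OF Sub v(1)] unfolding isotropic_def adjoin_def by blast
  then have "card (adjoin S v) \<le> card S" by (rule max)
  then have "card S * CARD('a) \<le> card S" by (simp add: card_adjoin[OF Sub v(2)])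
  moreover have "card S > 0" using lin_subspaceD(2)[OF Sub] finite_lin_subspace[OF Sub] by (auto simp: card_gt_0_iff)
  ultimately show False using two_le_card_field[where 'a = 'a] by simp
qed

text \<open>The coset bounds are summed. Equality of the sums forces equality in every coset, which
  is the second claim.\<close>

lemma zeros_bound:
  assumes S: "isotropic S" and max: "\<And>S'. isotropic S' \<Longrightarrow> card S' \<le> card S"
  shows "card zeros * CARD('a) \<le> card S * CARD('a) + (CARD('a) ^ Suc n - card S) * (d - 1)"
    and "card zeros * CARD('a) = card S * CARD('a) + (CARD('a) ^ Suc n - card S) * (d - 1) \<Longrightarrow>
       v \<in> vecs (Suc n) \<Longrightarrow> v \<notin> S \<Longrightarrow> card {l \<in> S. val (v + l) = 0} * CARD('a) = (d - 1) * card S"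
proof -
  have Sub: "lin_subspace (Suc n) S" using S by (simp add: isotropic_def)
  let ?V = "vecs (Suc n) - S"
  have fV: "finite ?V" using finite_vecs[where 'a = 'a] by auto
  have cS: "card S > 0" using lin_subspaceD(2)[OF Sub] finite_lin_subspace[OF Sub] by (auto simp: card_gt_0_iff)
  have le: "card {l \<in> S. val (v + l) = 0} * CARD('a) \<le> (d - 1) * card S" if "v \<in> ?V" for v
    using coset_zeros[OF S coset_nonzero_of_maximal[OF S max]] that by blast
  have cV: "card ?V = CARD('a) ^ Suc n - card S"
    using lin_subspaceD(1)[OF Sub] finite_lin_subspace[OF Sub]
    by (subst card_Diff_subset) (auto simp: card_vecs)
  have sz: "card S \<le> card zeros" by (rule card_mono[OF finite_zeros isotropic_subset_zeros[OF S]])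
  have sum1: "(\<Sum>v\<in>?V. card {l \<in> S. val (v + l) = 0} * CARD('a)) = card S * ((card zeros - card S) * CARD('a))"
    unfolding sum_distrib_right[symmetric] sum_coset_zeros[OF S] by (simp only: mult.assoc)
  have sum2: "(\<Sum>v\<in>?V. (d - 1) * card S) = card S * ((CARD('a) ^ Suc n - card S) * (d - 1))"
    by (simp only: sum_constant cV of_nat_id mult_ac)
  have "card S * ((card zeros - card S) * CARD('a)) \<le> card S * ((CARD('a) ^ Suc n - card S) * (d - 1))"
    unfolding sum1[symmetric] sum2[symmetric] by (intro sum_mono le)
  then have "(card zeros - card S) * CARD('a) \<le> (CARD('a) ^ Suc n - card S) * (d - 1)" using cS by simp
  then show "card zeros * CARD('a) \<le> card S * CARD('a) + (CARD('a) ^ Suc n - card S) * (d - 1)"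
    using sz by (simp add: diff_mult_distrib)
  assume eq: "card zeros * CARD('a) = card S * CARD('a) + (CARD('a) ^ Suc n - card S) * (d - 1)"
    and v: "v \<in> vecs (Suc n)" "v \<notin> S"
  have "(card zeros - card S) * CARD('a) = (CARD('a) ^ Suc n - card S) * (d - 1)"
    using eq by (simp add: diff_mult_distrib)
  then have "(\<Sum>v\<in>?V. card {l \<in> S. val (v + l) = 0} * CARD('a)) = (\<Sum>v\<in>?V. (d - 1) * card S)"
    unfolding sum1 sum2 by simp
  from sum_mono_inv[OF this le _ fV] show "card {l \<in> S. val (v + l) = 0} * CARD('a) = (d - 1) * card S"
    using v by blast
qed

lemma maximal_isotropic_exists:
  obtains S where "isotropic S" "\<And>S'. isotropic S' \<Longrightarrow> card S' \<le> card S"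
proof -
  have zero: "isotropic {0}"
    by (auto simp: isotropic_def lin_subspace_def vecs_def pointwise)
  have "\<forall>S'. isotropic S' \<longrightarrow> card S' < Suc (card zeros)"
    by (intro allI impI le_imp_less_Suc card_mono finite_zeros isotropic_subset_zeros)
  from ex_has_greatest_nat[OF zero this] obtain S where S: "isotropic S \<and> (\<forall>S'. isotropic S' \<longrightarrow> card S' \<le> card S)"
    by (elim exE)
  show ?thesis by (rule that[of S]) (use S in simp_all)
qed

end

section \<open>Forms attaining the bound\<close>

text \<open>The root \<open>0\<close> is at least double but counts only once.\<close>

lemma card_roots_less_degree:
  fixes p :: "'a::{field,finite} poly"
  assumes p: "p \<noteq> 0" and c: "coeff p 0 = 0" "coeff p 1 = 0"
  shows "card {x. poly p x = 0} < degree p"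
proof -
  have "poly p 0 = 0" using c by (simp add: poly_0_coeff_0)
  then obtain r where r: "p = [:0, 1:] * r" by (metis dvdE minus_zero poly_eq_0_iff_dvd)
  have r0: "r \<noteq> 0" using p r by auto
  have "poly r 0 = 0" using c(2) unfolding r by (simp add: poly_0_coeff_0)
  then have "{x. poly p x = 0} = {x. poly r x = 0}" unfolding r by auto
  moreover have "degree p = Suc (degree r)" unfolding r using r0 by (subst degree_mult_eq) auto
  ultimately show ?thesis using card_poly_roots_le[OF r0] by simp
qed

lemmas (in finite_form) coeff_d1_L' = coeff_d1_L[unfolded One_nat_def]

text \<open>The equality case as a set of axioms. The count is demanded for every isotropic subspace
  of size \<open>q^K\<close> because \<open>S\<close> will be exchanged for one through a prescribed
  isotropic vector.\<close>

locale extremal_form = finite_form F n d for F :: "'a::{field,finite} mpoly" and n d +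
  fixes K :: nat
  assumes dq: "d \<le> CARD('a)" and K1: "1 \<le> K"
    and max_exists: "\<exists>S. isotropic S \<and> card S = CARD('a) ^ K"
    and coset_count: "\<And>S v. isotropic S \<Longrightarrow> card S = CARD('a) ^ K \<Longrightarrow> v \<in> vecs (Suc n) \<Longrightarrow> v \<notin> S \<Longrightarrow>
        card {l \<in> S. val (v + l) = 0} * CARD('a) = (d - 1) * card S"
begin

definition maxiso :: "(nat \<Rightarrow> 'a) set \<Rightarrow> bool" where
  "maxiso S \<longleftrightarrow> isotropic S \<and> card S = CARD('a) ^ K"

lemma maxisoD:
  assumes "maxiso S"
  shows "lin_subspace (Suc n) S" "x \<in> S \<Longrightarrow> val x = 0" "finite S" "card S > 0"
  using assms finite_lin_subspace unfolding maxiso_def isotropic_def by auto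

section \<open>Translations by vectors of a maximal isotropic subspace\<close>

lemma L_zero_of_vanishing:
  assumes "\<And>s. val (u + s \<star> v) = 0" "val v = 0"
  shows "L u v = 0"
  using degree_L_isotropic[OF assms(2), of u] assms(1) dq d2
  by (intro poly_zero_if_vanishing) (auto simp: poly_L)

lemma B_maxiso:
  assumes S: "maxiso S" "l \<in> S" "l' \<in> S"
  shows "B l l' = 0"
proof -
  have "L l l' = 0"
    using S maxisoD[OF S(1)] lin_subspaceD[OF maxisoD(1)[OF S(1)]] by (intro L_zero_of_vanishing) auto
  then show ?thesis by (simp add: B_def)
qed

text \<open>Otherwise the degenerate bound puts \<open>d - 2\<close> in place of the attained
  \<open>d - 1\<close>. That bound needs a nonzero value in the coset, which exists because
  \<open>d - 1 < q\<close>.\<close>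

lemma B_nonzero_exists:
  assumes S: "maxiso S" and v: "v \<in> vecs (Suc n)" "v \<notin> S"
  shows "\<exists>P\<in>S. B P v \<noteq> 0"
proof (rule ccontr)
  assume *: "\<not> (\<exists>P\<in>S. B P v \<noteq> 0)"
  have iso: "isotropic S" and cS: "card S = CARD('a) ^ K" using S by (auto simp: maxiso_def)
  have eq: "card {l \<in> S. val (v + l) = 0} * CARD('a) = (d - 1) * card S"
    by (rule coset_count[OF iso cS v])
  have "\<exists>l\<in>S. val (v + l) \<noteq> 0"
  proof (rule ccontr)
    assume "\<not> (\<exists>l\<in>S. val (v + l) \<noteq> 0)"
    then have "{l \<in> S. val (v + l) = 0} = S" by blast
    then have "CARD('a) = d - 1" using eq maxisoD(4)[OF S] by simp
    then show False using dq d2 by simp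
  qed
  from coset_zeros_degenerate[OF iso this] have "(d - 1) * card S \<le> (d - 2) * card S" using * eq by auto
  then show False using maxisoD(4)[OF S] d2 by simp
qed

text \<open>Each line in direction \<open>P\<close> carries at most \<open>d - 1\<close> zeros, and
  by the count in the coset this is also the average over \<open>l\<close> in \<open>S\<close>.
  Hence no line falls short.\<close>

lemma line_zero_count:
  assumes S: "maxiso S" and v: "v \<in> vecs (Suc n)" "v \<notin> S" and P: "P \<in> S" "B P v \<noteq> 0" and l: "l \<in> S"
  shows "card {s. val (v + l + s \<star> P) = 0} = d - 1"
proof -
  note Sub = maxisoD(1)[OF S] and fS = maxisoD(3)[OF S]
  define a where "a l = card {s. val (v + l + s \<star> P) = 0}" for l
  have le: "a l \<le> d - 1" if "l \<in> S" for l
  proof -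
    have "coeff (L (v + l) P) (d - 1) \<noteq> 0"
      using P(2) B_maxiso[OF S P(1) that] by (simp add: coeff_d1_L coeff_d1_L' B_add)
    then have "L (v + l) P \<noteq> 0" by auto
    from card_poly_roots_le[OF this] have "a l \<le> degree (L (v + l) P)" by (simp add: poly_L a_def)
    also have "\<dots> \<le> d - 1" using maxisoD(2)[OF S P(1)] by (rule degree_L_isotropic)
    finally show ?thesis .
  qed
  have "(\<Sum>l\<in>S. a l) = card (SIGMA l:S. {s. val (v + l + s \<star> P) = 0})"
    unfolding a_def using fS by (subst card_SigmaI) auto
  also have "bij_betw (\<lambda>(l, s). (l + s \<star> P, s)) (SIGMA l:S. {s. val (v + l + s \<star> P) = 0}) ({l \<in> S. val (v + l) = 0} \<times> UNIV)"
    by (rule bij_betwI[where g = "\<lambda>(l, s). (l - s \<star> P, s)"])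
       (use P(1) lin_subspaceD(3,4)[OF Sub] lin_subspace_diff[OF Sub] in \<open>auto simp: add.assoc\<close>)
  from bij_betw_same_card[OF this]
  have "card (SIGMA l:S. {s. val (v + l + s \<star> P) = 0}) = (d - 1) * card S"
    using coset_count[of S, OF _ _ v] S by (simp add: card_cartesian_product maxiso_def)
  finally have "(\<Sum>l\<in>S. a l) = (\<Sum>l\<in>S. d - 1)" by simp
  from sum_mono_inv[OF this le l fS] show ?thesis by (simp add: a_def)
qed

text \<open>In the plane \<open>v + xP + yP\<^sub>0\<close> the zeros form \<open>d - 1\<close> parallel lines: counting on the
  lines through a zero shows that one of them consists of zeros, and two such lines cannot
  meet, since the derivative in direction \<open>P\<^sub>0\<close> would vanish at the common point.\<close>

lemma plane_structure:
  assumes S: "maxiso S" and v: "v \<in> vecs (Suc n)" "v \<notin> S" and P: "P \<in> S" and P0: "P0 \<in> S" "B P0 v \<noteq> 0"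
  shows "\<exists>a. \<forall>x y. val (v + y \<star> P0 + x \<star> (P + a \<star> P0)) = val (v + y \<star> P0)"
proof -
  note Sub = maxisoD(1)[OF S]
  define g where "g x y = val (v + x \<star> P + y \<star> P0)" for x y
  have g_line: "g (x + s) (y + a * s) = val (v + x \<star> P + y \<star> P0 + s \<star> (P + a \<star> P0))" for x y s a
    unfolding g_def by (rule arg_cong[of _ _ val]) (simp add: pointwise algebra_simps)
  have inS: "x \<star> P + y \<star> P0 \<in> S" for x y using lin_subspaceD(3,4)[OF Sub] P P0 by blast
  have vert: "card {y. g x y = 0} = d - 1" for x
    unfolding g_def using line_zero_count[OF S v P0 lin_subspaceD(4)[OF Sub P]] by blast
  have line_iso: "val (P + a \<star> P0) = 0" for a
    using inS[of 1 a] maxisoD(2)[OF S] by simp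
  have line_cases: "(\<forall>s. g (x + s) (y + a * s) = 0) \<or> card {s. g (x + s) (y + a * s) = 0} \<le> d - 1" for x y a
  proof (cases "L (v + x \<star> P + y \<star> P0) (P + a \<star> P0) = 0")
    case True
    then have "poly (L (v + x \<star> P + y \<star> P0) (P + a \<star> P0)) s = 0" for s by simp
    then show ?thesis unfolding poly_L g_line by blast
  next
    case False
    from card_poly_roots_le[OF this] degree_L_isotropic[OF line_iso[of a], of "v + x \<star> P + y \<star> P0"]
    show ?thesis unfolding poly_L g_line by linarith
  qed
  \<comment> \<open>Otherwise each of the \<open>q\<close> lines with a slope through the zero
    carries at most \<open>d - 2\<close> further zeros, while the other \<open>q - 1\<close>
    vertical lines carry \<open>d - 1\<close> each. But
    \<open>(q - 1) (d - 1) - q (d - 2) = q - d + 1\<close> is positive.\<close>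
  have exists_line: "\<exists>a. \<forall>s. g (x + s) (y + a * s) = 0" if z: "g x y = 0" for x y
  proof (rule ccontr)
    assume "\<not> ?thesis"
    then have *: "card {s. g (x + s) (y + a * s) = 0} \<le> d - 1" for a using line_cases by blast
    have **: "card {s. s \<noteq> 0 \<and> g (x + s) (y + a * s) = 0} \<le> d - 2" for a
    proof -
      have "{s. s \<noteq> 0 \<and> g (x + s) (y + a * s) = 0} = {s. g (x + s) (y + a * s) = 0} - {0}" by auto
      then show ?thesis using *[of a] z by (simp add: card_Diff_subset)
    qed
    have bij: "bij_betw (\<lambda>(a, s). (x + s, y + a * s)) (SIGMA a:UNIV. {s. s \<noteq> 0 \<and> g (x + s) (y + a * s) = 0})
       (SIGMA x':UNIV - {x}. {y'. g x' y' = 0})"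
      by (rule bij_betwI[where g = "\<lambda>(x', y'). ((y' - y) / (x' - x), x' - x)"]) auto
    have "card (SIGMA a:(UNIV::'a set). {s. s \<noteq> 0 \<and> g (x + s) (y + a * s) = 0}) \<le> CARD('a) * (d - 2)"
    proof -
      have "card (SIGMA a:(UNIV::'a set). {s. s \<noteq> 0 \<and> g (x + s) (y + a * s) = 0})
         = (\<Sum>a\<in>(UNIV::'a set). card {s. s \<noteq> 0 \<and> g (x + s) (y + a * s) = 0})"
        by (subst card_SigmaI) auto
      also have "\<dots> \<le> (\<Sum>a\<in>(UNIV::'a set). d - 2)" by (intro sum_mono **)
      finally show ?thesis by simp
    qed
    moreover have "card (SIGMA x':UNIV - {x}. {y'. g x' y' = 0}) = (CARD('a) - 1) * (d - 1)"
      by (subst card_SigmaI) (auto simp: vert card_Diff_subset)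
    ultimately have le: "(CARD('a) - 1) * (d - 1) \<le> CARD('a) * (d - 2)" using bij_betw_same_card[OF bij] by simp
    obtain e where e: "d = e + 2" using d2 by (metis add.commute le_Suc_ex)
    obtain r where r: "CARD('a) = r + e + 2" using dq unfolding e by (metis add.assoc add.commute le_Suc_ex)
    show False using le unfolding e r by (simp add: algebra_simps)
  qed
  have parallel: "a = a'" if z: "\<And>s. g (x + s) (y + a * s) = 0" "\<And>s. g (x' + s) (y' + a' * s) = 0" for a a' x y x' y'
  proof (rule ccontr)
    assume ne: "a \<noteq> a'"
    define x0 where "x0 = (y' - a' * x' - (y - a * x)) / (a - a')"
    define y0 where "y0 = y + a * (x0 - x)"
    have "(a - a') * x0 = y' - a' * x' - (y - a * x)" using ne by (simp add: x0_def)
    then have y0': "y0 = y' + a' * (x0 - x')" by (simp add: y0_def algebra_simps)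
    define w where "w = v + x0 \<star> P + y0 \<star> P0"
    have zl: "g (x0 + s) (y0 + a * s) = 0" "g (x0 + s) (y0 + a' * s) = 0" for s
      using z(1)[of "x0 - x + s"] z(2)[of "x0 - x' + s"]
      by (simp_all add: y0_def[symmetric] y0'[symmetric] distrib_left add.assoc[symmetric])
    have "L w (P + a \<star> P0) = 0" "L w (P + a' \<star> P0) = 0"
      using zl line_iso by (auto intro!: L_zero_of_vanishing simp: w_def g_line[symmetric])
    then have "B w (P + a \<star> P0) = 0" "B w (P + a' \<star> P0) = 0" by (simp_all add: B_def)
    then have "B w P + a * B w P0 = 0" "B w P + a' * B w P0 = 0" by (simp_all add: B_add B_scl)
    then have "a * B w P0 = a' * B w P0" by (metis add_left_cancel)
    then have "B w P0 = 0" using ne by simp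
    then have B0: "coeff (L w P0) 1 = 0" by (simp add: B_def)
    have c0: "coeff (L w P0) 0 = 0" using zl(1)[of 0] by (simp add: coeff_0_L w_def g_def)
    have "coeff (L w P0) (d - 1) \<noteq> 0"
      using P0(2) B_maxiso[OF S P0(1) P] B_maxiso[OF S P0(1) P0(1)]
      by (simp add: coeff_d1_L coeff_d1_L' w_def B_add B_scl)
    then have "L w P0 \<noteq> 0" by auto
    from card_roots_less_degree[OF this c0 B0]
    have "card {s. val (w + s \<star> P0) = 0} < d - 1"
      using degree_L_isotropic[of P0 w] maxisoD(2)[OF S P0(1)] by (simp add: poly_L)
    moreover have "card {s. val (w + s \<star> P0) = 0} = d - 1"
      using line_zero_count[OF S v P0 inS[of x0 y0]] by (simp add: w_def add.assoc)
    ultimately show False by simp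
  qed
  obtain y1 where "g 0 y1 = 0"
  proof -
    have "{y. g 0 y = 0} \<noteq> {}" using vert[of 0] d2 by (metis card.empty diff_is_0_eq not_less_eq_eq numeral_2_eq_2 One_nat_def)
    then show ?thesis using that by blast
  qed
  then obtain a where a: "\<And>s. g (0 + s) (y1 + a * s) = 0" using exists_line by blast
  have zl: "g (x + s) (y + a * s) = 0" if "g x y = 0" for x y s
    using exists_line[OF that] parallel[OF a] by blast
  have P0': "B P0 (v + x \<star> P + c \<star> P0) = B P0 v" for x c
    using B_maxiso[OF S P0(1) P] B_maxiso[OF S P0(1) P0(1)] by (simp add: B_add B_scl)
  have "val (v + y \<star> P0 + x \<star> (P + a \<star> P0)) = val (v + y \<star> P0)" for x y
  proof -
    let ?p = "L (v + x \<star> P + (a * x) \<star> P0) P0" and ?r = "L v P0"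
    have p: "poly ?p y = g x (y + a * x)" "poly ?r y = g 0 y" for y
      by (simp_all add: poly_L g_def add_scl add_ac)
    \<comment> \<open>Along \<open>P0\<close> both polynomials have the same coefficient of index
      \<open>d - 1\<close>, so their difference has degree at most \<open>d - 2\<close>; it vanishes
      at the \<open>d - 1\<close> zeros, which the slope \<open>a\<close> carries from one vertical
      line to the other.\<close>
    have "?p - ?r = 0"
    proof (rule ccontr)
      assume ne: "?p - ?r \<noteq> 0"
      have "coeff (?p - ?r) i = 0" if "i > d - 2" for i
      proof -
        consider "i = d - 1" | "i > d - 1" using \<open>i > d - 2\<close> by linarith
        then show ?thesis
        proof cases
          case 1
          then show ?thesis by (simp add: coeff_d1_L coeff_d1_L' P0')
        next
          case 2
          have "degree (L u P0) < i" for u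
            using degree_L_isotropic[OF maxisoD(2)[OF S P0(1)], of u] 2 by (rule le_less_trans)
          then show ?thesis by (simp add: coeff_eq_0)
        qed
      qed
      then have "degree (?p - ?r) \<le> d - 2" by (intro degree_le) blast
      then have "card {y. poly (?p - ?r) y = 0} \<le> d - 2" using card_poly_roots_le[OF ne] by linarith
      moreover have "{y. g 0 y = 0} \<subseteq> {y. poly (?p - ?r) y = 0}"
        using zl[of 0 _ x] by (auto simp: p)
      then have "card {y. g 0 y = 0} \<le> card {y. poly (?p - ?r) y = 0}" by (intro card_mono) auto
      ultimately show False using vert[of 0] d2 by simp
    qed
    then have "g x (y + a * x) = g 0 y" using p[of y] by (metis eq_iff_diff_eq_0)
    moreover have "v + x \<star> P + (y + a * x) \<star> P0 = v + y \<star> P0 + x \<star> (P + a \<star> P0)"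
      by (simp add: pointwise algebra_simps)
    then have "g x (y + a * x) = val (v + y \<star> P0 + x \<star> (P + a \<star> P0))"
      unfolding g_def by (rule arg_cong)
    moreover have "g 0 y = val (v + y \<star> P0)" by (simp add: g_def)
    ultimately show ?thesis by simp
  qed
  then show ?thesis by blast
qed

lemma B_zero_of_constant:
  assumes "\<And>s. val (v + s \<star> P) = val v" "val P = 0"
  shows "B P v = 0"
proof -
  have "L v P = [:val v:]"
    using degree_L_isotropic[OF assms(2), of v] dq d2 assms(1)
    by (intro poly_eq_if_same_values) (auto simp: poly_L)
  moreover have "coeff [:val v:] (d - 1) = 0" using d2 by (cases "d - 1") auto
  ultimately show ?thesis using coeff_d1_L[of v P] by simp
qed

text \<open>With slope \<open>a\<close> one has \<open>F(v + x P) = F(v - a x P0)\<close> as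
  polynomials in \<open>x\<close>. Comparing coefficients of index \<open>d - 1\<close> gives
  \<open>B P v = (-a)^(d - 1) B P0 v\<close>, so tangency forces \<open>a = 0\<close>.\<close>

lemma val_translate_maxiso:
  assumes S: "maxiso S" and v: "v \<in> vecs (Suc n)" "v \<notin> S" and P: "P \<in> S" "B P v = 0"
  shows "val (v + s \<star> P) = val v"
proof -
  obtain P0 where P0: "P0 \<in> S" "B P0 v \<noteq> 0" using B_nonzero_exists[OF S v] by blast
  obtain a where a: "\<And>x y. val (v + y \<star> P0 + x \<star> (P + a \<star> P0)) = val (v + y \<star> P0)"
    using plane_structure[OF S v P(1) P0] by blast
  have "L v P = pcompose (L v P0) [:0, - a:]"
  proof (rule poly_eq_if_same_values)
    show "degree (L v P) < CARD('a)"
      using degree_L_isotropic[OF maxisoD(2)[OF S P(1)], of v] dq d2 by linarith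
    have "degree (pcompose (L v P0) [:0, - a:]) \<le> degree (L v P0) * 1"
      unfolding degree_pcompose by (rule mult_le_mono2) simp
    then show "degree (pcompose (L v P0) [:0, - a:]) < CARD('a)"
      using degree_L_isotropic[OF maxisoD(2)[OF S P0(1)], of v] dq d2 by linarith
    fix x
    have "val (v + x \<star> P) = val (v + (- a * x) \<star> P0 + x \<star> (P + a \<star> P0))"
      by (rule arg_cong[of _ _ val]) (simp add: pointwise algebra_simps)
    then show "poly (L v P) x = poly (pcompose (L v P0) [:0, - a:]) x"
      by (simp add: poly_L poly_pcompose a mult.commute)
  qed
  then have "coeff (L v P) (d - 1) = (- a) ^ (d - 1) * coeff (L v P0) (d - 1)"
    by (simp add: coeff_pcompose_linear)
  then have "a = 0" using P(2) P0(2) by (simp add: coeff_d1_L coeff_d1_L')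
  then show ?thesis using a[of 0 s] by simp
qed

definition perp :: "(nat \<Rightarrow> 'a) set \<Rightarrow> (nat \<Rightarrow> 'a) \<Rightarrow> (nat \<Rightarrow> 'a) set" where
  "perp S v = {c \<in> S. B c v = 0}"

text \<open>Additivity is not formal, since \<open>B\<close> is not linear on the left. Translations
  by multiples of \<open>c\<close> and of \<open>c'\<close> preserve the value at \<open>v\<close>,
  hence so do those by \<open>c + c'\<close>, and a constant restriction has derivative zero at the
  direction.\<close>

lemma lin_subspace_perp:
  assumes S: "maxiso S" and v: "v \<in> vecs (Suc n)" "v \<notin> S"
  shows "lin_subspace (Suc n) (perp S v)"
proof -
  note Sub = maxisoD(1)[OF S]
  have "B (c + c') v = 0" if c: "c \<in> S" "B c v = 0" "c' \<in> S" "B c' v = 0" for c c'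
  proof (rule B_zero_of_constant)
    show "val (c + c') = 0" using maxisoD(2)[OF S] lin_subspaceD(3)[OF Sub] c by blast
    fix s
    let ?w = "v + s \<star> c"
    have w: "?w \<in> vecs (Suc n)"
      using v(1) lin_subspaceD(1)[OF Sub c(1)] lin_subspaceD(3,4)[OF lin_subspace_vecs] by blast
    have w': "?w \<notin> S"
    proof
      assume "?w \<in> S"
      then have "?w - s \<star> c \<in> S" using lin_subspace_diff[OF Sub] lin_subspaceD(4)[OF Sub] c(1) by blast
      then show False using v(2) by simp
    qed
    have "B c' ?w = 0" using c(4) B_maxiso[OF S c(3,1)] by (simp add: B_add B_scl)
    from val_translate_maxiso[OF S w w' c(3) this]
    have "val (?w + s \<star> c') = val v" using val_translate_maxiso[OF S v c(1,2)] by simp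
    then show "val (v + s \<star> (c + c')) = val v" by (simp add: scl_add add.assoc)
  qed
  moreover have "B 0 v = 0" using B_maxiso[OF S lin_subspaceD(2)[OF Sub]] B_scl_left[of 0 0 v] d2 by (simp add: zero_power)
  ultimately show ?thesis
    using lin_subspaceD(1)[OF Sub] lin_subspaceD(2)[OF Sub] lin_subspaceD(3)[OF Sub] lin_subspaceD(4)[OF Sub]
    unfolding lin_subspace_def[of _ "perp S v"] unfolding perp_def
    by (simp add: B_scl_left subset_iff)
qed

text \<open>The slope \<open>a\<close> in the plane of \<open>P\<close> and \<open>P0\<close> makes
  \<open>P + a P0\<close> a direction of constancy, hence an element of \<open>perp S v\<close>. So
  \<open>perp S v\<close> is a hyperplane of \<open>S\<close>.\<close>

lemma adjoin_perp:
  assumes S: "maxiso S" and v: "v \<in> vecs (Suc n)" "v \<notin> S" and P0: "P0 \<in> S" "B P0 v \<noteq> 0"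
  shows "S = adjoin (perp S v) P0"
proof
  note Sub = maxisoD(1)[OF S]
  show "adjoin (perp S v) P0 \<subseteq> S"
    using lin_subspaceD(3,4)[OF Sub] P0(1) unfolding adjoin_def perp_def by blast
  show "S \<subseteq> adjoin (perp S v) P0"
  proof
    fix P assume P: "P \<in> S"
    obtain a where a: "\<And>x y. val (v + y \<star> P0 + x \<star> (P + a \<star> P0)) = val (v + y \<star> P0)"
      using plane_structure[OF S v P P0] by blast
    have in_S: "P + a \<star> P0 \<in> S" using lin_subspaceD(3,4)[OF Sub] P P0(1) by blast
    have "B (P + a \<star> P0) v = 0"
      using a[of 0] maxisoD(2)[OF S in_S] by (intro B_zero_of_constant) auto
    then have "P + a \<star> P0 \<in> perp S v" using in_S by (simp add: perp_def)
    moreover have "P = (P + a \<star> P0) + (- a) \<star> P0" by (simp add: pointwise)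
    ultimately show "P \<in> adjoin (perp S v) P0" unfolding adjoin_def by blast
  qed
qed

text \<open>If \<open>z\<close> is not in \<open>S\<close>, the hyperplane \<open>perp S z\<close>
  together with \<open>z\<close> spans a space of the same size. It is isotropic because translation
  by \<open>perp S z\<close> preserves the value at \<open>z\<close>.\<close>

lemma isotropic_vector_in_maxiso:
  assumes z: "z \<in> vecs (Suc n)" "val z = 0"
  obtains S where "maxiso S" "z \<in> S"
proof -
  obtain S where S: "maxiso S" using max_exists by (auto simp: maxiso_def)
  show ?thesis
  proof (cases "z \<in> S")
    case False
    note Sub = maxisoD(1)[OF S]
    note C = lin_subspace_perp[OF S z(1) False]
    obtain P0 where P0: "P0 \<in> S" "B P0 z \<noteq> 0" using B_nonzero_exists[OF S z(1) False] by blast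
    have "P0 \<notin> perp S z" using P0 by (simp add: perp_def)
    from card_adjoin[OF C this] have "card S = card (perp S z) * CARD('a)"
      using adjoin_perp[OF S z(1) False P0] by simp
    moreover have "z \<notin> perp S z" using False by (simp add: perp_def)
    ultimately have card: "card (adjoin (perp S z) z) = card S" by (simp add: card_adjoin[OF C])
    have "val (c + s \<star> z) = 0" if c: "c \<in> perp S z" for c s
    proof (cases "s = 0")
      case True
      then show ?thesis using c maxisoD(2)[OF S] by (simp add: perp_def)
    next
      case nz: False
      have "c + s \<star> z = s \<star> (z + (1 / s) \<star> c)" using nz by (simp add: pointwise field_simps)
      moreover have "val (z + (1 / s) \<star> c) = val z"
        using c by (intro val_translate_maxiso[OF S z(1) False]) (auto simp: perp_def)
      ultimately show ?thesis using z(2) by (simp add: val_scl)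
    qed
    then have "isotropic (adjoin (perp S z) z)"
      using lin_subspace_adjoin[OF C z(1)] unfolding isotropic_def adjoin_def by blast
    then have "maxiso (adjoin (perp S z) z)" using card S by (simp add: maxiso_def)
    then show ?thesis using that adjoin_contains[OF C] by blast
  qed (use S that in blast)
qed

lemma val_translate:
  assumes P: "P \<in> vecs (Suc n)" "val P = 0" and v: "v \<in> vecs (Suc n)" "B P v = 0"
  shows "val (v + s \<star> P) = val v"
proof -
  obtain S where S: "maxiso S" "P \<in> S" using isotropic_vector_in_maxiso[OF P] .
  show ?thesis
  proof (cases "v \<in> S")
    case True
    then have "v + s \<star> P \<in> S" using lin_subspaceD(3,4)[OF maxisoD(1)[OF S(1)]] S(2) by blast
    then show ?thesis using maxisoD(2)[OF S(1)] True by simp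
  qed (use val_translate_maxiso S v in blast)
qed

lemma secant_count:
  assumes P: "P \<in> vecs (Suc n)" "val P = 0" and w: "w \<in> vecs (Suc n)" "B P w \<noteq> 0"
  shows "card {s. val (w + s \<star> P) = 0} = d - 1"
proof -
  obtain S where S: "maxiso S" "P \<in> S" using isotropic_vector_in_maxiso[OF P] .
  have "w \<notin> S" using B_maxiso[OF S] w(2) by blast
  from line_zero_count[OF S(1) w(1) this S(2) w(2) lin_subspaceD(2)[OF maxisoD(1)[OF S(1)]]]
  show ?thesis by simp
qed

text \<open>By translation \<open>F\<close> vanishes on the whole line \<open>Q + s P\<close>, hence
  \<open>L Q P = 0\<close>; its coefficient of index 1 is \<open>B Q P\<close>.\<close>

lemma perp_sym:
  assumes P: "P \<in> vecs (Suc n)" "val P = 0" and Q: "Q \<in> vecs (Suc n)" "val Q = 0" and PQ: "B P Q = 0"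
  shows "B Q P = 0"
proof -
  have "L Q P = 0" using val_translate[OF P Q(1) PQ] Q(2) P(2) by (intro L_zero_of_vanishing) auto
  then show ?thesis by (simp add: B_def)
qed

end

section \<open>Hyperbolic bases\<close>

context finite_form
begin

lemma B_self:
  assumes "val P = 0" shows "B P P = 0"
proof -
  have h: "ring_morphism (\<lambda>c::'a. [:id c:])"
    by (rule ring_morphism_poly_const[OF ring_morphism_id])
  have "line_poly id F P P = mp_eval (\<lambda>c. [:id c:]) (\<lambda>i. [:1, 1:] * [:P i:]) F"
    by (simp add: line_poly_def)
  also have "\<dots> = [:1, 1:] ^ d * mp_eval (\<lambda>c. [:id c:]) (\<lambda>i. [:P i:]) F"
    by (rule form_scale[OF form])
  also have "mp_eval (\<lambda>c. [:id c:]) (\<lambda>i. [:P i:]) F = [:val P:]"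
    using ring_morphism.mp_eval_comp[OF ring_morphism_poly_const[OF ring_morphism_id], of id P F]
    by (simp add: val_def)
  also have "[:1, 1:] ^ d * [:val P:] = 0" using assms by simp
  finally show ?thesis unfolding B_def L_def by (simp only: coeff_0)
qed

text \<open>Only one order of each pair is normalized: \<open>B\<close> of the exchanged pair
  depends on the form, being \<open>1\<close> for the quadric and \<open>-1\<close> for the
  space-filling form. Spanning is recorded in place of a basis property, as counting turns it into
  invertibility.\<close>

definition hyperbolic_basis :: "(nat \<Rightarrow> 'a) set \<Rightarrow> nat \<Rightarrow> (nat \<Rightarrow> nat \<Rightarrow> 'a) \<Rightarrow> bool" where
  "hyperbolic_basis W j b \<longleftrightarrow> (\<forall>i<2*j. b i \<in> W \<and> val (b i) = 0) \<and>
     (\<forall>i<j. B (b (2*i)) (b (2*i+1)) = 1) \<and>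
     (\<forall>i<2*j. \<forall>k<2*j. i div 2 \<noteq> k div 2 \<longrightarrow> B (b i) (b k) = 0) \<and>
     (\<forall>w\<in>W. \<exists>t. w = lincomb b (2*j) t)"

definition nondegenerate :: "(nat \<Rightarrow> 'a) set \<Rightarrow> bool" where
  "nondegenerate W \<longleftrightarrow> (\<forall>P\<in>W. val P = 0 \<longrightarrow> P \<noteq> 0 \<longrightarrow> (\<exists>w\<in>W. B P w \<noteq> 0))"

definition perp2 :: "(nat \<Rightarrow> 'a) set \<Rightarrow> (nat \<Rightarrow> 'a) \<Rightarrow> (nat \<Rightarrow> 'a) \<Rightarrow> (nat \<Rightarrow> 'a) set" where
  "perp2 W P Q = {w \<in> W. B P w = 0 \<and> B Q w = 0}"

text \<open>The predicate \<open>good\<close> provides the isotropic vectors that the induction splits off.\<close>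

lemma hyperbolic_basis_exists:
  assumes sym: "\<And>P Q. P \<in> vecs (Suc n) \<Longrightarrow> Q \<in> vecs (Suc n) \<Longrightarrow> val P = 0 \<Longrightarrow> val Q = 0 \<Longrightarrow> B P Q = 0 \<Longrightarrow> B Q P = 0"
    and hit: "\<And>P w. P \<in> vecs (Suc n) \<Longrightarrow> w \<in> vecs (Suc n) \<Longrightarrow> val P = 0 \<Longrightarrow> B P w \<noteq> 0 \<Longrightarrow> \<exists>s. val (w + s \<star> P) = 0"
    and good: "\<And>W j. lin_subspace (Suc n) W \<Longrightarrow> good W (Suc j) \<Longrightarrow> card W = CARD('a) ^ (2 * Suc j) \<Longrightarrow>
       \<exists>P\<in>W. P \<noteq> 0 \<and> val P = 0 \<and> (\<forall>Q\<in>W. val Q = 0 \<longrightarrow> B P Q \<noteq> 0 \<longrightarrow> good (perp2 W P Q) j)"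
  shows "lin_subspace (Suc n) W \<Longrightarrow> nondegenerate W \<Longrightarrow> card W = CARD('a) ^ (2 * j) \<Longrightarrow> good W j \<Longrightarrow>
    \<exists>b. hyperbolic_basis W j b"
proof (induction j arbitrary: W)
  case 0
  then have "card W = 1" by simp
  then obtain x where "W = {x}" by (auto simp: card_1_singleton_iff)
  then have "W = {0}" using lin_subspaceD(2)[OF "0.prems"(1)] by simp
  then have "hyperbolic_basis W 0 b" for b
    by (auto simp: hyperbolic_basis_def lincomb_def pointwise)
  then show ?case by blast
next
  case (Suc j)
  note W = Suc.prems(1)
  have WV: "w \<in> vecs (Suc n)" if "w \<in> W" for w using lin_subspaceD(1)[OF W that] .
  obtain P where P: "P \<in> W" "P \<noteq> 0" "val P = 0"
    and Pg: "\<And>Q. Q \<in> W \<Longrightarrow> val Q = 0 \<Longrightarrow> B P Q \<noteq> 0 \<Longrightarrow> good (perp2 W P Q) j"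
    using good[OF W Suc.prems(4,3)] by blast
  obtain w where w: "w \<in> W" "B P w \<noteq> 0" using Suc.prems(2) P unfolding nondegenerate_def by blast
  obtain s where s: "val (w + s \<star> P) = 0" using hit[OF WV[OF P(1)] WV[OF w(1)] P(3) w(2)] by blast
  \<comment> \<open>Moving \<open>w\<close> along \<open>P\<close> does not change
    \<open>B P w\<close>, because \<open>B P P = 0\<close>; so the zero on this line can be scaled
    to give \<open>B P Q = 1\<close>.\<close>
  define Q where "Q = (1 / B P w) \<star> (w + s \<star> P)"
  have Q: "Q \<in> W" "val Q = 0" "B P Q = 1"
  proof -
    show "Q \<in> W" unfolding Q_def using lin_subspaceD(3,4)[OF W] w(1) P(1) by blast
    show "val Q = 0" using s by (simp add: Q_def val_scl)
    show "B P Q = 1" using w(2) by (simp add: Q_def B_scl B_add B_self[OF P(3)])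
  qed
  have BQP: "B Q P \<noteq> 0" using sym[OF WV[OF Q(1)] WV[OF P(1)] Q(2) P(3)] Q(3) by auto
  have BPP: "B P P = 0" "B Q Q = 0" using B_self P Q by auto
  define W' where "W' = perp2 W P Q"
  have W'W: "W' \<subseteq> W" by (auto simp: W'_def perp2_def)
  have W': "lin_subspace (Suc n) W'"
    using lin_subspaceD(1)[OF W] lin_subspaceD(2)[OF W] lin_subspaceD(3)[OF W] lin_subspaceD(4)[OF W]
    unfolding lin_subspace_def[of _ W'] unfolding W'_def perp2_def by (simp add: B_add B_scl subset_iff)
  have decomp: "\<exists>w'\<in>W'. \<exists>x y. w = w' + x \<star> P + y \<star> Q" if "w \<in> W" for w
  proof -
    define y where "y = B P w"
    define x where "x = (B Q (w - y \<star> Q)) / B Q P"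
    define w' where "w' = w - y \<star> Q - x \<star> P"
    have "w' \<in> W" unfolding w'_def
      using lin_subspace_diff[OF W] lin_subspaceD(4)[OF W] that P(1) Q(1) by blast
    moreover have "B P w' = 0" using Q(3) by (simp add: w'_def B_diff B_scl BPP y_def)
    moreover have "B Q w' = 0" using BQP by (simp add: w'_def B_diff B_scl x_def)
    ultimately have "w' \<in> W'" by (simp add: W'_def perp2_def)
    moreover have "w = w' + x \<star> P + y \<star> Q" by (simp add: w'_def)
    ultimately show ?thesis by blast
  qed
  have PW': "P \<notin> W'" using BQP by (auto simp: W'_def perp2_def)
  have PQ0: "B P (w' + x \<star> P) = 0" if "w' \<in> W'" for w' x
    using that by (simp add: W'_def perp2_def B_add B_scl BPP)
  have QW': "Q \<notin> adjoin W' P" using PQ0 Q(3) unfolding adjoin_def by force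
  have aP: "lin_subspace (Suc n) (adjoin W' P)" by (rule lin_subspace_adjoin[OF W' WV[OF P(1)]])
  have "W = adjoin (adjoin W' P) Q"
  proof
    show "W \<subseteq> adjoin (adjoin W' P) Q"
    proof
      fix w assume "w \<in> W"
      then obtain w' x y where "w' \<in> W'" "w = w' + x \<star> P + y \<star> Q" using decomp by blast
      then show "w \<in> adjoin (adjoin W' P) Q" unfolding adjoin_def by blast
    qed
    show "adjoin (adjoin W' P) Q \<subseteq> W"
    proof
      fix w assume "w \<in> adjoin (adjoin W' P) Q"
      then obtain w' x y where w: "w' \<in> W'" "w = w' + x \<star> P + y \<star> Q" unfolding adjoin_def by blast
      then have "w' \<in> W" using W'W by blast
      then show "w \<in> W" unfolding w(2) by (intro lin_subspaceD(3,4)[OF W] P(1) Q(1))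
    qed
  qed
  then have "card W = card W' * CARD('a) * CARD('a)"
    using card_adjoin[OF aP QW'] card_adjoin[OF W' PW'] by simp
  then have "card W' * CARD('a) ^ 2 = CARD('a) ^ (2 * j) * CARD('a) ^ 2"
    using Suc.prems(3) by (simp add: power2_eq_square)
  then have cW': "card W' = CARD('a) ^ (2 * j)" by simp
  \<comment> \<open>Membership in \<open>W'\<close> puts \<open>R\<close> on the right of
    \<open>B\<close>. For isotropic \<open>R\<close>, the only vectors that nondegeneracy speaks of,
    \<open>sym\<close> moves it to the left.\<close>
  have perp_W': "B R P = 0" "B R Q = 0" if "R \<in> W'" "val R = 0" for R
  proof -
    have R: "R \<in> vecs (Suc n)" "B P R = 0" "B Q R = 0" using that WV by (auto simp: W'_def perp2_def)
    show "B R P = 0" by (rule sym[OF WV[OF P(1)] R(1) P(3) that(2) R(2)])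
    show "B R Q = 0" by (rule sym[OF WV[OF Q(1)] R(1) Q(2) that(2) R(3)])
  qed
  have nd: "nondegenerate W'"
    unfolding nondegenerate_def
  proof (intro ballI impI)
    fix R assume R: "R \<in> W'" "val R = 0" "R \<noteq> 0"
    then obtain w where w: "w \<in> W" "B R w \<noteq> 0" using Suc.prems(2) W'W unfolding nondegenerate_def by blast
    obtain w' x y where w': "w' \<in> W'" "w = w' + x \<star> P + y \<star> Q" using decomp[OF w(1)] by blast
    have "B R w = B R w'" unfolding w'(2) using perp_W'[OF R(1,2)] by (simp add: B_add B_scl)
    then show "\<exists>w\<in>W'. B R w \<noteq> 0" using w(2) w'(1) by metis
  qed
  have "good W' j" unfolding W'_def using Pg Q by simp
  from Suc.IH[OF W' nd cW' this] obtain b where b: "hyperbolic_basis W' j b" by blast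
  have b1: "b i \<in> W'" "val (b i) = 0" if "i < 2 * j" for i using b that by (auto simp: hyperbolic_basis_def)
  have b2: "B (b (2*i)) (b (2*i+1)) = 1" if "i < j" for i using b that by (auto simp: hyperbolic_basis_def)
  have b3: "B (b i) (b k) = 0" if "i < 2 * j" "k < 2 * j" "i div 2 \<noteq> k div 2" for i k
    using b that by (auto simp: hyperbolic_basis_def)
  have b4: "\<exists>t. w = lincomb b (2*j) t" if "w \<in> W'" for w using b that by (auto simp: hyperbolic_basis_def)
  define b' where "b' = b(2*j := P, 2*j+1 := Q)"
  have b'lt: "b' i = b i" if "i < 2 * j" for i using that by (simp add: b'_def)
  have b'j: "b' (2*j) = P" "b' (Suc (2*j)) = Q" by (simp_all add: b'_def)
  have "hyperbolic_basis W (Suc j) b'"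
    unfolding hyperbolic_basis_def
  proof (intro conjI allI impI ballI)
    fix i assume "i < 2 * Suc j"
    then have "i < 2 * j \<or> i = 2 * j \<or> i = Suc (2 * j)" by presburger
    then consider "i < 2 * j" | "i = 2 * j" | "i = Suc (2 * j)" by blast
    then show "b' i \<in> W" "val (b' i) = 0"
      by (cases; use b1 W'W P Q in \<open>auto simp: b'lt b'j\<close>)+
  next
    fix i assume "i < Suc j"
    then show "B (b' (2 * i)) (b' (2 * i + 1)) = 1"
      using b2[of i] Q(3) by (cases "i = j") (auto simp: b'lt b'j)
  next
    fix i k assume i: "i < 2 * Suc j" and k: "k < 2 * Suc j" and ne: "i div 2 \<noteq> k div 2"
    consider "i < 2 * j" "k < 2 * j" | "i < 2 * j" "k = 2 * j \<or> k = Suc (2 * j)"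
      | "k < 2 * j" "i = 2 * j \<or> i = Suc (2 * j)"
      | "i = 2 * j \<or> i = Suc (2 * j)" "k = 2 * j \<or> k = Suc (2 * j)"
    proof -
      have "i < 2 * j \<or> i = 2 * j \<or> i = Suc (2 * j)" "k < 2 * j \<or> k = 2 * j \<or> k = Suc (2 * j)"
        using i k by presburger+
      then show thesis using that by blast
    qed
    then show "B (b' i) (b' k) = 0"
    proof cases
      case 1
      then show ?thesis using b3 ne by (simp add: b'lt)
    next
      case 2
      then show ?thesis using perp_W'[OF b1[OF 2(1)]] by (auto simp: b'lt b'j)
    next
      case 3
      then show ?thesis using b1(1)[OF 3(1)] by (auto simp: b'lt b'j W'_def perp2_def)
    next
      case 4
      then show ?thesis using ne by auto
    qed
  next
    fix w assume "w \<in> W"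
    then obtain w' x y where w': "w' \<in> W'" "w = w' + x \<star> P + y \<star> Q" using decomp by blast
    obtain t where t: "w' = lincomb b (2*j) t" using b4[OF w'(1)] by blast
    have "lincomb b' (2 * j) (t(2*j := x, 2*j+1 := y)) = lincomb b (2*j) t"
      by (rule lincomb_cong) (auto simp: b'lt)
    then have "w = lincomb b' (2 * Suc j) (t(2*j := x, 2*j+1 := y))"
      using w'(2) t by (simp add: lincomb_Suc b'j)
    then show "\<exists>t. w = lincomb b' (2 * Suc j) t" by blast
  qed
  then show ?case by blast
qed

end

context extremal_form
begin

text \<open>Here \<open>good W j\<close> supplies an isotropic \<open>T\<close> in \<open>W\<close>
  of size \<open>q^j\<close>, and \<open>P\<close> is taken from \<open>T\<close>. After splitting
  off \<open>P\<close> and \<open>Q\<close>, the kernel of \<open>B Q\<close> on \<open>T\<close>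
  serves again: it has index \<open>q\<close> in \<open>T\<close>, and it is orthogonal to
  \<open>P\<close> because \<open>T\<close> is isotropic.\<close>

lemma extremal_hyperbolic_basis:
  assumes nd: "nondegenerate (vecs (Suc n))" and n: "Suc n = 2 * K"
  obtains b where "hyperbolic_basis (vecs (Suc n)) K b"
proof -
  define good where "good W j \<longleftrightarrow> (\<exists>T\<subseteq>W. isotropic T \<and> card T = CARD('a) ^ j)" for W and j :: nat
  have Biso: "B l l' = 0" if T: "isotropic T" "l \<in> T" "l' \<in> T" for T l l'
  proof -
    have Sub: "lin_subspace (Suc n) T" and v: "\<And>x. x \<in> T \<Longrightarrow> val x = 0" using T by (auto simp: isotropic_def)
    have "L l l' = 0"
      using T lin_subspaceD(3,4)[OF Sub] v by (intro L_zero_of_vanishing) blast+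
    then show ?thesis by (simp add: B_def)
  qed
  have "\<exists>b. hyperbolic_basis (vecs (Suc n)) K b"
  proof (rule hyperbolic_basis_exists[where good = good])
    fix P w assume "P \<in> vecs (Suc n)" "w \<in> vecs (Suc n)" "val P = 0" "B P w \<noteq> 0"
    then have "card {s. val (w + s \<star> P) = 0} = d - 1" by (intro secant_count)
    then have "{s. val (w + s \<star> P) = 0} \<noteq> {}"
      using d2 by (metis card.empty diff_is_0_eq not_less_eq_eq numeral_2_eq_2 One_nat_def)
    then show "\<exists>s. val (w + s \<star> P) = 0" by blast
  next
    fix W j assume W: "lin_subspace (Suc n) W" and g: "good W (Suc j)"
    obtain T where T: "T \<subseteq> W" "isotropic T" "card T = CARD('a) ^ Suc j" using g by (auto simp: good_def)
    have Sub: "lin_subspace (Suc n) T" using T(2) by (simp add: isotropic_def)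
    have "1 < CARD('a) ^ Suc j" using two_le_card_field[where 'a = 'a] by (intro one_less_power) auto
    then have "T \<noteq> {0}" using T(3) by auto
    then obtain P where P: "P \<in> T" "P \<noteq> 0" using lin_subspaceD(2)[OF Sub] by blast
    have vP: "val P = 0" using T(2) P(1) by (simp add: isotropic_def)
    have "good (perp2 W P Q) j" if Q: "Q \<in> W" "val Q = 0" "B P Q \<noteq> 0" for Q
    proof -
      define T' where "T' = {l \<in> T. B Q l = 0}"
      have BQP: "B Q P \<noteq> 0"
        using perp_sym[of Q P] Q vP lin_subspaceD(1)[OF W] lin_subspaceD(1)[OF Sub P(1)] by blast
      have T': "lin_subspace (Suc n) T'"
        using lin_subspaceD(1)[OF Sub] lin_subspaceD(2)[OF Sub] lin_subspaceD(3)[OF Sub] lin_subspaceD(4)[OF Sub]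
        unfolding lin_subspace_def[of _ T'] unfolding T'_def by (simp add: B_add B_scl subset_iff)
      have "P \<notin> T'" using BQP by (simp add: T'_def)
      from card_adjoin[OF T' this] have c: "card (adjoin T' P) = card T' * CARD('a)" .
      have "adjoin T' P = T"
      proof
        show "adjoin T' P \<subseteq> T"
          using lin_subspaceD(3,4)[OF Sub] P(1) unfolding adjoin_def T'_def by blast
        show "T \<subseteq> adjoin T' P"
        proof
          fix l assume l: "l \<in> T"
          define x where "x = B Q l / B Q P"
          have "l - x \<star> P \<in> T" using lin_subspace_diff[OF Sub] lin_subspaceD(4)[OF Sub] l P(1) by blast
          moreover have "B Q (l - x \<star> P) = 0" using BQP by (simp add: x_def B_diff B_scl)
          ultimately have "l - x \<star> P \<in> T'" by (simp add: T'_def)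
          moreover have "l = (l - x \<star> P) + x \<star> P" by simp
          ultimately show "l \<in> adjoin T' P" unfolding adjoin_def by blast
        qed
      qed
      then have "card T' = CARD('a) ^ j" using c T(3) by simp
      moreover have "isotropic T'" using T' T(2) by (auto simp: isotropic_def T'_def)
      moreover have "T' \<subseteq> perp2 W P Q"
        using T(1) Biso[OF T(2) P(1)] by (auto simp: T'_def perp2_def)
      ultimately show ?thesis unfolding good_def by blast
    qed
    then show "\<exists>P\<in>W. P \<noteq> 0 \<and> val P = 0 \<and> (\<forall>Q\<in>W. val Q = 0 \<longrightarrow> B P Q \<noteq> 0 \<longrightarrow> good (perp2 W P Q) j)"
      using P vP T(1) by blast
  next
    show "lin_subspace (Suc n) (vecs (Suc n))" by (rule lin_subspace_vecs)
    show "card (vecs (Suc n) :: (nat \<Rightarrow> 'a) set) = CARD('a) ^ (2 * K)" by (simp only: card_vecs n)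
    show "good (vecs (Suc n)) K"
    proof -
      obtain S where S: "isotropic S" "card S = CARD('a) ^ K" using max_exists by blast
      then have "S \<subseteq> vecs (Suc n)" unfolding isotropic_def lin_subspace_def by simp
      then show ?thesis using S unfolding good_def by blast
    qed
  qed (use perp_sym nd in auto)
  then show ?thesis using that by blast
qed

end

section \<open>Multiplicative and additive structure of a finite field\<close>

lemma finite_field_power_eq_1:
  fixes x :: "'a::{field,finite}"
  assumes "x \<noteq> 0"
  shows "x ^ (CARD('a) - 1) = 1"
proof -
  let ?U = "UNIV - {0::'a}"
  have "bij_betw (\<lambda>y. x * y) ?U ?U"
    using assms by (intro bij_betwI[where g = "\<lambda>y. y / x"]) auto
  then have "(\<Prod>y\<in>?U. x * y) = \<Prod>?U"
    by (rule prod.reindex_bij_betw[where g = "\<lambda>y. y"])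
  then have "x ^ card ?U * \<Prod>?U = 1 * \<Prod>?U" by (simp add: prod.distrib)
  moreover have "\<Prod>?U \<noteq> 0" by simp
  ultimately have "x ^ card ?U = 1" by (metis mult_right_cancel)
  then show ?thesis by (simp add: card_Diff_subset)
qed

lemma finite_field_power_card:
  fixes x :: "'a::{field,finite}"
  shows "x ^ CARD('a) = x"
proof (cases "x = 0")
  case False
  have "x ^ CARD('a) = x * x ^ (CARD('a) - 1)"
    using two_le_card_field[where 'a = 'a] by (subst power_Suc[symmetric]) simp
  then show ?thesis using finite_field_power_eq_1[OF False] by simp
qed (use two_le_card_field[where 'a = 'a] in \<open>simp add: zero_power\<close>)

lemma card_power_roots:
  fixes c :: "'a::{field,finite}"
  assumes "s > 0" shows "card {x. x ^ s = c} \<le> s"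
proof -
  let ?p = "monom 1 s - [:c:] :: 'a poly"
  have c: "coeff ?p i = (if i = s then 1 else if i = 0 then - c else 0)" for i
    using assms by (auto simp: coeff_pCons split: nat.splits)
  then have "?p \<noteq> 0" by (metis coeff_0 zero_neq_one)
  moreover have "degree ?p \<le> s"
  proof (rule degree_le, intro allI impI)
    fix i assume "s < i" then show "coeff ?p i = 0" unfolding c using assms by simp
  qed
  ultimately show ?thesis using card_poly_roots_le[of ?p] by (simp add: poly_monom)
qed

text \<open>No generator of the unit group is needed: a nonzero remainder \<open>r\<close> of
  \<open>M\<close> modulo \<open>q - 1\<close> would give \<open>X^r - 1\<close> more than
  \<open>r\<close> roots.\<close>

lemma unit_exponent_dvd:
  assumes "\<And>x::'a::{field,finite}. x \<noteq> 0 \<Longrightarrow> x ^ M = 1"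
  shows "CARD('a) - 1 dvd M"
proof (rule ccontr)
  assume "\<not> CARD('a) - 1 dvd M"
  define r where "r = M mod (CARD('a) - 1)"
  have r: "r > 0" "r < CARD('a) - 1"
    using \<open>\<not> CARD('a) - 1 dvd M\<close> two_le_card_field[where 'a = 'a] by (auto simp: r_def mod_greater_zero_iff_not_dvd)
  have "x ^ r = 1" if "x \<noteq> 0" for x :: 'a
  proof -
    have "x ^ M = x ^ ((CARD('a) - 1) * (M div (CARD('a) - 1)) + r)" by (simp add: r_def)
    also have "\<dots> = x ^ r" by (simp only: power_add power_mult finite_field_power_eq_1[OF that] power_one mult_1_left)
    finally show ?thesis using assms[OF that] by simp
  qed
  then have "UNIV - {0::'a} \<subseteq> {x. x ^ r = 1}" by auto
  then have "card (UNIV - {0::'a}) \<le> card {x::'a. x ^ r = 1}" by (intro card_mono) auto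
  then show False using card_power_roots[OF r(1), of "1::'a"] r(2) by (simp add: card_Diff_subset)
qed

text \<open>Cosets of \<open>T\<close> partition the field. Closure under negation comes from
  finiteness: translation by an element of \<open>T\<close> permutes \<open>T\<close>.\<close>

lemma additive_subgroup_card_dvd:
  fixes T :: "'a::{field,finite} set"
  assumes "0 \<in> T" and add: "\<And>a b. a \<in> T \<Longrightarrow> b \<in> T \<Longrightarrow> a + b \<in> T"
  shows "card T dvd CARD('a)"
proof -
  have neg: "- a \<in> T" if "a \<in> T" for a
  proof -
    have "bij_betw (\<lambda>b. a + b) T T"
      unfolding bij_betw_def
    proof
      show inj: "inj_on ((+) a) T" by (simp add: inj_on_def)
      show "(+) a ` T = T" by (rule endo_inj_surj[OF _ _ inj]) (use add that in auto)
    qed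
    then obtain b where "b \<in> T" "a + b = 0" using \<open>0 \<in> T\<close> unfolding bij_betw_def by (metis imageE)
    then show ?thesis by (metis add_eq_0_iff)
  qed
  define C where "C = range (\<lambda>x. (+) x ` T)"
  have "card T * card C = card (\<Union>C)"
  proof (rule card_partition)
    fix c assume "c \<in> C"
    then show "card c = card T" by (auto simp: C_def card_image)
  next
    fix c c' assume "c \<in> C" "c' \<in> C" "c \<noteq> c'"
    then obtain x y where x: "c = (+) x ` T" and y: "c' = (+) y ` T" by (auto simp: C_def)
    have "(+) u ` T \<subseteq> (+) w ` T" if "u + a = w + b" "a \<in> T" "b \<in> T" for u w a b
    proof
      fix z assume "z \<in> (+) u ` T"
      then obtain s where s: "s \<in> T" "z = u + s" by auto
      have "z = w + (b + (- a + s))" using that(1) s(2) by (simp add: algebra_simps)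
      moreover have "b + (- a + s) \<in> T" using add neg that s by blast
      ultimately show "z \<in> (+) w ` T" by blast
    qed
    then show "c \<inter> c' = {}" using \<open>c \<noteq> c'\<close> unfolding x y by (auto; metis subset_antisym)
  qed (auto simp: C_def)
  moreover have "\<Union>C = UNIV"
  proof -
    have "x \<in> (+) x ` T" for x using \<open>0 \<in> T\<close> by (metis add.right_neutral imageI)
    then show ?thesis by (auto simp: C_def)
  qed
  ultimately show ?thesis by (metis dvd_triv_left)
qed

lemma minus_one_eq_one_if_even:
  assumes "even CARD('a::{field,finite})"
  shows "(-1 :: 'a) = 1"
proof -
  have "odd (CARD('a) - 1)" using assms two_le_card_field[where 'a = 'a] by simp
  then show ?thesis using finite_field_power_eq_1[of "-1::'a"] by simp
qed

text \<open>Write \<open>q = t u\<close> and \<open>t^2 - 1 = (q - 1) k\<close>; then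
  \<open>k - 1 = t (u k - t)\<close>. If \<open>u k = t\<close>, then \<open>k = 1\<close> and
  \<open>u = t\<close>. Otherwise \<open>k \<ge> t + 1\<close>, and
  \<open>(q - 1) k \<ge> t (t + 1)\<close> is too large.\<close>

lemma square_of_dvd_conditions:
  fixes t q :: nat
  assumes t: "2 \<le> t" and tq: "t < q" "t dvd q" and dvd: "q - 1 dvd t ^ 2 - 1"
  shows "q = t ^ 2"
proof -
  obtain u where u: "q = t * u" using tq(2) by blast
  have u1: "u \<ge> 2" using tq(1) u by (metis One_nat_def Suc_1 Suc_leI less_2_cases_iff mult.right_neutral mult_0_right nat_neq_iff not_less0 leI)
  obtain k where k: "t ^ 2 - 1 = (q - 1) * k" using dvd by blast
  have q1: "q \<ge> 1" using t tq by simp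
  have t1: "t ^ 2 \<ge> 1" using t by simp
  have "int t ^ 2 - 1 = (int t * int u - 1) * int k"
    using arg_cong[OF k, of int] u q1 t1 by (simp add: of_nat_diff)
  then have e: "int k - 1 = int t * (int u * int k - int t)" by (simp add: algebra_simps power2_eq_square)
  show ?thesis
  proof (cases "int u * int k - int t = 0")
    case True
    then show ?thesis using e u by (simp add: power2_eq_square)
  next
    case False
    have k0: "k > 0"
    proof (rule ccontr)
      assume "\<not> k > 0"
      then have "t ^ 2 - 1 = 0" using k by simp
      moreover have "4 \<le> t ^ 2" using power_mono[OF t, of 2] by simp
      ultimately show False by simp
    qed
    then have "int u * int k - int t \<ge> 0 \<or> int t * (int u * int k - int t) < 0"
      using t by (metis linorder_not_le mult_pos_neg of_nat_0_less_iff less_le_trans zero_less_numeral)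
    then have pos: "int u * int k - int t \<ge> 1" using False e k0 by auto
    have "int t * 1 \<le> int t * (int u * int k - int t)" by (rule mult_left_mono[OF pos]) simp
    then have kt: "k \<ge> t + 1" using e by linarith
    have "q - 1 \<ge> t" using tq by simp
    then have "(q - 1) * k \<ge> t * (t + 1)" using kt by (intro mult_mono) auto
    then have "t ^ 2 - 1 \<ge> t * (t + 1)" using k by simp
    then show ?thesis using t by (simp add: power2_eq_square algebra_simps)
  qed
qed

text \<open>The map \<open>x^(t - 1)\<close> sends the \<open>(t - 1) (t + 1)\<close> units into the
  at most \<open>t + 1\<close> roots of \<open>X^(t + 1) - 1\<close>, with fibres of size at most
  \<open>t - 1\<close>. Hence every such root is attained.\<close>

lemma power_image_units:
  fixes a :: "'a::{field,finite}"
  assumes q: "CARD('a) = t ^ 2" and t: "2 \<le> t" and a: "a ^ (t + 1) = 1"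
  shows "\<exists>\<mu>. \<mu> \<noteq> 0 \<and> \<mu> ^ (t - 1) = a"
proof -
  let ?U = "UNIV - {0::'a}"
  let ?I = "(\<lambda>x. x ^ (t - 1)) ` ?U"
  have sq: "t ^ 2 - 1 = (t - 1) * (t + 1)" using t by (simp add: power2_eq_square algebra_simps)
  have cU: "card ?U = (t - 1) * (t + 1)" using q sq by (simp add: card_Diff_subset)
  have "?I \<subseteq> {x. x ^ (t + 1) = 1}"
  proof clarify
    fix x :: 'a assume "x \<noteq> 0"
    then show "(x ^ (t - 1)) ^ (t + 1) = 1"
      using finite_field_power_eq_1[of x] unfolding q sq power_mult by simp
  qed
  moreover have "card ?U \<le> card ?I * (t - 1)"
  proof -
    have "?U = (\<Union>c\<in>?I. {x \<in> ?U. x ^ (t - 1) = c})" by auto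
    then have "card ?U \<le> (\<Sum>c\<in>?I. card {x \<in> ?U. x ^ (t - 1) = c})"
      using card_UN_le[of ?I "\<lambda>c. {x \<in> ?U. x ^ (t - 1) = c}"] by simp
    also have "\<dots> \<le> (\<Sum>c\<in>?I. t - 1)"
    proof (rule sum_mono)
      fix c
      have "card {x \<in> ?U. x ^ (t - 1) = c} \<le> card {x. x ^ (t - 1) = c}" by (rule card_mono) auto
      also have "\<dots> \<le> t - 1" using t by (intro card_power_roots) auto
      finally show "card {x \<in> ?U. x ^ (t - 1) = c} \<le> t - 1" .
    qed
    finally show ?thesis by simp
  qed
  then have "(t + 1) * (t - 1) \<le> card ?I * (t - 1)" unfolding cU by (simp only: mult.commute)
  then have "t + 1 \<le> card ?I" using t unfolding mult_le_cancel2 by simp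
  then have "card {x::'a. x ^ (t + 1) = 1} \<le> card ?I"
    using card_power_roots[of "t + 1" "1::'a"] by simp
  ultimately have "?I = {x. x ^ (t + 1) = 1}" by (intro card_seteq) simp_all
  then have "a \<in> ?I" using a by blast
  then show ?thesis by blast
qed

section \<open>Diagonalization and classification\<close>

context extremal_form
begin

text \<open>For \<open>y\<close> nonzero, the defect of additivity is a polynomial in
  \<open>x\<close> of degree below \<open>d - 1\<close>, because \<open>B e w = 0\<close> makes the
  coefficients of index \<open>d - 1\<close> cancel. It vanishes at the \<open>d - 1\<close> values
  of \<open>x\<close> where \<open>x e + y f\<close> is isotropic, by translation along that
  vector.\<close>

lemma split_pair:
  assumes e: "e \<in> vecs (Suc n)" "val e = 0" and f: "f \<in> vecs (Suc n)" "val f = 0" and ef: "B e f \<noteq> 0"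
    and w: "w \<in> vecs (Suc n)" and perp: "\<And>x y. val (x \<star> e + y \<star> f) = 0 \<Longrightarrow> B (x \<star> e + y \<star> f) w = 0"
  shows "val (x \<star> e + y \<star> f + w) = val (x \<star> e + y \<star> f) + val w"
proof -
  note V = lin_subspaceD(3,4)[OF lin_subspace_vecs[of "Suc n", where 'a = 'a]]
  have Bew: "B e w = 0" using perp[of 1 0] e by simp
  show ?thesis
  proof (cases "y = 0")
    case True
    have "val (w + x \<star> e) = val w" by (rule val_translate[OF e w Bew])
    then show ?thesis using True e by (simp add: val_scl add.commute)
  next
    case False
    let ?p = "L (w + y \<star> f) e - L (y \<star> f) e - [:val w:]"
    have "coeff ?p i = 0" if "i \<ge> d - 1" for i
    proof -
      have "coeff [:val w:] i = 0" using that d2 by (cases i) auto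
      moreover have "coeff (L (w + y \<star> f) e) i = coeff (L (y \<star> f) e) i"
      proof (cases "i = d - 1")
        case True
        then show ?thesis unfolding True coeff_d1_L by (simp add: B_add Bew)
      next
        case False
        then have "degree (L u e) < i" for u
          using degree_L_isotropic[OF e(2), of u] that by linarith
        then show ?thesis by (simp add: coeff_eq_0)
      qed
      ultimately show ?thesis by simp
    qed
    then have dp: "degree ?p < d - 1" using d2 by (intro degree_lessI) auto
    have "?p = 0"
    proof (rule ccontr)
      assume ne: "?p \<noteq> 0"
      have "{s. val (y \<star> f + s \<star> e) = 0} \<subseteq> {s. poly ?p s = 0}"
      proof
        fix s assume "s \<in> {s. val (y \<star> f + s \<star> e) = 0}"
        then have z: "val (s \<star> e + y \<star> f) = 0" by (simp add: add.commute)
        have "s \<star> e + y \<star> f \<in> vecs (Suc n)" using V e(1) f(1) by blast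
        from val_translate[OF this z w perp[OF z], of 1]
        have "val (w + y \<star> f + s \<star> e) = val w" by (simp add: add_ac)
        then show "s \<in> {s. poly ?p s = 0}" using z by (simp add: poly_L add.commute)
      qed
      then have "card {s. val (y \<star> f + s \<star> e) = 0} \<le> card {s. poly ?p s = 0}" by (intro card_mono) auto
      also have "\<dots> < d - 1" using card_poly_roots_le[OF ne] dp by linarith
      finally show False
        using secant_count[OF e, of "y \<star> f"] False ef V(2)[OF f(1)] by (simp add: B_scl)
    qed
    then have "poly ?p x = 0" by simp
    then have "val (w + y \<star> f + x \<star> e) = val (y \<star> f + x \<star> e) + val w"
      by (simp add: poly_L algebra_simps)
    then show ?thesis by (simp add: add_ac)
  qed
qed

text \<open>Linearity on the right gives \<open>B (g i) (x e + y f) = 0\<close>.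
  \<open>perp_sym\<close> reverses the order exactly when \<open>x e + y f\<close> is isotropic,
  which is what \<open>split_pair\<close> asks for.\<close>

lemma split_pair_span:
  assumes e: "e \<in> vecs (Suc n)" "val e = 0" and f: "f \<in> vecs (Suc n)" "val f = 0" and ef: "B e f \<noteq> 0"
    and g: "\<And>i. i < k \<Longrightarrow> g i \<in> vecs (Suc n)" "\<And>i. i < k \<Longrightarrow> val (g i) = 0"
      "\<And>i. i < k \<Longrightarrow> B (g i) e = 0" "\<And>i. i < k \<Longrightarrow> B (g i) f = 0"
  shows "val (x \<star> e + y \<star> f + lincomb g k t) = val (x \<star> e + y \<star> f) + val (lincomb g k t)"
proof (rule split_pair[OF e f ef])
  note V = lin_subspaceD(3,4)[OF lin_subspace_vecs[of "Suc n", where 'a = 'a]]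
  show "lincomb g k t \<in> vecs (Suc n)" by (rule lincomb_in_subspace[OF lin_subspace_vecs g(1)])
  fix x y assume z: "val (x \<star> e + y \<star> f) = 0"
  have R: "x \<star> e + y \<star> f \<in> vecs (Suc n)" using V e(1) f(1) by blast
  have "B (x \<star> e + y \<star> f) (g i) = 0" if "i < k" for i
    by (rule perp_sym[OF g(1,2)[OF that] R z]) (simp add: B_add B_scl g that)
  then show "B (x \<star> e + y \<star> f) (lincomb g k t) = 0"
  proof (induction k)
    case 0
    have "lincomb g 0 t = 0" by (simp add: lincomb_def pointwise)
    then show ?case by simp
  qed (simp add: lincomb_Suc B_add B_scl)
qed

text \<open>Orthogonality is listed in both orders because \<open>B\<close> need not be
  symmetric.\<close>

definition orthogonal_pairs where
  "orthogonal_pairs e f e' f' \<longleftrightarrow> {e, f, e', f'} \<subseteq> vecs (Suc n) \<and>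
     val e = 0 \<and> val f = 0 \<and> val e' = 0 \<and> val f' = 0 \<and> B e f = 1 \<and> B e' f' = 1 \<and>
     B e e' = 0 \<and> B e f' = 0 \<and> B f e' = 0 \<and> B f f' = 0 \<and>
     B e' e = 0 \<and> B e' f = 0 \<and> B f' e = 0 \<and> B f' f = 0"

lemma orthogonal_pairs_split:
  assumes "orthogonal_pairs e f e' f'"
  shows "val (x \<star> e + y \<star> f + (x' \<star> e' + y' \<star> f')) = val (x \<star> e + y \<star> f) + val (x' \<star> e' + y' \<star> f')"
proof -
  define g where "g i = (if i = 0 then e' else f')" for i :: nat
  have "lincomb g 2 (\<lambda>i. if i = 0 then x' else y') = x' \<star> e' + y' \<star> f'"
    by (simp add: lincomb_def pointwise g_def numeral_2_eq_2)
  moreover have "val (x \<star> e + y \<star> f + lincomb g 2 (\<lambda>i. if i = 0 then x' else y'))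
     = val (x \<star> e + y \<star> f) + val (lincomb g 2 (\<lambda>i. if i = 0 then x' else y'))"
    by (rule split_pair_span) (use assms in \<open>auto simp: orthogonal_pairs_def g_def\<close>)
  ultimately show ?thesis by simp
qed

text \<open>The vectors \<open>P = e + l e'\<close> and \<open>Q = f + \<mu> f'\<close> are
  isotropic by splitting, and \<open>\<mu>\<close> is chosen such that
  \<open>B P Q = 1 + \<mu> l^(d - 1) = 0\<close>. Translation makes \<open>F\<close> vanish on their
  span; splitting this zero into the two planes gives the relation.\<close>

lemma orthogonal_pairs_relation:
  assumes pairs: "orthogonal_pairs e f e' f'" and l: "l \<noteq> 0"
  shows "val ((l * x) \<star> e' + (- y / l ^ (d - 1)) \<star> f') = - val (x \<star> e + y \<star> f)"
proof -
  note V = lin_subspaceD(3,4)[OF lin_subspace_vecs[of "Suc n", where 'a = 'a]]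
  have in_V: "e \<in> vecs (Suc n)" "f \<in> vecs (Suc n)" "e' \<in> vecs (Suc n)" "f' \<in> vecs (Suc n)"
    and v0: "val e = 0" "val f = 0" "val e' = 0" "val f' = 0" and ef: "B e f = 1" "B e' f' = 1"
    using pairs by (auto simp: orthogonal_pairs_def)
  note split = orthogonal_pairs_split[OF pairs]
  define \<mu> where "\<mu> = - 1 / l ^ (d - 1)"
  define P where "P = e + l \<star> e'"
  define Q where "Q = f + \<mu> \<star> f'"
  have in_V2: "P \<in> vecs (Suc n)" "Q \<in> vecs (Suc n)" using in_V V unfolding P_def Q_def by blast+
  have vP: "val P = 0" using split[of 1 0 l 0] v0 by (simp add: P_def val_scl)
  have vQ: "val Q = 0" using split[of 0 1 0 \<mu>] v0 by (simp add: Q_def val_scl)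
  have deg: "degree (L u v) < CARD('a)" if "val v = 0" for u v
    using degree_L_isotropic[OF that, of u] d2 dq by linarith
  have "L P f = L e f"
  proof (rule poly_eq_if_same_values)
    show "poly (L P f) s = poly (L e f) s" for s
      using split[of 1 s l 0] v0 by (simp add: poly_L P_def val_scl add_ac)
  qed (rule deg[OF v0(2)])+
  then have 1: "B P f = 1" using ef by (simp add: B_def)
  have "L P f' = L (l \<star> e') f'"
  proof (rule poly_eq_if_same_values)
    show "poly (L P f') s = poly (L (l \<star> e') f') s" for s
      using split[of 1 0 l s] v0 by (simp add: poly_L P_def val_scl add_ac)
  qed (rule deg[OF v0(4)])+
  then have "B P f' = B (l \<star> e') f'" by (simp add: B_def)
  then have 2: "B P f' = l ^ (d - 1)" using ef by (simp add: B_scl_left)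
  have "B P Q = 0" using 1 2 l by (simp add: Q_def B_add B_scl \<mu>_def)
  then have "B P (y \<star> Q) = 0" by (simp add: B_scl)
  from val_translate[OF in_V2(1) vP V(2)[OF in_V2(2)] this, of x]
  have "val (y \<star> Q + x \<star> P) = 0" using vQ by (simp add: val_scl)
  moreover have "y \<star> Q + x \<star> P = x \<star> e + y \<star> f + ((l * x) \<star> e' + (- y / l ^ (d - 1)) \<star> f')"
    by (simp add: P_def Q_def \<mu>_def pointwise algebra_simps)
  ultimately have "val (x \<star> e + y \<star> f) + val ((l * x) \<star> e' + (- y / l ^ (d - 1)) \<star> f') = 0"
    by (simp add: split)
  then show ?thesis by (simp add: add_eq_0_iff)
qed

text \<open>The same vector of the second plane arises from the parameters \<open>l\<close> and
  \<open>1\<close>. Comparing both relations yields invariance of the binary form under a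
  torus.\<close>

lemma orthogonal_pairs_scaling:
  assumes pairs: "orthogonal_pairs e f e' f'" and l: "l \<noteq> 0"
  shows "val ((l * x) \<star> e + (y / l ^ (d - 1)) \<star> f) = val (x \<star> e + y \<star> f)"
  using orthogonal_pairs_relation[OF pairs, of 1 "l * x" "y / l ^ (d - 1)"]
    orthogonal_pairs_relation[OF pairs l, of x y] by simp

text \<open>For a root \<open>b\<close>, the vector \<open>b e + f\<close> is as good a partner of
  \<open>e\<close> as \<open>f\<close>. Both choices give the negative of one and the same form on
  the second plane.\<close>

lemma orthogonal_pairs_shift:
  assumes pairs: "orthogonal_pairs e f e' f'" and b: "val (b \<star> e + f) = 0"
  shows "val ((x + b * y) \<star> e + y \<star> f) = val (x \<star> e + y \<star> f)"
proof -
  note V = lin_subspaceD(3,4)[OF lin_subspace_vecs[of "Suc n", where 'a = 'a]]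
  have in_V: "b \<star> e + f \<in> vecs (Suc n)" using pairs V by (auto simp: orthogonal_pairs_def)
  have "B (b \<star> e + f) e' = 0" "B (b \<star> e + f) f' = 0"
    using pairs by (auto intro!: perp_sym[OF _ _ in_V b] simp: orthogonal_pairs_def B_add B_scl)
  then have "orthogonal_pairs e (b \<star> e + f) e' f'"
    using pairs b in_V B_self[of e] by (auto simp: orthogonal_pairs_def B_add B_scl)
  from orthogonal_pairs_relation[OF this, of 1 x y] orthogonal_pairs_relation[OF pairs, of 1 x y]
  have "val (x \<star> e + y \<star> (b \<star> e + f)) = val (x \<star> e + y \<star> f)" by simp
  moreover have "x \<star> e + y \<star> (b \<star> e + f) = (x + b * y) \<star> e + y \<star> f"
    by (simp add: pointwise algebra_simps)
  ultimately show ?thesis by simp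
qed

text \<open>The dehomogenized form \<open>A(X) = F(X e + f)\<close> is monic of degree
  \<open>t = d - 1\<close> without constant term. For \<open>t > 1\<close> its roots form a group of
  order \<open>t\<close>, and the torus gives \<open>l^(d (t - i)) = 1\<close> whenever the
  coefficient of \<open>X^i\<close> is nonzero. This yields \<open>q = t^2\<close> and leaves
  \<open>X^t + a X\<close>.\<close>

lemma binary_form_classification:
  assumes pairs: "orthogonal_pairs e f e' f'"
  shows "(d = 2 \<and> (\<forall>x y. val (x \<star> e + y \<star> f) = x * y)) \<or>
    (3 \<le> d \<and> CARD('a) = (d - 1) ^ 2 \<and> (\<exists>a. a ^ d = 1 \<and>
       (\<forall>x y. val (x \<star> e + y \<star> f) = x ^ (d - 1) * y + a * (x * y ^ (d - 1)))))"
proof -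
  have in_V: "e \<in> vecs (Suc n)" "f \<in> vecs (Suc n)" and v0: "val e = 0" "val f = 0" and ef: "B e f = 1"
    using pairs by (auto simp: orthogonal_pairs_def)
  define t where "t = d - 1"
  have t: "t \<ge> 1" "d = Suc t" "t < CARD('a)" using d2 dq by (auto simp: t_def)
  define A where "A = L f e"
  have pA: "poly A x = val (x \<star> e + f)" for x by (simp add: A_def poly_L add.commute)
  have dA: "degree A \<le> t" unfolding A_def t_def by (rule degree_L_isotropic[OF v0(1)])
  have At: "coeff A t = 1" unfolding A_def t_def coeff_d1_L by (rule ef)
  have A0: "coeff A 0 = 0" unfolding A_def coeff_0_L by (rule v0)
  \<comment> \<open>The linear coefficient is \<open>B f e\<close>; were it zero, symmetry of
    orthogonality would contradict \<open>B e f = 1\<close>.\<close>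
  have A1: "coeff A 1 \<noteq> 0"
    using perp_sym[OF in_V(2) v0(2) in_V(1) v0(1)] ef by (auto simp: A_def B_def)
  have hA: "val (x \<star> e + y \<star> f) = y ^ d * poly A (x / y)" if "y \<noteq> 0" for x y
  proof -
    have "x \<star> e + y \<star> f = y \<star> ((x / y) \<star> e + f)" using that by (simp add: pointwise field_simps)
    then show ?thesis by (simp add: val_scl pA)
  qed
  \<comment> \<open>Torus invariance read on \<open>A\<close>: the substitution of
    \<open>l^d X\<close> multiplies \<open>A\<close> by \<open>l^(d t)\<close>.\<close>
  have scale: "l ^ (d * i) = l ^ (d * t)" if l: "l \<noteq> 0" and i: "coeff A i \<noteq> 0" for l :: 'a and i
  proof -
    have "pcompose A [:0, l ^ d:] = smult (l ^ (d * t)) A"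
    proof (rule poly_eq_if_same_values)
      show "degree (pcompose A [:0, l ^ d:]) < CARD('a)"
        using dA t l by (simp add: degree_pcompose)
      show "degree (smult (l ^ (d * t)) A) < CARD('a)" using dA t l by simp
      fix x
      have "val ((l * x) \<star> e + (1 / l ^ t) \<star> f) = poly A x"
        using orthogonal_pairs_scaling[OF pairs l, of x 1] by (simp add: pA t_def)
      moreover have "val ((l * x) \<star> e + (1 / l ^ t) \<star> f) = (1 / l ^ t) ^ d * poly A (l ^ d * x)"
        using l t by (subst hA) (auto simp: field_simps)
      ultimately have "(1 / l ^ t) ^ d * poly A (l ^ d * x) = poly A x" by simp
      then have "poly A (l ^ d * x) = l ^ (d * t) * poly A x"
        using l by (simp add: field_simps power_mult[symmetric])
      then show "poly (pcompose A [:0, l ^ d:]) x = poly (smult (l ^ (d * t)) A) x"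
        by (simp add: poly_pcompose mult.commute)
    qed
    then have "coeff (pcompose A [:0, l ^ d:]) i = coeff (smult (l ^ (d * t)) A) i" by simp
    then show ?thesis using i by (simp add: coeff_pcompose_linear power_mult[symmetric])
  qed
  have scale': "l ^ (d * (t - i)) = 1" if "l \<noteq> 0" "coeff A i \<noteq> 0" "i \<le> t" for l :: 'a and i
  proof -
    have "d * t = d * i + d * (t - i)" using that(3) by (simp add: diff_mult_distrib2)
    then have "l ^ (d * i) * l ^ (d * (t - i)) = l ^ (d * i) * 1"
      using scale[OF that(1,2)] by (simp only: power_add mult_1_right)
    then show ?thesis using that(1) by simp
  qed
  have val_y0: "val (x \<star> e + 0 \<star> f) = 0" for x using v0 by (simp add: val_scl)
  show ?thesis
  proof (cases "t = 1")
    case True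
    have "A = [:0, 1:]"
    proof (rule poly_eqI)
      fix i show "coeff A i = coeff [:0, 1:] i"
        using A0 At dA True coeff_eq_0[of A i] by (cases i; cases "i - 1") (auto simp: coeff_pCons)
    qed
    then have "val (x \<star> e + y \<star> f) = x * y" for x y
      using hA[of y x] val_y0[of x] t True by (cases "y = 0") (auto simp: power2_eq_square)
    then show ?thesis using t True by simp
  next
    case False
    then have t2: "2 \<le> t" using t by simp
    define T where "T = {b. poly A b = 0}"
    have cT: "card T = t"
      using secant_count[OF in_V(1) v0(1) in_V(2)] ef by (simp add: T_def pA t_def add.commute)
    have T0: "0 \<in> T" using v0 by (simp add: T_def pA)
    have "a + b \<in> T" if "a \<in> T" "b \<in> T" for a b
      using orthogonal_pairs_shift[OF pairs, of b a 1] that by (simp add: T_def pA)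
    from additive_subgroup_card_dvd[OF T0 this] have "t dvd CARD('a)" by (simp add: cT)
    have "x ^ (t ^ 2 - 1) = 1" if "x \<noteq> 0" for x :: 'a
    proof -
      have "d * (t - 1) = t ^ 2 - 1" using t t2 by (simp add: power2_eq_square algebra_simps)
      then show ?thesis using scale'[OF that A1] t by metis
    qed
    then have "CARD('a) - 1 dvd t ^ 2 - 1" by (rule unit_exponent_dvd)
    with square_of_dvd_conditions[OF t2 t(3) \<open>t dvd CARD('a)\<close>] have q: "CARD('a) = t ^ 2" by blast
    \<comment> \<open>Now \<open>q - 1 = d (t - 1)\<close>, and for \<open>1 < i < t\<close> the
      positive number \<open>d (t - i)\<close> is too small to be a multiple of it.\<close>
    have mid: "coeff A i = 0" if i: "1 < i" "i < t" for i
    proof (rule ccontr)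
      assume "coeff A i \<noteq> 0"
      then have "CARD('a) - 1 dvd d * (t - i)"
        using scale' i by (intro unit_exponent_dvd) auto
      moreover have "d * (t - i) > 0" using t i by simp
      ultimately have "CARD('a) - 1 \<le> d * (t - i)" by (rule dvd_imp_le)
      moreover have "CARD('a) - 1 = d * (t - 1)" using q t t2 by (simp add: power2_eq_square algebra_simps)
      moreover have "d * (t - i) < d * (t - 1)" using i t by (intro mult_strict_left_mono) auto
      ultimately show False by simp
    qed
    define a where "a = coeff A 1"
    have A: "A = monom 1 t + monom a 1"
    proof (rule poly_eqI)
      fix i
      consider "i = 0" | "i = 1" | "1 < i" "i < t" | "i = t" | "i > t" by linarith
      then show "coeff A i = coeff (monom 1 t + monom a 1) i"
        using A0 At dA t2 mid coeff_eq_0[of A i] by cases (auto simp: a_def)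
    qed
    have val_eq: "val (x \<star> e + y \<star> f) = x ^ t * y + a * (x * y ^ t)" for x y
    proof (cases "y = 0")
      case False
      have "val (x \<star> e + y \<star> f) = y ^ d * ((x / y) ^ t + a * (x / y))"
        using hA[OF False] by (simp add: A poly_monom)
      also have "\<dots> = x ^ t * y + a * (x * y ^ t)" using False t(2) by (simp add: field_simps)
      finally show ?thesis .
    qed (use val_y0 t in \<open>simp add: zero_power\<close>)
    have "T \<noteq> {0}" using cT t2 by auto
    then obtain b where b: "b \<in> T" "b \<noteq> 0" using T0 by blast
    have "b ^ t + a * b = 0" using b(1) by (simp add: T_def A poly_monom)
    moreover have "b ^ t = b ^ (t - 1) * b" using t by (simp add: power_eq_if)
    ultimately have "(b ^ (t - 1) + a) * b = 0" by (simp add: algebra_simps)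
    then have "b ^ (t - 1) + a = 0" using b(2) by simp
    then have "a = - (b ^ (t - 1))" by (rule add_eq_0_iff[THEN iffD1])
    then have "a ^ d = (- 1) ^ d * (b ^ (t - 1)) ^ d" by (simp only: power_minus[symmetric])
    also have "(b ^ (t - 1)) ^ d = 1"
    proof -
      have "(t - 1) * d = CARD('a) - 1" using q t t2 by (simp add: power2_eq_square algebra_simps)
      then show ?thesis using finite_field_power_eq_1[OF b(2)] by (simp add: power_mult[symmetric])
    qed
    \<comment> \<open>If \<open>d\<close> is odd then \<open>t\<close> is even, so
      \<open>q = t^2\<close> is even and signs disappear.\<close>
    also have "(- 1) ^ d = (1 :: 'a)"
    proof (cases "even d")
      case False
      then have "even CARD('a)" using q t by simp
      then have "(- 1 :: 'a) = 1" by (rule minus_one_eq_one_if_even)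
      then show ?thesis by (simp only: power_one)
    qed simp
    finally have "a ^ d = 1" by simp
    moreover have "3 \<le> d" using t t2 by simp
    ultimately show ?thesis using val_eq q unfolding t_def by blast
  qed
qed

section \<open>Assembling the binary forms\<close>

lemma hyperbolic_basis_pairs:
  assumes b: "hyperbolic_basis (vecs (Suc n)) K b" and ij: "i < K" "j < K" "i \<noteq> j"
  shows "orthogonal_pairs (b (2*i)) (b (2*i+1)) (b (2*j)) (b (2*j+1))"
  using b ij unfolding hyperbolic_basis_def orthogonal_pairs_def by auto

lemma val_hyperbolic_basis:
  assumes b: "hyperbolic_basis (vecs (Suc n)) K b" and k: "k \<le> K"
  shows "val (lincomb b (2*k) t) = (\<Sum>i<k. val (t (2*i) \<star> b (2*i) + t (2*i+1) \<star> b (2*i+1)))"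
  using k
proof (induction k)
  case 0
  have "lincomb b 0 t = 0" by (simp add: lincomb_def pointwise)
  then show ?case by simp
next
  case (Suc k)
  have bi: "b i \<in> vecs (Suc n)" "val (b i) = 0" if "i < 2 * K" for i
    using b that by (auto simp: hyperbolic_basis_def)
  have "val (t (2*k) \<star> b (2*k) + t (2*k+1) \<star> b (2*k+1) + lincomb b (2*k) t)
     = val (t (2*k) \<star> b (2*k) + t (2*k+1) \<star> b (2*k+1)) + val (lincomb b (2*k) t)"
  proof (rule split_pair_span)
    have "B (b (2*k)) (b (2*k+1)) = 1" using b Suc.prems by (auto simp: hyperbolic_basis_def)
    then show "B (b (2*k)) (b (2*k+1)) \<noteq> 0" by simp
    fix i assume i: "i < 2 * k"
    then have "i div 2 \<noteq> (2 * k) div 2" "i div 2 \<noteq> (2 * k + 1) div 2" by auto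
    then show "B (b i) (b (2*k)) = 0" "B (b i) (b (2*k+1)) = 0"
      using b Suc.prems i unfolding hyperbolic_basis_def by auto
  qed (use bi Suc.prems in auto)
  then show ?case using Suc by (simp add: lincomb_Suc add_ac del: scl_apply)
qed

text \<open>A second pair exists since \<open>K \<ge> 2\<close>, so pair \<open>0\<close> can be
  classified. Every other binary form is \<open>- h 0 x (- y)\<close> by the relation between pairs,
  and this is again the same form.\<close>

theorem extremal_normal_form:
  assumes b: "hyperbolic_basis (vecs (Suc n)) K b" and K2: "K \<ge> 2"
  shows "(d = 2 \<and> (\<forall>t. val (lincomb b (2*K) t) = (\<Sum>i<K. t (2*i) * t (2*i+1)))) \<or>
    (CARD('a) = (d - 1) ^ 2 \<and> (\<exists>\<mu>. \<mu> \<noteq> 0 \<and> (\<forall>t. val (lincomb b (2*K) t) =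
       (\<Sum>i<K. t (2*i) ^ (d - 1) * t (2*i+1) + \<mu> ^ (d - 2) * (t (2*i) * t (2*i+1) ^ (d - 1))))))"
proof -
  define h where "h i x y = val (x \<star> b (2*i) + y \<star> b (2*i+1))" for i x y
  have val_sum: "val (lincomb b (2*K) t) = (\<Sum>i<K. h i (t (2*i)) (t (2*i+1)))" for t
    using val_hyperbolic_basis[OF b order_refl] by (simp add: h_def)
  have rel: "h j x y = - h i x (- y)" if "i < K" "j < K" "i \<noteq> j" for i j x y
    using orthogonal_pairs_relation[OF hyperbolic_basis_pairs[OF b that], of 1 x "- y"] by (simp add: h_def)
  have "0 < K" "1 < K" using K2 by auto
  then have "orthogonal_pairs (b (2*0)) (b (2*0+1)) (b (2*1)) (b (2*1+1))"
    by (intro hyperbolic_basis_pairs[OF b]) auto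
  from binary_form_classification[OF this]
  consider "d = 2" "\<forall>x y. val (x \<star> b (2*0) + y \<star> b (2*0+1)) = x * y"
    | a where "3 \<le> d" "CARD('a) = (d - 1) ^ 2" "a ^ d = 1"
      "\<forall>x y. val (x \<star> b (2*0) + y \<star> b (2*0+1)) = x ^ (d - 1) * y + a * (x * y ^ (d - 1))"
    by blast
  then show ?thesis
  proof cases
    assume d: "d = 2" and *: "\<forall>x y. val (x \<star> b (2*0) + y \<star> b (2*0+1)) = x * y"
    have "h i x y = x * y" if "i < K" for i x y
      using * rel[of 0 i x y] that K2 by (cases "i = 0") (auto simp: h_def)
    then show ?thesis using d val_sum by simp
  next
    fix a assume d: "3 \<le> d" and q: "CARD('a) = (d - 1) ^ 2" and a: "a ^ d = 1"
      and *: "\<forall>x y. val (x \<star> b (2*0) + y \<star> b (2*0+1)) = x ^ (d - 1) * y + a * (x * y ^ (d - 1))"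
    \<comment> \<open>Either \<open>d - 1\<close> is odd, or \<open>q = (d - 1)^2\<close> is even
      and \<open>-1 = 1\<close>.\<close>
    have sgn: "- ((- y) ^ (d - 1)) = y ^ (d - 1)" for y :: 'a
    proof (cases "odd (d - 1)")
      case False
      then have "even CARD('a)" using q d by simp
      then have m: "(- 1 :: 'a) = 1" by (rule minus_one_eq_one_if_even)
      have "- z = z" for z :: 'a using arg_cong[OF m, of "\<lambda>u. u * z"] by simp
      then show ?thesis by (simp only:)
    qed simp
    have h: "h i x y = x ^ (d - 1) * y + a * (x * y ^ (d - 1))" if "i < K" for i x y
    proof (cases "i = 0")
      case True
      then show ?thesis using * by (simp add: h_def)
    next
      case False
      have "h i x y = - (x ^ (d - 1) * (- y) + a * (x * (- y) ^ (d - 1)))"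
        using rel[of 0 i x y] that False K2 * by (simp add: h_def)
      also have "\<dots> = x ^ (d - 1) * y + a * (x * - ((- y) ^ (d - 1)))" by (simp add: algebra_simps)
      finally show ?thesis by (simp only: sgn)
    qed
    \<comment> \<open>Writing \<open>a\<close> as \<open>\<mu>^(d - 2)\<close> prepares the
      rescaling of basis vectors that removes this coefficient.\<close>
    have "a ^ (d - 1 + 1) = 1" "2 \<le> d - 1" using a d by simp_all
    then obtain \<mu> where \<mu>: "\<mu> \<noteq> 0" "\<mu> ^ (d - 1 - 1) = a"
      using power_image_units[OF q] by blast
    have "d - 1 - 1 = d - 2" by simp
    then have "\<forall>t. val (lincomb b (2*K) t) =
       (\<Sum>i<K. t (2*i) ^ (d - 1) * t (2*i+1) + \<mu> ^ (d - 2) * (t (2*i) * t (2*i+1) ^ (d - 1)))"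
      unfolding val_sum \<mu>(2)[symmetric] by (intro allI sum.cong refl) (simp add: h \<mu>(2)[symmetric])
    then show ?thesis using q \<mu>(1) by blast
  qed
qed

end

section \<open>Forms are determined by their values\<close>

text \<open>As a polynomial in the last variable the sum has degree below \<open>q\<close>, so each
  of its coefficients vanishes identically. Restriction to the monomials with one fixed exponent
  there keeps the others distinguishable by the first \<open>k\<close> exponents, and the induction
  continues.\<close>

lemma vanishing_reduced_sum:
  fixes c :: "(nat \<Rightarrow>\<^sub>0 nat) \<Rightarrow> 'a::{field,finite}"
  assumes "finite S" "\<And>m i. m \<in> S \<Longrightarrow> Poly_Mapping.lookup m i < CARD('a)"
    and "\<And>m m'. m \<in> S \<Longrightarrow> m' \<in> S \<Longrightarrow> (\<And>i. i < k \<Longrightarrow> Poly_Mapping.lookup m i = Poly_Mapping.lookup m' i) \<Longrightarrow> m = m'"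
    and "\<And>x. (\<Sum>m\<in>S. c m * (\<Prod>i<k. x i ^ Poly_Mapping.lookup m i)) = 0"
    and "m \<in> S"
  shows "c m = 0"
  using assms
proof (induction k arbitrary: S m)
  case 0
  then have "S = {m}" by auto
  then show ?case using "0.prems"(4)[of "\<lambda>_. 0"] by simp
next
  case (Suc k)
  define j where "j = Poly_Mapping.lookup m k"
  define S' where "S' = {m' \<in> S. Poly_Mapping.lookup m' k = j}"
  show ?case
  proof (rule Suc.IH[of S'])
    show "finite S'" using Suc.prems(1) by (simp add: S'_def)
    show "m \<in> S'" using Suc.prems(5) by (simp add: S'_def j_def)
    show "\<And>m i. m \<in> S' \<Longrightarrow> Poly_Mapping.lookup m i < CARD('a)" using Suc.prems(2) by (simp add: S'_def)
    fix u w assume uw: "u \<in> S'" "w \<in> S'" "\<And>i. i < k \<Longrightarrow> Poly_Mapping.lookup u i = Poly_Mapping.lookup w i"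
    show "u = w"
    proof (rule Suc.prems(3))
      fix i assume "i < Suc k"
      then show "Poly_Mapping.lookup u i = Poly_Mapping.lookup w i"
        using uw by (cases "i = k") (auto simp: S'_def)
    qed (use uw in \<open>auto simp: S'_def\<close>)
  next
    fix x
    define p where "p = (\<Sum>m\<in>S. monom (c m * (\<Prod>i<k. x i ^ Poly_Mapping.lookup m i)) (Poly_Mapping.lookup m k))"
    have "p = 0"
    proof (rule poly_zero_if_vanishing)
      show "degree p < CARD('a)"
        unfolding p_def using Suc.prems(1,2) by (intro degree_sum_less) (auto intro: le_less_trans[OF degree_monom_le])
      fix y
      have "poly p y = (\<Sum>m\<in>S. c m * (\<Prod>i<Suc k. (x(k := y)) i ^ Poly_Mapping.lookup m i))"
        by (simp add: p_def poly_sum poly_monom mult.assoc)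
      then show "poly p y = 0" using Suc.prems(4)[of "x(k := y)"] by simp
    qed
    then have "coeff p j = 0" by simp
    then have "(\<Sum>m\<in>S. if Poly_Mapping.lookup m k = j then c m * (\<Prod>i<k. x i ^ Poly_Mapping.lookup m i) else 0) = 0"
      by (simp add: p_def coeff_sum)
    then show "(\<Sum>m\<in>S'. c m * (\<Prod>i<k. x i ^ Poly_Mapping.lookup m i)) = 0"
      using Suc.prems(1) by (simp add: S'_def sum.inter_filter)
  qed
qed

lemma mdeg_eq_0_iff: "mdeg m = 0 \<longleftrightarrow> m = 0"
proof
  assume "mdeg m = 0"
  then show "m = 0" by (metis le_zero_eq lookup_le_mdeg lookup_zero poly_mapping_eqI)
qed simp

lemma single_plus_diff:
  fixes m :: "nat \<Rightarrow>\<^sub>0 nat"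
  assumes "k \<le> Poly_Mapping.lookup m i"
  shows "m = Poly_Mapping.single i k + (m - Poly_Mapping.single i k)"
  using assms by (intro poly_mapping_eqI) (auto simp: lookup_add lookup_minus lookup_single when_def)

lemma mdeg_eq_1:
  assumes "mdeg m = 1" obtains j where "m = Poly_Mapping.single j 1"
proof -
  have "m \<noteq> 0" using assms by auto
  then obtain j where j: "j \<in> Poly_Mapping.keys m" by fastforce
  then have s: "m = Poly_Mapping.single j 1 + (m - Poly_Mapping.single j 1)"
    by (intro single_plus_diff) (simp add: in_keys_iff)
  then have "mdeg (m - Poly_Mapping.single j 1) = 0"
    using assms by (metis add_cancel_left_right mdeg_plus mdeg_single)
  then have "m = Poly_Mapping.single j 1" using s by (simp add: mdeg_eq_0_iff)
  then show ?thesis using that by blast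
qed

text \<open>Up to degree \<open>q + 1\<close> the only monomials with an exponent \<open>q\<close>
  or more are pure powers and \<open>X\<^sub>i^q X\<^sub>j\<close>. The latter must be excluded by
  hypothesis, because \<open>X\<^sub>i^q X\<^sub>j - X\<^sub>i X\<^sub>j^q\<close> vanishes at every
  rational point.\<close>

lemma form_eq_0_if_vanishing:
  fixes H :: "'a::{field,finite} mpoly"
  assumes H: "form n d H" and d: "d \<le> CARD('a) + 1" and van: "\<And>x. mp_eval id x H = 0"
    and mixed: "\<And>i j. d = CARD('a) + 1 \<Longrightarrow> i \<noteq> j \<Longrightarrow>
        Poly_Mapping.lookup H (Poly_Mapping.single i CARD('a) + Poly_Mapping.single j 1) = 0"
  shows "H = 0"
proof (rule ccontr)
  assume "H \<noteq> 0"
  \<comment> \<open>Evaluation at the \<open>i\<close>-th unit vector isolates this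
    coefficient.\<close>
  have pure: "Poly_Mapping.lookup H (Poly_Mapping.single i d) = 0" for i
  proof -
    let ?e = "\<lambda>j. if j = i then 1 else 0 :: 'a"
    have *: "mon ?e m = (if m = Poly_Mapping.single i d then 1 else 0)" if m: "m \<in> Poly_Mapping.keys H" for m
    proof (cases "Poly_Mapping.keys m \<subseteq> {i}")
      case True
      then have "mdeg m = Poly_Mapping.lookup m i" by (subst mdeg_superset[of "{i}"]) auto
      then have "Poly_Mapping.lookup m i = d" using H m by (simp add: form_def)
      then have "m = Poly_Mapping.single i d"
        using True by (intro poly_mapping_eqI) (auto simp: lookup_single when_def in_keys_iff subset_iff)
      then show ?thesis by simp
    next
      case False
      then obtain j where "j \<in> Poly_Mapping.keys m" "j \<noteq> i" by blast
      then have "mon ?e m = 0" unfolding mon_def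
        by (intro prod_zero) (auto simp: in_keys_iff intro!: bexI[of _ j])
      moreover have "m \<noteq> Poly_Mapping.single i d"
        using \<open>j \<in> Poly_Mapping.keys m\<close> \<open>j \<noteq> i\<close> by (auto simp: in_keys_iff lookup_single)
      ultimately show ?thesis by simp
    qed
    have "0 = (\<Sum>m\<in>Poly_Mapping.keys H. Poly_Mapping.lookup H m * (if m = Poly_Mapping.single i d then 1 else 0))"
      using van[of ?e] * by (simp add: mp_eval_mon)
    also have "\<dots> = Poly_Mapping.lookup H (Poly_Mapping.single i d)"
      by (auto simp: if_distrib[of "\<lambda>x. _ * x"] in_keys_iff cong: if_cong)
    finally show ?thesis by simp
  qed
  have red: "Poly_Mapping.lookup m i < CARD('a)" if m: "m \<in> Poly_Mapping.keys H" for m i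
  proof (rule ccontr)
    assume "\<not> ?thesis"
    then have ge: "CARD('a) \<le> Poly_Mapping.lookup m i" by simp
    define m' where "m' = m - Poly_Mapping.single i CARD('a)"
    have mm': "m = Poly_Mapping.single i CARD('a) + m'" unfolding m'_def by (rule single_plus_diff[OF ge])
    have dm: "mdeg m = d" using H m by (simp add: form_def)
    then have "CARD('a) + mdeg m' = d" using mm' by (metis mdeg_plus mdeg_single)
    then consider "mdeg m' = 0" "d = CARD('a)" | "mdeg m' = 1" "d = CARD('a) + 1" using d by linarith
    then show False
    proof cases
      case 1
      then show False using pure[of i] m mm' by (simp add: mdeg_eq_0_iff in_keys_iff)
    next
      case 2
      obtain j where j: "m' = Poly_Mapping.single j 1" using mdeg_eq_1[OF 2(1)] .
      show False
      proof (cases "i = j")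
        case True
        then have "m = Poly_Mapping.single i d" using mm' j 2 by (simp add: single_add[symmetric])
        then show False using pure[of i] m by (simp add: in_keys_iff)
      next
        case False
        then show False using mixed[OF 2(2) False] m mm' j by (simp add: in_keys_iff)
      qed
    qed
  qed
  obtain m where m: "m \<in> Poly_Mapping.keys H" using \<open>H \<noteq> 0\<close> by fastforce
  have "Poly_Mapping.lookup H m = 0"
  proof (rule vanishing_reduced_sum[where S = "Poly_Mapping.keys H" and k = "Suc n"])
    fix m m' assume mm: "m \<in> Poly_Mapping.keys H" "m' \<in> Poly_Mapping.keys H"
      and eq: "\<And>i. i < Suc n \<Longrightarrow> Poly_Mapping.lookup m i = Poly_Mapping.lookup m' i"
    have z: "Poly_Mapping.lookup m'' i = 0" if "m'' \<in> Poly_Mapping.keys H" "\<not> i < Suc n" for m'' i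
    proof -
      have "Poly_Mapping.keys m'' \<subseteq> {..n}" using H that(1) by (simp add: form_def)
      then have "i \<notin> Poly_Mapping.keys m''" using that(2) by auto
      then show ?thesis by (simp add: in_keys_iff)
    qed
    show "m = m'"
      using eq z[OF mm(1)] z[OF mm(2)] by (intro poly_mapping_eqI) metis
  next
    fix x
    have "(\<Sum>m\<in>Poly_Mapping.keys H. Poly_Mapping.lookup H m * (\<Prod>i<Suc n. x i ^ Poly_Mapping.lookup m i)) = mp_eval id x H"
      unfolding mp_eval_mon id_apply
    proof (rule sum.cong[OF refl])
      fix m assume "m \<in> Poly_Mapping.keys H"
      then have "Poly_Mapping.keys m \<subseteq> {..<Suc n}" using H by (simp add: form_def lessThan_Suc_atMost)
      then show "Poly_Mapping.lookup H m * (\<Prod>i<Suc n. x i ^ Poly_Mapping.lookup m i) = Poly_Mapping.lookup H m * mon x m"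
        using mon_superset[of "{..<Suc n}" m x] by simp
    qed
    then show "(\<Sum>m\<in>Poly_Mapping.keys H. Poly_Mapping.lookup H m * (\<Prod>i<Suc n. x i ^ Poly_Mapping.lookup m i)) = 0"
      using van by simp
  qed (use red m in auto)
  then show False using m by (simp add: in_keys_iff)
qed

section \<open>Homogeneity under algebraic operations\<close>

lemma form_diff: "form n d p \<Longrightarrow> form n d q \<Longrightarrow> form n d (p - q :: 'a::ring_1 mpoly)"
  unfolding form_def using keys_diff[of p q] by blast

lemma form_add: "form n d p \<Longrightarrow> form n d q \<Longrightarrow> form n d (p + q :: 'a::comm_monoid_add mpoly)"
  unfolding form_def using Poly_Mapping.keys_add[of p q] by blast

lemma form_0 [simp]: "form n d 0"
  by (simp add: form_def)

lemma form_sum: "(\<And>i. i \<in> A \<Longrightarrow> form n d (f i)) \<Longrightarrow> form n d (sum f A :: 'a::comm_monoid_add mpoly)"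
  by (induction A rule: infinite_finite_induct) (auto intro: form_add)

lemma form_mult:
  assumes "form n d p" "form n d' q"
  shows "form n (d + d') (p * q :: 'a::comm_semiring_1 mpoly)"
  unfolding form_def
proof
  fix m assume "m \<in> Poly_Mapping.keys (p * q)"
  then obtain a b where "m = a + b" "a \<in> Poly_Mapping.keys p" "b \<in> Poly_Mapping.keys q"
    using Poly_Mapping.keys_mult[of p q] by blast
  then show "Poly_Mapping.keys m \<subseteq> {..n} \<and> mdeg m = d + d'"
    using assms by (auto simp: form_def keys_plus_nat mdeg_plus)
qed

lemma form_const [simp]: "form n 0 (mp_const c)"
  by (simp add: form_def mp_const_def)

lemma form_one [simp]: "form n 0 (1 :: 'a::comm_semiring_1 mpoly)"
  by (simp add: form_def)

lemma form_var: "i \<le> n \<Longrightarrow> form n 1 (mp_var i)"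
  by (simp add: form_def mp_var_def)

lemma form_power: "form n d p \<Longrightarrow> form n (k * d) (p ^ k :: 'a::comm_semiring_1 mpoly)"
proof (induction k)
  case (Suc k)
  then show ?case using form_mult[of n d p "k * d" "p ^ k"] by simp
qed simp

lemma form_linear_subst:
  fixes F :: "'a::field mpoly"
  assumes "form n d F"
  shows "form n d (linear_subst n A F)"
proof -
  define l where "l i = (\<Sum>j=0..n. mp_const (A $$ (i, j)) * mp_var j)" for i
  have l: "form n 1 (l i)" for i
    unfolding l_def
  proof (rule form_sum)
    fix j assume "j \<in> {0..n}"
    then show "form n 1 (mp_const (A $$ (i, j)) * mp_var j)"
      using form_mult[OF form_const form_var, of j n] by simp
  qed
  have pr: "form n (\<Sum>i\<in>I. e i) (\<Prod>i\<in>I. l i ^ e i)" if "finite I" for I e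
    using that
  proof (induction I rule: finite_induct)
    case (insert i I)
    then show ?case using form_mult[OF form_power[OF l[of i], of "e i"] insert.IH] by simp
  qed simp
  have "form n d (mp_const (Poly_Mapping.lookup F m) * mon l m)" if "m \<in> Poly_Mapping.keys F" for m
    using form_mult[OF form_const pr[of "Poly_Mapping.keys m" "Poly_Mapping.lookup m"]] assms that
    by (simp add: mon_def form_def mdeg_def)
  then show ?thesis unfolding linear_subst_def mp_eval_mon l_def[symmetric] by (intro form_sum)
qed

lemma form_eqI:
  fixes G H :: "'a::{field,finite} mpoly"
  assumes "form n d G" "form n d H" "d \<le> CARD('a)" "\<And>x. mp_eval id x G = mp_eval id x H"
  shows "G = H"
proof -
  have "G - H = 0"
    using assms by (intro form_eq_0_if_vanishing[OF form_diff]) (auto simp: mp_eval_diff[OF ring_morphism_id])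
  then show ?thesis by simp
qed

section \<open>Change of coordinates\<close>

text \<open>The basis vectors are the columns, so that \<open>linear_subst\<close> with this matrix
  writes the form in the coordinates of \<open>b\<close>.\<close>

definition basis_mat :: "nat \<Rightarrow> (nat \<Rightarrow> nat \<Rightarrow> 'a) \<Rightarrow> 'a mat" where
  "basis_mat n b = mat (Suc n) (Suc n) (\<lambda>(i, j). b j i)"

lemma basis_mat_carrier [simp]: "basis_mat n b \<in> carrier_mat (Suc n) (Suc n)"
  by (simp add: basis_mat_def)

lemma mp_eval_form_cong:
  assumes "form n d F" "\<And>i. i \<le> n \<Longrightarrow> x i = y i"
  shows "mp_eval h x F = mp_eval h y F"
  using assms by (intro mp_eval_cong) (auto simp: form_def subset_iff)

lemma mp_eval_basis_subst:
  assumes h: "ring_morphism (h :: 'a::field \<Rightarrow> 'b::comm_ring_1)" and F: "form n d F"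
  shows "mp_eval h y (linear_subst n (basis_mat n b) F) = mp_eval h (\<lambda>i. \<Sum>j\<le>n. h (b j i) * y j) F"
  unfolding mp_eval_linear_subst[OF h]
proof (rule mp_eval_form_cong[OF F])
  fix i assume "i \<le> n"
  then show "(\<Sum>j = 0..n. h (basis_mat n b $$ (i, j)) * y j) = (\<Sum>j\<le>n. h (b j i) * y j)"
    by (simp add: basis_mat_def atLeast0AtMost)
qed

lemma val_basis_subst:
  fixes F :: "'a::field mpoly"
  assumes "form n d F"
  shows "mp_eval id t (linear_subst n (basis_mat n b) F) = mp_eval id (lincomb b (Suc n) t) F"
  unfolding mp_eval_basis_subst[OF ring_morphism_id assms]
  by (simp add: lincomb_def lessThan_Suc_atMost mult.commute)

text \<open>The columns of \<open>C\<close> are coordinates of the unit vectors, which gives one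
  product by construction. The other follows because a surjection of the finite space onto itself is
  injective.\<close>

lemma basis_inverse:
  fixes b :: "nat \<Rightarrow> nat \<Rightarrow> 'a::{field,finite}"
  assumes b: "lincomb b (Suc n) ` vecs (Suc n) = vecs (Suc n)"
  shows "\<exists>C\<in>carrier_mat (Suc n) (Suc n). basis_mat n b * C = 1\<^sub>m (Suc n) \<and> C * basis_mat n b = 1\<^sub>m (Suc n)"
proof -
  define e where "e i = (\<lambda>l. if l = i then 1 else 0 :: 'a)" for i :: nat
  have e_vecs: "e i \<in> vecs (Suc n)" if "i < Suc n" for i using that by (auto simp: e_def vecs_def)
  have "\<exists>t. lincomb b (Suc n) t = e i" if "i < Suc n" for i
    using e_vecs[OF that] b by (metis imageE)
  then obtain c where c: "\<And>i. i < Suc n \<Longrightarrow> lincomb b (Suc n) (c i) = e i" by metis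
  have inj: "inj_on (lincomb b (Suc n)) (vecs (Suc n))"
    by (rule eq_card_imp_inj_on) (simp_all only: finite_vecs b)
  define C where "C = mat (Suc n) (Suc n) (\<lambda>(j, i). c i j)"
  have C: "C \<in> carrier_mat (Suc n) (Suc n)" by (simp add: C_def)
  have cb: "(\<Sum>l<Suc n. c i l * b l k) = e i k" if "i < Suc n" for i k
    using c[OF that] by (metis lincomb_apply)
  have "basis_mat n b * C = 1\<^sub>m (Suc n)"
  proof (rule eq_matI)
    fix l i assume li: "l < dim_row (1\<^sub>m (Suc n) :: 'a mat)" "i < dim_col (1\<^sub>m (Suc n) :: 'a mat)"
    then have "(basis_mat n b * C) $$ (l, i) = (\<Sum>j<Suc n. c i j * b j l)"
      by (simp add: basis_mat_def C_def scalar_prod_def atLeast0LessThan mult.commute)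
    then show "(basis_mat n b * C) $$ (l, i) = 1\<^sub>m (Suc n) $$ (l, i)" using cb[of i l] li by (simp add: e_def)
  qed (auto simp: basis_mat_def C_def)
  moreover have "C * basis_mat n b = 1\<^sub>m (Suc n)"
  proof (rule eq_matI)
    fix l j assume lj: "l < dim_row (1\<^sub>m (Suc n) :: 'a mat)" "j < dim_col (1\<^sub>m (Suc n) :: 'a mat)"
    define s where "s = (\<lambda>l. if l < Suc n then \<Sum>i<Suc n. c i l * b j i else 0)"
    have s: "s \<in> vecs (Suc n)" by (simp add: s_def vecs_def)
    have ej: "e j \<in> vecs (Suc n)" using e_vecs lj by simp
    have "lincomb b (Suc n) s = lincomb b (Suc n) (e j)"
    proof
      fix k
      show "lincomb b (Suc n) s k = lincomb b (Suc n) (e j) k"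
      proof (cases "k < Suc n")
        case True
        have "lincomb b (Suc n) s k = (\<Sum>l<Suc n. (\<Sum>i<Suc n. c i l * b j i) * b l k)"
          unfolding lincomb_apply by (rule sum.cong) (auto simp: s_def)
        also have "\<dots> = (\<Sum>i<Suc n. b j i * (\<Sum>l<Suc n. c i l * b l k))"
          unfolding sum_distrib_left sum_distrib_right by (subst sum.swap) (simp only: mult_ac)
        also have "\<dots> = (\<Sum>i<Suc n. if i = k then b j k else 0)"
        proof (rule sum.cong[OF refl])
          fix i assume "i \<in> {..<Suc n}"
          then show "b j i * (\<Sum>l<Suc n. c i l * b l k) = (if i = k then b j k else 0)"
            by (simp only: cb lessThan_iff) (simp add: e_def)
        qed
        also have "\<dots> = b j k" using True by simp
        also have "\<dots> = lincomb b (Suc n) (e j) k" using lincomb_unit[of j "Suc n" b] lj by (simp add: e_def)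
        finally show ?thesis .
      next
        case False
        have "lincomb b (Suc n) s \<in> vecs (Suc n)" "lincomb b (Suc n) (e j) \<in> vecs (Suc n)" using b s ej by blast+
        then show ?thesis using False by (simp add: vecs_def)
      qed
    qed
    then have "s = e j" using inj s ej by (simp add: inj_on_eq_iff)
    then have "s l = e j l" by simp
    moreover have "(C * basis_mat n b) $$ (l, j) = s l"
      using lj by (simp add: basis_mat_def C_def scalar_prod_def atLeast0LessThan s_def)
    ultimately show "(C * basis_mat n b) $$ (l, j) = 1\<^sub>m (Suc n) $$ (l, j)" using lj by (simp add: e_def)
  qed (auto simp: basis_mat_def C_def)
  ultimately show ?thesis using C by blast
qed

lemma invertible_basis_mat:
  fixes b :: "nat \<Rightarrow> nat \<Rightarrow> 'a::{field,finite}"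
  assumes "lincomb b (Suc n) ` vecs (Suc n) = vecs (Suc n)"
  shows "invertible_mat (basis_mat n b)"
  using basis_inverse[OF assms] unfolding invertible_mat_def inverts_mat_def
  by (auto simp: basis_mat_def)

lemma line_poly_basis_subst:
  assumes h: "ring_morphism (h :: 'a::field \<Rightarrow> 'b::comm_ring_1)" and F: "form n d F"
  shows "line_poly h (linear_subst n (basis_mat n b) F) u v
     = line_poly h F (\<lambda>i. \<Sum>j\<le>n. h (b j i) * u j) (\<lambda>i. \<Sum>j\<le>n. h (b j i) * v j)"
proof -
  have s: "(\<Sum>j\<in>J. [:h (b j i):] * [:u j, v j:]) = [:\<Sum>j\<in>J. h (b j i) * u j, \<Sum>j\<in>J. h (b j i) * v j:]" for i J
    by (induction J rule: infinite_finite_induct) auto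
  show ?thesis
    unfolding line_poly_def mp_eval_basis_subst[OF ring_morphism_poly_const[OF h] F] s ..
qed

section \<open>Linear subspaces of nonsingular hypersurfaces\<close>

text \<open>The Jacobian criterion for points given as functions, to which \<open>line_poly\<close>
  applies without conversion from \<open>vec\<close>.\<close>

definition smooth_at_points :: "nat \<Rightarrow> 'a::field mpoly \<Rightarrow> bool" where
  "smooth_at_points n F \<longleftrightarrow> (\<forall>x. (\<exists>i\<le>n. x i \<noteq> 0) \<longrightarrow> mp_eval to_ac x F = 0 \<longrightarrow>
     (\<exists>i\<le>n. mp_eval to_ac x (mp_pderiv i F) \<noteq> 0))"

lemma smooth_at_pointsD:
  assumes "smooth_at_points n F" "\<exists>i\<le>n. x i \<noteq> 0" "mp_eval to_ac x F = 0"
  shows "\<exists>i\<le>n. mp_eval to_ac x (mp_pderiv i F) \<noteq> 0"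
  using assms(1)[unfolded smooth_at_points_def, rule_format, OF assms(2,3)] .

lemma mp_eval_pderiv_cong:
  assumes h: "ring_morphism (h :: 'a::comm_ring_1 \<Rightarrow> 'b::comm_ring_1)" and F: "form n d F"
    and "\<And>i. i \<le> n \<Longrightarrow> x i = y i"
  shows "mp_eval h x (mp_pderiv j F) = mp_eval h y (mp_pderiv j F)"
proof -
  have "mon x (m - Poly_Mapping.single j 1) = mon y (m - Poly_Mapping.single j 1)"
    if "m \<in> Poly_Mapping.keys F" for m
  proof (rule mon_cong)
    fix i assume "i \<in> Poly_Mapping.keys (m - Poly_Mapping.single j 1)"
    then have "i \<in> Poly_Mapping.keys m" by (auto simp: in_keys_iff lookup_minus)
    then show "x i = y i" using assms that by (auto simp: form_def)
  qed
  then show ?thesis unfolding mp_eval_pderiv[OF h] by simp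
qed

lemma smooth_at_points_iff:
  fixes F :: "'a::field mpoly"
  assumes "form n d F"
  shows "nonsingular_hypersurface n F \<longleftrightarrow> smooth_at_points n F"
proof -
  note h = ring_morphism_to_ac[where 'a = 'a]
  show ?thesis
  proof
    assume ns: "nonsingular_hypersurface n F"
    show "smooth_at_points n F"
      unfolding smooth_at_points_def
    proof (intro allI impI)
      fix x :: "nat \<Rightarrow> 'a alg_closure"
      assume x: "\<exists>i\<le>n. x i \<noteq> 0" "mp_eval to_ac x F = 0"
      define v where "v = vec (Suc n) x"
      have "v \<in> carrier_vec (Suc n)" by (simp add: v_def)
      moreover have "v \<noteq> 0\<^sub>v (Suc n)"
      proof
        assume "v = 0\<^sub>v (Suc n)"
        then have "v $ i = 0" if "i \<le> n" for i using that by simp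
        then show False using x(1) by (auto simp: v_def)
      qed
      moreover have vx: "v $ i = x i" if "i \<le> n" for i using that by (simp add: v_def)
      have "mp_eval to_ac (($) v) F = mp_eval to_ac x F" by (rule mp_eval_form_cong[OF assms vx])
      then have "mp_eval to_ac (($) v) F = 0" using x(2) by simp
      ultimately obtain i where "i \<le> n" "mp_eval to_ac (($) v) (mp_pderiv i F) \<noteq> 0"
        using ns unfolding nonsingular_hypersurface_def by blast
      moreover have "mp_eval to_ac (($) v) (mp_pderiv i F) = mp_eval to_ac x (mp_pderiv i F)"
        by (rule mp_eval_pderiv_cong[OF h assms vx])
      ultimately show "\<exists>i\<le>n. mp_eval to_ac x (mp_pderiv i F) \<noteq> 0" by auto
    qed
  next
    assume sm: "smooth_at_points n F"
    show "nonsingular_hypersurface n F"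
      unfolding nonsingular_hypersurface_def
    proof clarify
      fix v :: "'a alg_closure vec"
      assume v: "v \<in> carrier_vec (Suc n)" "v \<noteq> 0\<^sub>v (Suc n)" "mp_eval to_ac (($) v) F = 0"
        "\<forall>i\<le>n. mp_eval to_ac (($) v) (mp_pderiv i F) = 0"
      have "\<exists>i\<le>n. v $ i \<noteq> 0"
      proof (rule ccontr)
        assume "\<not> ?thesis"
        then have "v = 0\<^sub>v (Suc n)" using v(1) by (intro eq_vecI) auto
        then show False using v(2) by simp
      qed
      from smooth_at_pointsD[OF sm this v(3)] show False using v(4) by blast
    qed
  qed
qed

text \<open>If \<open>F\<close> vanishes on the first \<open>r + 2\<close> of \<open>2r + 2\<close> coordinates, only the \<open>r\<close>
  derivatives in the other directions can be nonzero there, and they have a common zero.\<close>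

lemma singular_of_large_coordinate_subspace:
  fixes F :: "'a::{field,finite} mpoly"
  assumes F: "form n d F" and d: "2 \<le> d" "d \<le> CARD('a)" and n: "Suc n = 2 * r + 2"
    and van: "\<And>x. x \<in> vecs (r + 2) \<Longrightarrow> mp_eval id x F = 0"
  shows "\<not> smooth_at_points n F"
proof -
  let ?k = "r + 2"
  \<comment> \<open>The part of \<open>F\<close> in the first \<open>r + 2\<close> variables
    vanishes at all rational points; since \<open>d \<le> q\<close>, it is the zero polynomial. So
    every monomial of \<open>F\<close> contains a further variable.\<close>
  have no_pure: "Poly_Mapping.lookup F m = 0" if m: "Poly_Mapping.keys m \<subseteq> {..<?k}" for m
  proof -
    define S where "S = {m \<in> Poly_Mapping.keys F. Poly_Mapping.keys m \<subseteq> {..<?k}}"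
    define H where "H = (\<Sum>m\<in>S. Poly_Mapping.single m (Poly_Mapping.lookup F m))"
    have fS: "finite S" by (simp add: S_def)
    have lH: "Poly_Mapping.lookup H m = (if m \<in> S then Poly_Mapping.lookup F m else 0)" for m
      using fS by (simp add: H_def lookup_sum lookup_single when_def)
    interpret ring_morphism "id :: 'a \<Rightarrow> 'a" by (rule ring_morphism_id)
    have "H = 0"
    proof (rule form_eq_0_if_vanishing)
      show "form n d H" using F by (auto simp: form_def in_keys_iff lH S_def split: if_splits)
      show "d \<le> CARD('a) + 1" using d by simp
      fix x :: "nat \<Rightarrow> 'a"
      define x' where "x' = (\<lambda>i. if i < ?k then x i else 0)"
      have *: "mon x' m = (if m \<in> S then mon x m else 0)" if mF: "m \<in> Poly_Mapping.keys F" for m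
      proof (cases "m \<in> S")
        case True
        then have "mon x' m = mon x m" by (intro mon_cong) (auto simp: S_def x'_def)
        then show ?thesis using True by simp
      next
        case False
        then obtain j where "j \<in> Poly_Mapping.keys m" "\<not> j < ?k" using mF by (auto simp: S_def)
        then have "mon x' m = 0" unfolding mon_def
          by (intro prod_zero) (auto simp: in_keys_iff x'_def intro!: bexI[of _ j])
        then show ?thesis using False by simp
      qed
      have "mp_eval id x H = (\<Sum>m\<in>S. Poly_Mapping.lookup F m * mon x m)"
        unfolding H_def mp_eval_sum by simp
      also have "\<dots> = (\<Sum>m\<in>Poly_Mapping.keys F. Poly_Mapping.lookup F m * mon x' m)"
        by (rule sum.mono_neutral_cong_left) (auto simp: * S_def)
      also have "\<dots> = mp_eval id x' F" by (simp add: mp_eval_mon)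
      also have "\<dots> = 0" by (rule van) (simp add: x'_def vecs_def)
      finally show "mp_eval id x H = 0" .
    qed (use d in auto)
    then have "Poly_Mapping.lookup H m = 0" by simp
    then show ?thesis using m by (auto simp: lH S_def in_keys_iff split: if_splits)
  qed
  \<comment> \<open>Up to terms of degree at least two in the remaining variables, \<open>F\<close>
    is the sum of \<open>X\<^sub>k\<^sub>+\<^sub>i\<close> times the form with coefficients
    \<open>a i\<close>, where \<open>k = r + 2\<close>. On the subspace this form is the derivative
    in direction \<open>k + i\<close>, and derivatives inside the subspace vanish.\<close>
  define a where "a i \<mu> = Poly_Mapping.lookup F (\<mu> + Poly_Mapping.single (?k + i) 1)" for i \<mu>
  have "1 \<le> d - 1" using d by simp
  from common_zero_of_forms[OF this order_refl, where a = a]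
  obtain \<alpha> :: "nat \<Rightarrow> 'a alg_closure" where \<alpha>: "\<exists>i<?k. \<alpha> i \<noteq> 0"
    and zero: "\<And>i. i < r \<Longrightarrow> (\<Sum>\<mu>\<in>exps ?k (d - 1). to_ac (a i \<mu>) * mon \<alpha> \<mu>) = 0" by blast
  define y where "y = (\<lambda>i. if i < ?k then \<alpha> i else 0)"
  have mon_y0: "mon y m = 0" if nk: "\<not> Poly_Mapping.keys m \<subseteq> {..<?k}" for m
  proof -
    obtain j where "j \<in> Poly_Mapping.keys m" "\<not> j < ?k" using nk by auto
    then show ?thesis unfolding mon_def
      by (intro prod_zero) (auto simp: in_keys_iff y_def intro!: bexI[of _ j])
  qed
  have mon_y: "mon y m = mon \<alpha> m" if "Poly_Mapping.keys m \<subseteq> {..<?k}" for m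
    using that by (intro mon_cong) (auto simp: y_def)
  have key: "\<not> Poly_Mapping.keys m \<subseteq> {..<?k}" if "m \<in> Poly_Mapping.keys F" for m
    using no_pure[of m] that by (auto simp: in_keys_iff)
  have "mp_eval to_ac y F = 0"
    unfolding mp_eval_mon by (intro sum.neutral ballI) (simp only: mon_y0[OF key] mult_zero_right)
  moreover have "mp_eval to_ac y (mp_pderiv j F) = 0" if j: "j \<le> n" for j
  proof -
    define g where "g m = to_ac (Poly_Mapping.lookup F m) *
      (of_nat (Poly_Mapping.lookup m j) * mon y (m - Poly_Mapping.single j 1))" for m
    have ev: "mp_eval to_ac y (mp_pderiv j F) = (\<Sum>m\<in>Poly_Mapping.keys F. g m)"
      unfolding mp_eval_pderiv[OF ring_morphism_to_ac] g_def ..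
    show ?thesis
    proof (cases "j < ?k")
      case True
      have "g m = 0" if m: "m \<in> Poly_Mapping.keys F" for m
      proof -
        obtain l where l: "l \<in> Poly_Mapping.keys m" "\<not> l < ?k" using key[OF m] by auto
        then have "l \<in> Poly_Mapping.keys (m - Poly_Mapping.single j 1)"
          using True by (auto simp: in_keys_iff lookup_minus lookup_single when_def)
        then have "\<not> Poly_Mapping.keys (m - Poly_Mapping.single j 1) \<subseteq> {..<?k}" using l(2) by auto
        from mon_y0[OF this] show ?thesis by (simp add: g_def)
      qed
      then show ?thesis unfolding ev by simp
    next
      case False
      then obtain i where i: "j = ?k + i" by (metis le_Suc_ex not_less)
      have ir: "i < r" using j n i by simp
      let ?\<epsilon> = "Poly_Mapping.single j (1::nat)"
      have inj: "inj_on (\<lambda>\<mu>. \<mu> + ?\<epsilon>) (exps ?k (d - 1))" by (simp add: inj_on_def)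
      have g_im: "g (\<mu> + ?\<epsilon>) = to_ac (a i \<mu>) * mon \<alpha> \<mu>" if \<mu>: "\<mu> \<in> exps ?k (d - 1)" for \<mu>
      proof -
        have "Poly_Mapping.lookup \<mu> j = 0" using \<mu> False by (auto simp: exps_def in_keys_iff subset_iff)
        moreover have "mon y \<mu> = mon \<alpha> \<mu>" using \<mu> by (intro mon_y) (simp add: exps_def)
        ultimately show ?thesis by (simp add: g_def a_def i lookup_add)
      qed
      have out: "g m = 0" if m: "m \<in> Poly_Mapping.keys F" "m \<notin> (\<lambda>\<mu>. \<mu> + ?\<epsilon>) ` exps ?k (d - 1)" for m
      proof (rule ccontr)
        assume "g m \<noteq> 0"
        then have lk: "Poly_Mapping.lookup m j \<noteq> 0" and mn: "mon y (m - ?\<epsilon>) \<noteq> 0"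
          by (auto simp: g_def intro: gr0I)
        have s: "m = ?\<epsilon> + (m - ?\<epsilon>)" using lk by (intro single_plus_diff) simp
        have ks: "Poly_Mapping.keys (m - ?\<epsilon>) \<subseteq> {..<?k}" using mn mon_y0 by blast
        have "mdeg m = d" using F m(1) by (simp add: form_def)
        then have "mdeg (m - ?\<epsilon>) = d - 1" using s by (metis add_diff_cancel_left' mdeg_plus mdeg_single)
        then have "m - ?\<epsilon> \<in> exps ?k (d - 1)" using ks by (simp add: exps_def)
        then show False using m(2) s by (metis add.commute imageI)
      qed
      have "(\<Sum>m\<in>Poly_Mapping.keys F. g m) = (\<Sum>m\<in>(\<lambda>\<mu>. \<mu> + ?\<epsilon>) ` exps ?k (d - 1). g m)"
      proof (rule sum.mono_neutral_cong)
        show "g m = 0" if "m \<in> (\<lambda>\<mu>. \<mu> + ?\<epsilon>) ` exps ?k (d - 1) - Poly_Mapping.keys F" for m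
          using that by (auto simp: g_def in_keys_iff)
      qed (use out finite_exps in auto)
      also have "\<dots> = (\<Sum>\<mu>\<in>exps ?k (d - 1). to_ac (a i \<mu>) * mon \<alpha> \<mu>)"
        unfolding sum.reindex[OF inj] comp_def by (rule sum.cong[OF refl g_im])
      finally show ?thesis unfolding ev using zero[OF ir] by simp
    qed
  qed
  moreover have "\<exists>i\<le>n. y i \<noteq> 0"
  proof -
    obtain i where "i < ?k" "\<alpha> i \<noteq> 0" using \<alpha> by blast
    then show ?thesis using n by (intro exI[of _ i]) (auto simp: y_def)
  qed
  ultimately show ?thesis using smooth_at_pointsD[of n F y] by (metis (no_types, lifting))
qed

lemma smooth_at_points_basis_subst:
  fixes F :: "'a::{field,finite} mpoly"
  assumes sm: "smooth_at_points n F" and F: "form n d F" and b: "lincomb b (Suc n) ` vecs (Suc n) = vecs (Suc n)"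
  shows "smooth_at_points n (linear_subst n (basis_mat n b) F)"
  unfolding smooth_at_points_def
proof (intro allI impI)
  note h = ring_morphism_to_ac[where 'a = 'a]
  let ?F = "linear_subst n (basis_mat n b) F"
  fix y :: "nat \<Rightarrow> 'a alg_closure"
  assume y: "\<exists>i\<le>n. y i \<noteq> 0" "mp_eval to_ac y ?F = 0"
  define \<Phi> where "\<Phi> u = (\<lambda>i. \<Sum>j\<le>n. to_ac (b j i) * u j)" for u :: "nat \<Rightarrow> 'a alg_closure"
  obtain C where C: "C \<in> carrier_mat (Suc n) (Suc n)" "basis_mat n b * C = 1\<^sub>m (Suc n)" "C * basis_mat n b = 1\<^sub>m (Suc n)"
    using basis_inverse[OF b] by blast
  have BC: "(\<Sum>j\<le>n. b j l * C $$ (j, i)) = (if l = i then 1 else 0)" if "l \<le> n" "i \<le> n" for l i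
  proof -
    have "(basis_mat n b * C) $$ (l, i) = (\<Sum>j\<le>n. b j l * C $$ (j, i))"
      using that C(1) by (simp add: basis_mat_def scalar_prod_def atLeast0LessThan lessThan_Suc_atMost)
    then show ?thesis using C(2) that by simp
  qed
  have CB: "(\<Sum>i\<le>n. C $$ (l, i) * b j i) = (if l = j then 1 else 0)" if "l \<le> n" "j \<le> n" for l j
  proof -
    have "(C * basis_mat n b) $$ (l, j) = (\<Sum>i\<le>n. C $$ (l, i) * b j i)"
      using that C(1) by (simp add: basis_mat_def scalar_prod_def atLeast0LessThan lessThan_Suc_atMost)
    then show ?thesis using C(3) that by simp
  qed
  have "\<exists>i\<le>n. \<Phi> y i \<noteq> 0"
  proof (rule ccontr)
    assume *: "\<not> ?thesis"
    have "y l = 0" if l: "l \<le> n" for l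
    proof -
      have "0 = (\<Sum>i\<le>n. to_ac (C $$ (l, i)) * \<Phi> y i)" using * by simp
      also have "\<dots> = (\<Sum>j\<le>n. to_ac (\<Sum>i\<le>n. C $$ (l, i) * b j i) * y j)"
        unfolding \<Phi>_def to_ac_sum sum_distrib_left sum_distrib_right
        by (subst sum.swap) (simp add: mult.assoc)
      also have "\<dots> = (\<Sum>j\<le>n. (if j = l then y j else 0))"
        using CB[OF l] by (intro sum.cong) auto
      also have "\<dots> = y l" using l by simp
      finally show ?thesis by simp
    qed
    then show False using y(1) by blast
  qed
  moreover have "mp_eval to_ac (\<Phi> y) F = 0"
    using y(2) unfolding mp_eval_basis_subst[OF h F] \<Phi>_def .
  ultimately obtain i where i: "i \<le> n" "mp_eval to_ac (\<Phi> y) (mp_pderiv i F) \<noteq> 0"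
    using smooth_at_pointsD[OF sm] by blast
  \<comment> \<open>The \<open>i\<close>-th column of the inverse matrix: the change of coordinates
    maps it to the \<open>i\<close>-th unit vector, so the directional derivative along
    \<open>v\<close> becomes the nonzero partial derivative of \<open>F\<close>.\<close>
  define v where "v j = to_ac (C $$ (j, i))" for j
  have \<Phi>v: "\<Phi> v l = (if l = i then 1 else 0)" if "l \<le> n" for l
  proof -
    have "\<Phi> v l = to_ac (\<Sum>j\<le>n. b j l * C $$ (j, i))" by (simp add: \<Phi>_def v_def to_ac_sum)
    then show ?thesis using BC[OF that i(1)] by simp
  qed
  have "(\<Sum>j\<le>n. v j * mp_eval to_ac y (mp_pderiv j ?F)) = coeff (line_poly to_ac ?F y v) 1"
    by (rule coeff_1_line_poly[OF h form_linear_subst[OF F], symmetric])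
  also have "\<dots> = coeff (line_poly to_ac F (\<Phi> y) (\<Phi> v)) 1"
    unfolding line_poly_basis_subst[OF h F] \<Phi>_def ..
  also have "\<dots> = (\<Sum>l\<le>n. \<Phi> v l * mp_eval to_ac (\<Phi> y) (mp_pderiv l F))"
    by (rule coeff_1_line_poly[OF h F])
  also have "\<dots> = (\<Sum>l\<le>n. if l = i then mp_eval to_ac (\<Phi> y) (mp_pderiv l F) else 0)"
    by (rule sum.cong) (auto simp: \<Phi>v)
  also have "\<dots> = mp_eval to_ac (\<Phi> y) (mp_pderiv i F)" using i(1) by simp
  finally have "(\<Sum>j\<le>n. v j * mp_eval to_ac y (mp_pderiv j ?F)) \<noteq> 0" using i(2) by simp
  then show "\<exists>i\<le>n. mp_eval to_ac y (mp_pderiv i ?F) \<noteq> 0"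
    by (metis (no_types, lifting) atMost_iff mult_zero_right sum.neutral)
qed

context finite_form
begin

text \<open>A basis of a larger \<open>S\<close>, extended to the whole space, becomes a coordinate
  system in which the form vanishes on the first \<open>r + 2\<close> coordinates. This makes it
  singular.\<close>

lemma isotropic_dim_le:
  assumes sm: "smooth_at_points n F" and d: "d \<le> CARD('a)" and n: "Suc n = 2 * r + 2"
    and S: "isotropic S" and cS: "card S = CARD('a) ^ k"
  shows "k \<le> r + 1"
proof (rule ccontr)
  assume "\<not> k \<le> r + 1"
  then have k: "r + 2 \<le> k" by simp
  have Sub: "lin_subspace (Suc n) S" using S by (simp add: isotropic_def)
  obtain k' b where b: "indep k' b" "\<And>j. j < k' \<Longrightarrow> b j \<in> S" "card S = CARD('a) ^ k'"
    by (rule basis_exists[OF Sub]) blast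
  have [simp]: "k' = k" using b(3) cS card_power_inject[where 'a = 'a] by metis
  have bV: "b j \<in> vecs (Suc n)" if "j < k'" for j using b(2)[OF that] lin_subspaceD(1)[OF Sub] by blast
  obtain R b' where b': "indep R b'" "\<forall>j<k'. b' j = b j" "lincomb b' R ` vecs R = vecs (Suc n)"
    using extend_to_basis[OF lin_subspace_vecs b(1) bV] by blast
  have "CARD('a) ^ R = CARD('a) ^ Suc n"
    using card_span[OF b'(1)] b'(3) by (simp only: card_vecs)
  then have R: "R = Suc n" using card_power_inject[where 'a = 'a] by blast
  let ?F = "linear_subst n (basis_mat n b') F"
  have span: "lincomb b' (Suc n) ` vecs (Suc n) = vecs (Suc n)" using b'(3) R by simp
  have "mp_eval id x ?F = 0" if x: "x \<in> vecs (r + 2)" for x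
  proof -
    have "lincomb b' (Suc n) x = lincomb b' k x"
      unfolding lincomb_def
    proof (rule ext, rule sum.mono_neutral_right)
      have "k \<le> Suc n"
      proof -
        have "card S \<le> card (vecs (Suc n) :: (nat \<Rightarrow> 'a) set)"
          using lin_subspaceD(1)[OF Sub] finite_vecs[where 'a = 'a] by (intro card_mono) auto
        then have le: "CARD('a) ^ k \<le> CARD('a) ^ Suc n" by (simp only: cS card_vecs)
        have "1 < CARD('a)" using two_le_card_field[where 'a = 'a] by linarith
        from power_le_imp_le_exp[OF this le] show ?thesis .
      qed
      then show "{..<k} \<subseteq> {..<Suc n}" by simp
    qed (use x k in \<open>auto simp: vecs_def\<close>)
    also have "\<dots> = lincomb b k x" using b'(2) by (intro lincomb_cong) auto
    also have "\<dots> \<in> S" using lincomb_in_subspace[OF Sub b(2)] by simp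
    finally have "val (lincomb b' (Suc n) x) = 0" using S by (simp add: isotropic_def)
    then show ?thesis by (simp add: val_basis_subst[OF form] val_def)
  qed
  from singular_of_large_coordinate_subspace[OF form_linear_subst[OF form] d2 d n this]
  show False using smooth_at_points_basis_subst[OF sm form span] by simp
qed

text \<open>Smoothness is used at rational points only: a partial derivative is \<open>B P\<close>
  at a unit vector.\<close>

lemma nondegenerate_of_smooth:
  assumes "smooth_at_points n F"
  shows "nondegenerate (vecs (Suc n))"
  unfolding nondegenerate_def
proof (intro ballI impI)
  note h = ring_morphism_to_ac[where 'a = 'a]
  have ev: "mp_eval to_ac (\<lambda>i. to_ac (P i)) G = to_ac (mp_eval id P G)" for P and G :: "'a mpoly"
    using ring_morphism.mp_eval_comp[OF h, of id P G] by simp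
  fix P :: "nat \<Rightarrow> 'a" assume P: "P \<in> vecs (Suc n)" "val P = 0" "P \<noteq> 0"
  obtain i where "P i \<noteq> 0" using P(3) by (auto simp: pointwise)
  moreover from this have "i \<le> n" using P(1) by (metis (mono_tags, lifting) mem_Collect_eq not_less_eq_eq vecs_def)
  ultimately have "\<exists>i\<le>n. to_ac (P i) \<noteq> 0" by auto
  moreover have "mp_eval to_ac (\<lambda>i. to_ac (P i)) F = 0" using P(2) by (simp add: ev val_def)
  ultimately obtain i where i: "i \<le> n" "mp_eval to_ac (\<lambda>i. to_ac (P i)) (mp_pderiv i F) \<noteq> 0"
    using smooth_at_pointsD[OF assms, of "\<lambda>i. to_ac (P i)"] by (metis (no_types, lifting))
  define e where "e = (\<lambda>l. if l = i then 1 else 0 :: 'a)"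
  have "e \<in> vecs (Suc n)" using i(1) by (auto simp: vecs_def e_def)
  moreover have "B P e = mp_eval id P (mp_pderiv i F)"
    using i(1) by (simp add: B_sum e_def if_distrib[of "\<lambda>x. x * _"] cong: if_cong)
  moreover have "mp_eval id P (mp_pderiv i F) \<noteq> 0" using i(2) by (simp add: ev)
  ultimately show "\<exists>w\<in>vecs (Suc n). B P w \<noteq> 0" by (intro bexI[of _ e]) simp_all
qed

end

section \<open>Points and zeros\<close>

text \<open>Passage to the affine cone: scalar classes of nonzero zeros are disjoint of size
  \<open>q - 1\<close>, and the summand \<open>1\<close> is the origin.\<close>

lemma num_points_zeros:
  fixes F :: "'a::{field,finite} mpoly"
  assumes F: "form n d F" and d: "d \<ge> 1"
  shows "num_points n F * (CARD('a) - 1) + 1 = card {x \<in> vecs (Suc n). mp_eval id x F = 0}"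
proof -
  let ?C = "rational_points n F"
  
  have val_vec: "mp_eval id (($) (vec (Suc n) x)) F = mp_eval id x F" for x
    by (rule mp_eval_form_cong[OF F]) simp
  have val_smult: "mp_eval id (($) (c \<cdot>\<^sub>v x)) F = c ^ d * mp_eval id (($) x) F" if "x \<in> carrier_vec (Suc n)" for c x
  proof -
    have "mp_eval id (($) (c \<cdot>\<^sub>v x)) F = mp_eval id (\<lambda>i. c * x $ i) F"
      by (rule mp_eval_form_cong[OF F]) (use that in simp)
    then show ?thesis by (simp add: form_scale[OF F])
  qed
  define U where "U = {x \<in> carrier_vec (Suc n). x \<noteq> 0\<^sub>v (Suc n) \<and> mp_eval id (($) x) F = 0}"
  define cls where "cls x = {c \<cdot>\<^sub>v x | c. c \<noteq> (0::'a)}" for x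
  have cls_self: "x \<in> cls x" for x
    unfolding cls_def by (rule CollectI, rule exI[of _ 1]) simp
  have cls_eq: "cls (c \<cdot>\<^sub>v x) = cls x" if "c \<noteq> 0" for c x
  proof -
    have *: "a \<cdot>\<^sub>v x = (a / c) \<cdot>\<^sub>v (c \<cdot>\<^sub>v x)" for a using that by (simp add: smult_smult_assoc)
    show ?thesis
    proof
      show "cls (c \<cdot>\<^sub>v x) \<subseteq> cls x"
      proof
        fix y assume "y \<in> cls (c \<cdot>\<^sub>v x)"
        then obtain a where "a \<noteq> 0" "y = (a * c) \<cdot>\<^sub>v x" unfolding cls_def by (auto simp: smult_smult_assoc)
        then show "y \<in> cls x" unfolding cls_def using that by (intro CollectI exI[of _ "a * c"]) simp
      qed
      show "cls x \<subseteq> cls (c \<cdot>\<^sub>v x)"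
      proof
        fix y assume "y \<in> cls x"
        then obtain a where "a \<noteq> 0" "y = a \<cdot>\<^sub>v x" unfolding cls_def by auto
        then show "y \<in> cls (c \<cdot>\<^sub>v x)" unfolding cls_def using that *[of a]
          by (intro CollectI exI[of _ "a / c"]) simp
      qed
    qed
  qed
  have smult_nz: "c \<cdot>\<^sub>v x \<noteq> 0\<^sub>v (Suc n)" if "x \<in> carrier_vec (Suc n)" "x \<noteq> 0\<^sub>v (Suc n)" "c \<noteq> 0"
    for c :: 'a and x
  proof
    assume z: "c \<cdot>\<^sub>v x = 0\<^sub>v (Suc n)"
    have "x = 0\<^sub>v (Suc n)"
    proof (rule eq_vecI)
      fix i assume "i < dim_vec (0\<^sub>v (Suc n) :: 'a vec)"
      then have i: "i < Suc n" by simp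
      have "(c \<cdot>\<^sub>v x) $ i = 0" using z i by simp
      then show "x $ i = 0\<^sub>v (Suc n) $ i" using i that by simp
    qed (use that in auto)
    then show False using that by blast
  qed
  have C: "?C = cls ` U"
  proof
    show "?C \<subseteq> cls ` U"
    proof
      fix P assume P: "P \<in> ?C"
      then obtain x where x: "P = cls x" "x \<in> carrier_vec (Suc n)" "x \<noteq> 0\<^sub>v (Suc n)"
        unfolding rational_points_def proj_points_def cls_def by blast
      have "mp_eval id (($) x) F = 0" using P x(1) cls_self unfolding rational_points_def by blast
      then show "P \<in> cls ` U" using x by (auto simp: U_def)
    qed
    show "cls ` U \<subseteq> ?C"
    proof
      fix P assume "P \<in> cls ` U"
      then obtain x :: "'a vec" where x: "P = cls x" "x \<in> carrier_vec (Suc n)" "x \<noteq> 0\<^sub>v (Suc n)" "mp_eval id (($) x) F = 0"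
        by (auto simp: U_def)
      have "P \<in> proj_points n" using x(1-3) unfolding proj_points_def cls_def by blast
      moreover have "\<forall>y\<in>P. mp_eval id (($) y) F = 0"
        unfolding x(1) cls_def using val_smult[OF x(2)] x(4) by auto
      ultimately show "P \<in> ?C" by (simp add: rational_points_def)
    qed
  qed
  have finC: "finite (carrier_vec (Suc n) :: 'a vec set)"
  proof -
    have "carrier_vec (Suc n) = vec (Suc n) ` (vecs (Suc n) :: (nat \<Rightarrow> 'a) set)"
    proof
      show "carrier_vec (Suc n) \<subseteq> vec (Suc n) ` (vecs (Suc n) :: (nat \<Rightarrow> 'a) set)"
      proof
        fix x :: "'a vec" assume x: "x \<in> carrier_vec (Suc n)"
        have "x = vec (Suc n) (\<lambda>i. if i < Suc n then x $ i else 0)" using x by (intro eq_vecI) auto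
        then show "x \<in> vec (Suc n) ` vecs (Suc n)" using truncate_vecs by blast
      qed
    qed auto
    then show ?thesis using finite_vecs[where 'a = 'a] by simp
  qed
  have finU: "finite U" unfolding U_def by (rule finite_subset[OF _ finC]) auto
  have UC: "\<Union>?C = U"
  proof
    show "\<Union>?C \<subseteq> U"
    proof
      fix y assume "y \<in> \<Union>?C"
      then obtain x c where "x \<in> U" "c \<noteq> 0" "y = c \<cdot>\<^sub>v x" unfolding C cls_def by blast
      then show "y \<in> U" using val_smult[of x c] smult_nz[of x c] by (auto simp: U_def)
    qed
    show "U \<subseteq> \<Union>?C" unfolding C using cls_self by blast
  qed
  have "(CARD('a) - 1) * card ?C = card (\<Union>?C)"
  proof (rule card_partition)
    show "finite ?C" unfolding C using finU by simp
    show "finite (\<Union>?C)" unfolding UC by (rule finU)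
    fix P assume "P \<in> ?C"
    then obtain x where x: "P = cls x" "x \<in> carrier_vec (Suc n)" "x \<noteq> 0\<^sub>v (Suc n)" unfolding C U_def by blast
    have "inj_on (\<lambda>c. c \<cdot>\<^sub>v x) (UNIV - {0})"
    proof (rule inj_onI)
      fix c c' assume eq: "c \<cdot>\<^sub>v x = c' \<cdot>\<^sub>v x"
      obtain i where i: "i < Suc n" "x $ i \<noteq> 0"
      proof (rule ccontr)
        assume "\<not> thesis"
        then have "x = 0\<^sub>v (Suc n)" using that x(2) by (intro eq_vecI) auto
        then show False using x(3) by simp
      qed
      have "(c \<cdot>\<^sub>v x) $ i = (c' \<cdot>\<^sub>v x) $ i" using eq by simp
      then show "c = c'" using i x(2) by simp
    qed
    moreover have "P = (\<lambda>c. c \<cdot>\<^sub>v x) ` (UNIV - {0})" unfolding x(1) cls_def by auto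
    ultimately show "card P = CARD('a) - 1" by (simp add: card_image card_Diff_subset)
  next
    fix P Q assume "P \<in> ?C" "Q \<in> ?C" "P \<noteq> Q"
    then obtain x y where xy: "P = cls x" "Q = cls y" unfolding C by blast
    show "P \<inter> Q = {}"
    proof (rule ccontr)
      assume "P \<inter> Q \<noteq> {}"
      then obtain c c' where "c \<cdot>\<^sub>v x = c' \<cdot>\<^sub>v y" "c \<noteq> 0" "c' \<noteq> 0" unfolding xy cls_def by blast
      then have "cls x = cls y" using cls_eq by metis
      then show False using \<open>P \<noteq> Q\<close> xy by simp
    qed
  qed
  then have 1: "num_points n F * (CARD('a) - 1) = card U" by (simp add: UC num_points_def mult.commute)
  let ?Z = "{x \<in> vecs (Suc n). mp_eval id x F = 0}"
  have z0: "0 \<in> ?Z"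
  proof -
    have "mp_eval id (\<lambda>i. 0 * 0) F = 0 ^ d * mp_eval id (\<lambda>i. 0 :: 'a) F" by (rule form_scale[OF F])
    then have "mp_eval id (0 :: nat \<Rightarrow> 'a) F = 0" using d by (simp add: zero_fun_def zero_power)
    then show ?thesis by (simp add: vecs_def zero_fun_apply)
  qed
  have "bij_betw (vec (Suc n)) (?Z - {0}) U"
  proof (rule bij_betwI[where g = "\<lambda>(x :: 'a vec) i. if i < Suc n then x $ i else 0"])
    show "vec (Suc n) \<in> ?Z - {0} \<rightarrow> U"
    proof
      fix x assume x: "x \<in> ?Z - {0}"
      have "vec (Suc n) x \<noteq> 0\<^sub>v (Suc n)"
      proof
        assume "vec (Suc n) x = 0\<^sub>v (Suc n)"
        then have "x i = 0" if "i < Suc n" for i using that by (metis index_vec index_zero_vec(1))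
        then have "x = 0" using x by (auto simp: vecs_def pointwise) (metis leI)
        then show False using x by simp
      qed
      then show "vec (Suc n) x \<in> U" using x val_vec by (simp add: U_def)
    qed
    show "(\<lambda>(x :: 'a vec) i. if i < Suc n then x $ i else 0) \<in> U \<rightarrow> ?Z - {0}"
    proof
      fix x assume x: "x \<in> U"
      let ?y = "\<lambda>i. if i < Suc n then x $ i else 0"
      have xy: "vec (Suc n) ?y = x" using x by (intro eq_vecI) (auto simp: U_def)
      have "mp_eval id ?y F = 0" using val_vec[of ?y] x unfolding xy by (simp add: U_def)
      moreover have "?y \<noteq> 0"
      proof
        assume "?y = 0"
        then have "vec (Suc n) ?y = 0\<^sub>v (Suc n)" by (intro eq_vecI) (auto simp: zero_fun_apply)
        then show False using x unfolding xy by (simp add: U_def)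
      qed
      ultimately show "?y \<in> ?Z - {0}" using truncate_vecs[of "Suc n" "($) x"] by simp
    qed
    show "(\<lambda>i. if i < Suc n then vec (Suc n) x $ i else 0) = x" if "x \<in> ?Z - {0}" for x
      using that by (auto simp: vecs_def)
    show "vec (Suc n) (\<lambda>i. if i < Suc n then y $ i else 0) = y" if "y \<in> U" for y
      using that by (intro eq_vecI) (auto simp: U_def)
  qed
  then have "card (?Z - {0}) = card U" by (rule bij_betw_same_card)
  moreover have "finite ?Z" by (rule finite_subset[OF _ finite_vecs[of "Suc n"]]) auto
  ultimately have "card ?Z = card U + 1" using z0 by (metis Suc_eq_plus1 card.remove)
  then show ?thesis using 1 by simp
qed

lemma theta_geometric: "theta q m * (q - 1) + 1 = q ^ (m + 1)" if "q \<ge> 1" for q :: nat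
proof (induction m)
  case 0
  then show ?case using that by (simp add: theta_def)
next
  case (Suc m)
  obtain r where r: "q = Suc r" using \<open>q \<ge> 1\<close> by (cases q) auto
  have "theta q (Suc m) = theta q m + q ^ (m + 1)" by (simp add: theta_def)
  then have "theta q (Suc m) * r + 1 = (theta q m * r + 1) + q ^ (m + 1) * r"
    by (simp add: add_mult_distrib)
  also have "\<dots> = q ^ (m + 1) + q ^ (m + 1) * r" using Suc by (simp add: r)
  also have "\<dots> = q ^ (Suc m + 1)" by (simp add: r)
  finally show ?case by (simp add: r)
qed

section \<open>Counting the points of the normal forms\<close>

text \<open>All fibres of a nonzero linear functional are translates of its kernel.\<close>

lemma card_linear_preimage:
  fixes w :: "nat \<Rightarrow> 'a::{field,finite}"
  assumes "\<exists>i<k. w i \<noteq> 0"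
  shows "card {y \<in> vecs k. (\<Sum>i<k. w i * y i) \<in> T} * CARD('a) = card T * CARD('a) ^ k"
proof -
  obtain i0 where i0: "i0 < k" "w i0 \<noteq> 0" using assms by blast
  define u where "u c = (\<lambda>i. if i = i0 then c / w i0 else 0)" for c
  have u: "u c \<in> vecs k" "(\<Sum>i<k. w i * u c i) = c" for c
  proof -
    show "u c \<in> vecs k" using i0 by (auto simp: u_def vecs_def)
    have "(\<Sum>i<k. w i * u c i) = (\<Sum>i<k. if i = i0 then c else 0)"
      by (rule sum.cong) (use i0 in \<open>auto simp: u_def\<close>)
    then show "(\<Sum>i<k. w i * u c i) = c" using i0 by simp
  qed
  define A where "A c = {y \<in> vecs k. (\<Sum>i<k. w i * y i) = c}" for c
  have fin: "finite (A c)" for c unfolding A_def by (rule finite_subset[OF _ finite_vecs[of k]]) auto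
  have cA: "card (A c) = card (A 0)" for c
  proof (rule bij_betw_same_card)
    show "bij_betw (\<lambda>y. y - u c) (A c) (A 0)"
    proof (rule bij_betwI[where g = "\<lambda>y. y + u c"])
      show "(\<lambda>y. y - u c) \<in> A c \<rightarrow> A 0"
        using u[of c] by (auto simp: A_def vecs_def minus_apply right_diff_distrib sum_subtractf)
      show "(\<lambda>y. y + u c) \<in> A 0 \<rightarrow> A c"
        using u[of c] by (auto simp: A_def vecs_def plus_fun_apply distrib_left sum.distrib)
    qed auto
  qed
  have un: "card {y \<in> vecs k. (\<Sum>i<k. w i * y i) \<in> S} = card S * card (A 0)" for S
  proof -
    have "{y \<in> vecs k. (\<Sum>i<k. w i * y i) \<in> S} = (\<Union>c\<in>S. A c)" by (auto simp: A_def)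
    then have "card {y \<in> vecs k. (\<Sum>i<k. w i * y i) \<in> S} = (\<Sum>c\<in>S. card (A c))"
      by (simp add: card_UN_disjoint fin) (subst card_UN_disjoint, auto simp: fin, auto simp: A_def)
    also have "\<dots> = (\<Sum>c\<in>S. card (A 0))" by (intro sum.cong refl cA)
    finally show ?thesis by simp
  qed
  have "CARD('a) * card (A 0) = CARD('a) ^ k"
    using un[of UNIV] by (simp add: card_vecs)
  then show ?thesis using un[of T] by (metis mult.assoc mult.commute)
qed

definition interleave :: "(nat \<Rightarrow> 'a) \<Rightarrow> (nat \<Rightarrow> 'a) \<Rightarrow> nat \<Rightarrow> 'a" where
  "interleave x y = (\<lambda>i. if even i then x (i div 2) else y (i div 2))"

text \<open>For fixed \<open>x\<close> the zero condition is linear in \<open>y\<close> up to the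
  set \<open>T\<close>, which is \<open>{0}\<close> for the quadric and the trace kernel for the
  Hermitian form. The vector \<open>x = 0\<close> admits all \<open>y\<close>, any other a share
  \<open>card T / q\<close> of them.\<close>

lemma card_interleaved_zeros:
  fixes W :: "(nat \<Rightarrow> 'a::{field,finite}) \<Rightarrow> nat \<Rightarrow> 'a"
  assumes val: "\<And>x y. x \<in> vecs k \<Longrightarrow> y \<in> vecs k \<Longrightarrow> f (interleave x y) = (0::'a) \<longleftrightarrow> (\<Sum>i<k. W x i * y i) \<in> T"
    and W: "\<And>x i. W x i = 0 \<longleftrightarrow> x i = 0" and T: "0 \<in> T"
  shows "card {t \<in> vecs (2 * k). f t = 0} * CARD('a)
     = CARD('a) ^ k * CARD('a) + (CARD('a) ^ k - 1) * (card T * CARD('a) ^ k)"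
proof -
  let ?A = "\<lambda>x. {y \<in> vecs k. (\<Sum>i<k. W x i * y i) \<in> T}"
  have bij: "bij_betw (\<lambda>(x, y). interleave x y) (SIGMA x:vecs k. ?A x) {t \<in> vecs (2 * k). f t = 0}"
  proof (rule bij_betwI[where g = "\<lambda>t. (\<lambda>i. t (2 * i), \<lambda>i. t (2 * i + 1))"])
    have iv: "interleave x y \<in> vecs (2 * k)" if "x \<in> vecs k" "y \<in> vecs k" for x y :: "nat \<Rightarrow> 'a"
      using that by (auto simp: vecs_def interleave_def)
    show "(\<lambda>(x, y). interleave x y) \<in> (SIGMA x:vecs k. ?A x) \<rightarrow> {t \<in> vecs (2 * k). f t = 0}"
      using iv val by auto
    have di: "interleave (\<lambda>i. t (2 * i)) (\<lambda>i. t (2 * i + 1)) = t" for t :: "nat \<Rightarrow> 'a"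
    proof
      fix i show "interleave (\<lambda>i. t (2 * i)) (\<lambda>i. t (2 * i + 1)) i = t i"
        by (cases "even i") (auto simp: interleave_def)
    qed
    show "(\<lambda>t. (\<lambda>i. t (2 * i), \<lambda>i. t (2 * i + 1))) \<in> {t \<in> vecs (2 * k). f t = 0} \<rightarrow> (SIGMA x:vecs k. ?A x)"
    proof
      fix t assume t: "t \<in> {t \<in> vecs (2 * k). f t = 0}"
      have in_V: "(\<lambda>i. t (2 * i)) \<in> vecs k" "(\<lambda>i. t (2 * i + 1)) \<in> vecs k" using t by (auto simp: vecs_def)
      show "(\<lambda>i. t (2 * i), \<lambda>i. t (2 * i + 1)) \<in> (SIGMA x:vecs k. ?A x)"
        using val[OF in_V] t in_V unfolding di by simp
    qed
    show "(\<lambda>t. (\<lambda>i. t (2 * i), \<lambda>i. t (2 * i + 1))) ((\<lambda>(x, y). interleave x y) p) = p"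
      if "p \<in> (SIGMA x:vecs k. ?A x)" for p
      by (cases p) (simp add: interleave_def)
    show "(\<lambda>(x, y). interleave x y) ((\<lambda>t. (\<lambda>i. t (2 * i), \<lambda>i. t (2 * i + 1))) t) = t"
      for t :: "nat \<Rightarrow> 'a"
      by (simp only: di prod.case)
  qed
  have finA: "finite (?A x)" for x by (rule finite_subset[OF _ finite_vecs[of k]]) auto
  have "card {t \<in> vecs (2 * k). f t = 0} = (\<Sum>x\<in>vecs k. card (?A x))"
    using bij_betw_same_card[OF bij] finite_vecs[where 'a = 'a] finA by (simp add: card_SigmaI)
  then have "card {t \<in> vecs (2 * k). f t = 0} * CARD('a) = (\<Sum>x\<in>vecs k. card (?A x) * CARD('a))"
    by (simp add: sum_distrib_right)
  also have "\<dots> = card (?A 0) * CARD('a) + (\<Sum>x\<in>vecs k - {0}. card (?A x) * CARD('a))"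
    using finite_vecs[where 'a = 'a, of k] by (intro sum.remove) (auto simp: vecs_def zero_fun_apply)
  also have "?A 0 = vecs k" using W[of 0] T by (auto simp: zero_fun_apply)
  also have "(\<Sum>x\<in>vecs k - {0}. card (?A x) * CARD('a)) = (\<Sum>x\<in>vecs k - {0 :: nat \<Rightarrow> 'a}. card T * CARD('a) ^ k)"
  proof (rule sum.cong[OF refl])
    fix x :: "nat \<Rightarrow> 'a" assume x: "x \<in> vecs k - {0}"
    then obtain i where "x i \<noteq> 0" by (auto simp: pointwise)
    then have "i < k" "W x i \<noteq> 0" using x W by (auto simp: vecs_def intro: leI)
    then show "card (?A x) * CARD('a) = card T * CARD('a) ^ k" by (intro card_linear_preimage) blast
  qed
  also have "card (vecs k :: (nat \<Rightarrow> 'a) set) = CARD('a) ^ k" by (rule card_vecs)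
  also have "(\<Sum>x\<in>vecs k - {0 :: nat \<Rightarrow> 'a}. card T * CARD('a) ^ k) = (CARD('a) ^ k - 1) * (card T * CARD('a) ^ k)"
  proof -
    have "0 \<in> (vecs k :: (nat \<Rightarrow> 'a) set)" by (simp add: vecs_def zero_fun_apply)
    then have "card (vecs k - {0 :: nat \<Rightarrow> 'a}) = CARD('a) ^ k - 1"
      using finite_vecs[where 'a = 'a, of k] by (simp add: card_Diff_subset card_vecs)
    then show ?thesis by simp
  qed
  finally show ?thesis .
qed

section \<open>Frobenius and trace for square \<open>q\<close>\<close>

lemma prime_CHAR_field: "prime CHAR('a::{field,finite})"
  by (rule prime_CHAR_semidom) (simp add: finite_imp_CHAR_pos)

text \<open>Comparing \<open>(X + 1)^q = X^q + 1\<close> with \<open>(X^(p^a) + 1)^u\<close> for \<open>q = p^a * u\<close>.\<close>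

lemma card_field_prime_power: "\<exists>a. CARD('a::{field,finite}) = CHAR('a) ^ a"
proof -
  let ?p = "CHAR('a)" and ?q = "CARD('a)"
  note p = prime_CHAR_field[where 'a = 'a]
  have q2: "2 \<le> ?q" by (rule two_le_card_field)
  obtain a u where au: "?q = ?p ^ a * u" "\<not> ?p dvd u"
    using multiplicity_decompose'[of ?q ?p] q2 p by (metis not_prime_unit not_numeral_le_zero)
  have u0: "of_nat u \<noteq> (0 :: 'a)" using au(2) by (simp add: of_nat_eq_0_iff_char_dvd)
  have "u = 1"
  proof (rule ccontr)
    assume "u \<noteq> 1"
    moreover have "u \<noteq> 0" using au(1) q2 by (intro notI) simp
    ultimately have u2: "u \<ge> 2" by simp
    let ?X = "[:0, 1:] :: 'a poly"
    have Xp: "?X ^ k = monom 1 k" for k by (simp add: monom_altdef)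
    have CH: "CHAR('a poly) = ?p" by simp
    have frob: "(?X + 1) ^ (?p ^ a) = ?X ^ (?p ^ a) + 1"
      using freshmans_dream'[of "?p ^ a" a ?X 1] p by (simp add: CH)
    \<comment> \<open>Both sides are monic of degree \<open>q\<close> and agree at all
      \<open>q\<close> points by \<open>x^q = x\<close>, so their difference has too many roots for
      its degree.\<close>
    have e: "(?X + 1) ^ ?q = ?X ^ ?q + 1"
    proof -
      have "degree ((?X + 1) ^ ?q - (?X ^ ?q + 1)) < ?q"
      proof -
        have l: "coeff ((?X + 1) ^ ?q) ?q = 1"
        proof -
          have "degree ((?X + 1) ^ ?q) = ?q" by (simp add: degree_power_eq one_pCons)
          moreover have "lead_coeff ((?X + 1) ^ ?q) = 1" by (simp add: lead_coeff_power one_pCons)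
          ultimately show ?thesis by simp
        qed
        have "coeff ((?X + 1) ^ ?q - (?X ^ ?q + 1)) i = 0" if "i \<ge> ?q" for i
        proof (cases "i = ?q")
          case True
          then show ?thesis using l q2 by (simp add: Xp coeff_1)
        next
          case False
          then have "i > ?q" using that by simp
          moreover have "degree ((?X + 1) ^ ?q - (?X ^ ?q + 1)) \<le> ?q"
            by (intro degree_diff_le degree_add_le) (auto simp: degree_power_eq one_pCons)
          ultimately show ?thesis by (intro coeff_eq_0) simp
        qed
        then show ?thesis using q2 by (intro degree_lessI) auto
      qed
      then have "(?X + 1) ^ ?q - (?X ^ ?q + 1) = 0"
        by (rule poly_zero_if_vanishing) (simp add: finite_field_power_card)
      then show ?thesis by simp
    qed
    have "(?X + 1) ^ ?q = (?X ^ (?p ^ a) + 1) ^ u" by (simp add: au(1) power_mult frob)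
    also have "\<dots> = (\<Sum>k\<le>u. of_nat (u choose k) * ?X ^ (?p ^ a * k))"
      by (simp add: binomial_ring power_mult)
    \<comment> \<open>In \<open>(X^(p^a) + 1)^u\<close> this coefficient is \<open>u\<close>,
      nonzero in the field; in \<open>X^q + 1\<close> it is zero once \<open>u > 1\<close>.\<close>
    finally have "coeff (?X ^ ?q + 1) (?p ^ a) = (\<Sum>k\<le>u. of_nat (u choose k) * coeff (?X ^ (?p ^ a * k)) (?p ^ a))"
      unfolding e by (simp add: coeff_sum of_nat_poly)
    also have "\<dots> = (\<Sum>k\<le>u. if k = 1 then of_nat u else 0)"
    proof (rule sum.cong[OF refl])
      fix k
      have "?p ^ a * k = ?p ^ a \<longleftrightarrow> k = 1" using p prime_gt_0_nat by simp
      then show "of_nat (u choose k) * coeff (?X ^ (?p ^ a * k)) (?p ^ a) = (if k = 1 then of_nat u else (0::'a))"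
        by (auto simp: Xp)
    qed
    also have "\<dots> = of_nat u" using u2 by simp
    finally have "coeff (?X ^ ?q + 1) (?p ^ a) = of_nat u" .
    moreover have "coeff (?X ^ ?q + 1) (?p ^ a) = 0"
    proof -
      have "?p ^ a > 0" using p prime_gt_0_nat by simp
      moreover have "?p ^ a \<noteq> ?q" using au(1) u2 \<open>?p ^ a > 0\<close> by simp
      ultimately show ?thesis by (simp add: Xp coeff_1)
    qed
    ultimately show False using u0 by simp
  qed
  then show ?thesis using au by auto
qed

text \<open>As a divisor of a power of the characteristic, \<open>s\<close> is itself such a
  power.\<close>

lemma sqrt_card_frobenius:
  fixes x y :: "'a::{field,finite}"
  assumes "CARD('a) = s ^ 2"
  shows "(x + y) ^ s = x ^ s + y ^ s"
proof -
  note p = prime_CHAR_field[where 'a = 'a]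
  obtain a where "s ^ 2 = CHAR('a) ^ a" using card_field_prime_power[where 'a = 'a] assms by metis
  then have "s dvd CHAR('a) ^ a" by (metis dvd_triv_left power2_eq_square)
  then obtain i where "s = CHAR('a) ^ i" using divides_primepow_nat[OF p] by auto
  then show ?thesis using freshmans_dream'[of s i x y] p by simp
qed

lemma sqrt_card_frobenius_sum:
  fixes f :: "'b \<Rightarrow> 'a::{field,finite}"
  assumes "CARD('a) = s ^ 2"
  shows "(\<Sum>i\<in>A. f i) ^ s = (\<Sum>i\<in>A. f i ^ s)"
proof -
  have "s > 0" using assms two_le_card_field[where 'a = 'a] by (cases "s = 0") auto
  then show ?thesis
    by (induction A rule: infinite_finite_induct) (auto simp: sqrt_card_frobenius[OF assms] zero_power)
qed

text \<open>Kernel and image of \<open>z + z^s\<close> both consist of roots of polynomials of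
  degree \<open>s\<close>, the image being fixed by \<open>z^s\<close>. Since the product of their
  sizes is at least \<open>q = s^2\<close>, the kernel attains its bound.\<close>

lemma card_trace_kernel:
  assumes q: "CARD('a::{field,finite}) = s ^ 2"
  shows "card {z::'a. z + z ^ s = 0} = s"
proof -
  have s2: "s \<ge> 2"
  proof (rule ccontr)
    assume "\<not> s \<ge> 2"
    then have "s = 0 \<or> s = 1" by auto
    then have "s ^ 2 \<le> 1" by auto
    then show False using q two_le_card_field[where 'a = 'a] by simp
  qed
  let ?N = "{z::'a. z + z ^ s = 0}" and ?I = "{z::'a. z ^ s - z = 0}"
  have bound: "card {z::'a. z ^ s + c * z = 0} \<le> s" for c
  proof -
    let ?p = "monom 1 s + monom c 1 :: 'a poly"
    have "coeff ?p s = 1" using s2 by simp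
    then have "?p \<noteq> 0" by (metis coeff_0 zero_neq_one)
    moreover have "degree ?p \<le> s" using s2 by (intro degree_add_le) (auto simp: degree_monom_eq intro: order_trans[OF degree_monom_le])
    ultimately show ?thesis using card_poly_roots_le[of ?p] by (simp add: poly_monom)
  qed
  have N: "card ?N \<le> s" using bound[of 1] by (simp add: add.commute)
  have I: "card ?I \<le> s" using bound[of "- 1"] by simp
  have "card (UNIV :: 'a set) \<le> card ?N * card ?I"
  proof (rule card_le_mult_kernel[where \<phi> = "\<lambda>z. z + z ^ s"])
    show "range (\<lambda>z. z + z ^ s) \<subseteq> ?I"
    proof clarify
      fix z :: 'a
      have "(z ^ s) ^ s = z" using finite_field_power_card[of z] q by (simp add: power_mult[symmetric] power2_eq_square)
      then show "(z + z ^ s) ^ s - (z + z ^ s) = 0" by (simp add: sqrt_card_frobenius[OF q])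
    qed
    fix z z' :: 'a assume eq: "z + z ^ s = z' + z' ^ s"
    have "(z - z' + z') ^ s = (z - z') ^ s + z' ^ s" by (rule sqrt_card_frobenius[OF q])
    then have diff: "(z - z') ^ s = z ^ s - z' ^ s" by simp
    show "z - z' \<in> ?N" unfolding mem_Collect_eq diff using eq by (simp add: algebra_simps)
  qed auto
  then have "s * s \<le> card ?N * card ?I" by (simp add: q power2_eq_square)
  also have "\<dots> \<le> card ?N * s" using I by (rule mult_left_mono) simp
  finally have "s \<le> card ?N" using s2 by simp
  then show ?thesis using N by simp
qed

section \<open>Projective equivalence and the normal forms\<close>

lemma card_zeros_proj_equivalent:
  fixes F G :: "'a::{field,finite} mpoly"
  assumes F: "form n d F" and eqv: "proj_equivalent n F G"
  shows "card {x \<in> vecs (Suc n). mp_eval id x F = 0} = card {x \<in> vecs (Suc n). mp_eval id x G = 0}"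
proof -
  obtain A c where A: "A \<in> carrier_mat (Suc n) (Suc n)" "invertible_mat A" and c: "c \<noteq> 0"
    and AF: "linear_subst n A F = mp_const c * G" using eqv unfolding proj_equivalent_def by blast
  obtain B where "A * B = 1\<^sub>m (dim_row A)" "B * A = 1\<^sub>m (dim_row B)"
    using A(2) unfolding invertible_mat_def inverts_mat_def by blast
  then have B: "B * A = 1\<^sub>m (Suc n)" "B \<in> carrier_mat (Suc n) (Suc n)"
    using A(1) by (metis carrier_matD(1,2) carrier_matI index_mult_mat(2,3) index_one_mat(2,3))+
  define \<phi> where "\<phi> t = (\<lambda>i. if i < Suc n then \<Sum>j<Suc n. A $$ (i, j) * t j else 0)" for t
  have \<phi>_vecs: "\<phi> t \<in> vecs (Suc n)" for t by (simp add: \<phi>_def vecs_def)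
  have inj: "inj_on \<phi> (vecs (Suc n))"
  proof (rule inj_on_inverseI)
    fix t :: "nat \<Rightarrow> 'a" assume t: "t \<in> vecs (Suc n)"
    show "(\<lambda>w l. if l < Suc n then \<Sum>i<Suc n. B $$ (l, i) * w i else 0) (\<phi> t) = t"
    proof
      fix l
      show "(if l < Suc n then \<Sum>i<Suc n. B $$ (l, i) * \<phi> t i else 0) = t l"
      proof (cases "l < Suc n")
        case True
        have "(\<Sum>i<Suc n. B $$ (l, i) * \<phi> t i) = (\<Sum>i<Suc n. B $$ (l, i) * (\<Sum>j<Suc n. A $$ (i, j) * t j))"
          by (rule sum.cong) (simp_all add: \<phi>_def)
        also have "\<dots> = (\<Sum>j<Suc n. (\<Sum>i<Suc n. B $$ (l, i) * A $$ (i, j)) * t j)"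
          unfolding sum_distrib_left sum_distrib_right by (subst sum.swap) (simp only: mult_ac)
        also have "\<dots> = (\<Sum>j<Suc n. if j = l then t j else 0)"
        proof (rule sum.cong[OF refl])
          fix j assume "j \<in> {..<Suc n}"
          then have "(B * A) $$ (l, j) = (\<Sum>i<Suc n. B $$ (l, i) * A $$ (i, j))"
            using True A(1) B(2) by (simp add: scalar_prod_def atLeast0LessThan)
          then have "(\<Sum>i<Suc n. B $$ (l, i) * A $$ (i, j)) = (if j = l then 1 else 0)"
            using True \<open>j \<in> {..<Suc n}\<close> unfolding B(1) by auto
          then show "(\<Sum>i<Suc n. B $$ (l, i) * A $$ (i, j)) * t j = (if j = l then t j else 0)"
            by (simp only:) simp
        qed
        also have "\<dots> = t l" using True by simp
        finally show ?thesis using True by simp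
      qed (use t in \<open>simp add: vecs_def\<close>)
    qed
  qed
  have surj: "\<phi> ` vecs (Suc n) = vecs (Suc n)"
    by (rule endo_inj_surj[OF finite_vecs _ inj]) (use \<phi>_vecs in blast)
  have val: "mp_eval id (\<phi> t) F = c * mp_eval id t G" for t
  proof -
    have "mp_eval id t (linear_subst n A F) = mp_eval id (\<phi> t) F"
      unfolding mp_eval_linear_subst[OF ring_morphism_id]
      by (rule mp_eval_form_cong[OF F]) (simp add: \<phi>_def atLeast0AtMost lessThan_Suc_atMost)
    then show ?thesis unfolding AF by (simp add: mp_eval_mult_const[OF ring_morphism_id])
  qed
  have "{x \<in> vecs (Suc n). mp_eval id x F = 0} = \<phi> ` {x \<in> vecs (Suc n). mp_eval id x G = 0}"
  proof
    show "{x \<in> vecs (Suc n). mp_eval id x F = 0} \<subseteq> \<phi> ` {x \<in> vecs (Suc n). mp_eval id x G = 0}"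
    proof
      fix x assume x: "x \<in> {x \<in> vecs (Suc n). mp_eval id x F = 0}"
      then obtain t where t: "t \<in> vecs (Suc n)" "x = \<phi> t" using surj by blast
      then show "x \<in> \<phi> ` {x \<in> vecs (Suc n). mp_eval id x G = 0}" using x val[of t] c by simp
    qed
    show "\<phi> ` {x \<in> vecs (Suc n). mp_eval id x G = 0} \<subseteq> {x \<in> vecs (Suc n). mp_eval id x F = 0}"
      using \<phi>_vecs val by auto
  qed
  moreover have "inj_on \<phi> {x \<in> vecs (Suc n). mp_eval id x G = 0}" using inj by (rule inj_on_subset) auto
  ultimately show ?thesis by (simp add: card_image)
qed

lemma proj_equivalent_basisI:
  fixes F :: "'a::{field,finite} mpoly"
  assumes "lincomb b (Suc n) ` vecs (Suc n) = vecs (Suc n)" "c \<noteq> 0"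
    and "linear_subst n (basis_mat n b) F = mp_const c * G"
  shows "proj_equivalent n F G"
  unfolding proj_equivalent_def using assms invertible_basis_mat[OF assms(1)] basis_mat_carrier by blast

section \<open>The three normal forms\<close>

lemma mp_const_1: "mp_const (1 :: 'a::comm_semiring_1) = 1"
  by (simp add: mp_const_def)

lemma normal_form_range: "n = 2 * m + 1 \<Longrightarrow> {0..(n - 1) div 2} = {..<m + 1}" for n m :: nat
  by auto

lemma form_hyperbolic:
  assumes "n = 2 * m + 1"
  shows "form n 2 (hyperbolic_form n :: 'a::field mpoly)"
  unfolding hyperbolic_form_def one_add_one[symmetric]
proof (intro form_sum form_mult form_var)
  fix i assume "i \<in> {0..(n - 1) div (1 + 1)}"
  then have "i \<le> m" unfolding one_add_one using assms by simp
  then show "(1 + 1) * i \<le> n" "(1 + 1) * i + 1 \<le> n" unfolding one_add_one using assms by simp_all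
qed

lemma form_hermitian_term:
  assumes "2 * i + 1 \<le> n"
  shows "form n (r + 1) (mp_var (2 * i) ^ r * mp_var (2 * i + 1) :: 'a::field mpoly)"
    "form n (r + 1) (mp_var (2 * i) * mp_var (2 * i + 1) ^ r :: 'a::field mpoly)"
proof -
  have v: "form n 1 (mp_var (2 * i) :: 'a mpoly)" "form n 1 (mp_var (2 * i + 1) :: 'a mpoly)"
    using assms by (intro form_var; simp)+
  show "form n (r + 1) (mp_var (2 * i) ^ r * mp_var (2 * i + 1) :: 'a::field mpoly)"
    using form_mult[OF form_power[OF v(1), of r] v(2)] by simp
  show "form n (r + 1) (mp_var (2 * i) * mp_var (2 * i + 1) ^ r :: 'a::field mpoly)"
    using form_mult[OF v(1) form_power[OF v(2), of r]] by simp
qed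

lemma form_hermitian: "n = 2 * m + 1 \<Longrightarrow> form n (r + 1) (hermitian_form r n :: 'a::field mpoly)"
  unfolding hermitian_form_def by (rule form_sum, rule form_add; rule form_hermitian_term) auto

lemma form_space_filling: "n = 2 * m + 1 \<Longrightarrow> form n (r + 1) (space_filling_form r n :: 'a::field mpoly)"
  unfolding space_filling_form_def by (rule form_sum, rule form_diff; rule form_hermitian_term) auto

lemma mp_eval_hyperbolic:
  assumes "n = 2 * m + 1"
  shows "mp_eval id t (hyperbolic_form n :: 'a::field mpoly) = (\<Sum>i<m+1. t (2*i) * t (2*i+1))"
proof -
  interpret ring_morphism "id :: 'a \<Rightarrow> 'a" by (rule ring_morphism_id)
  show ?thesis unfolding hyperbolic_form_def normal_form_range[OF assms]
    by (simp add: mp_eval_sum mp_eval_mult mp_eval_add)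
qed

lemma mp_eval_hermitian:
  assumes "n = 2 * m + 1"
  shows "mp_eval id t (hermitian_form r n :: 'a::field mpoly)
    = (\<Sum>i<m+1. t (2*i) ^ r * t (2*i+1) + t (2*i) * t (2*i+1) ^ r)"
proof -
  interpret ring_morphism "id :: 'a \<Rightarrow> 'a" by (rule ring_morphism_id)
  show ?thesis unfolding hermitian_form_def normal_form_range[OF assms]
    by (simp add: mp_eval_sum mp_eval_mult mp_eval_add mp_eval_power)
qed

lemma mp_eval_space_filling:
  assumes h: "ring_morphism (h :: 'a::field \<Rightarrow> 'b::comm_ring_1)" and "n = 2 * m + 1"
  shows "mp_eval h t (space_filling_form r n)
    = (\<Sum>i<m+1. t (2*i) ^ r * t (2*i+1) - t (2*i) * t (2*i+1) ^ r)"
proof -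
  interpret ring_morphism h by fact
  show ?thesis unfolding space_filling_form_def normal_form_range[OF assms(2)]
    by (simp add: mp_eval_sum mp_eval_mult mp_eval_add mp_eval_diff[OF h] mp_eval_power)
qed

lemma interleave_even: "interleave x y (2 * i) = x i"
  and interleave_odd: "interleave x y (2 * i + 1) = y i"
  by (simp_all add: interleave_def)

lemma card_zeros_hyperbolic:
  assumes n: "n = 2 * m + 1"
  shows "card {t \<in> vecs (Suc n). mp_eval id t (hyperbolic_form n :: 'a::{field,finite} mpoly) = 0} * CARD('a)
    = CARD('a) ^ (m+1) * CARD('a) + (CARD('a) ^ (m+1) - 1) * (1 * CARD('a) ^ (m+1))"
proof -
  have "card {t \<in> vecs (2 * (m+1)). mp_eval id t (hyperbolic_form n :: 'a mpoly) = 0} * CARD('a)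
    = CARD('a) ^ (m+1) * CARD('a) + (CARD('a) ^ (m+1) - 1) * (card {0::'a} * CARD('a) ^ (m+1))"
    by (rule card_interleaved_zeros[where W = "\<lambda>x. x"])
       (simp_all only: mp_eval_hyperbolic[OF n] interleave_even interleave_odd singleton_iff)
  then show ?thesis using n by simp
qed

text \<open>With \<open>z\<close> the sum of the \<open>x i ^ r * y i\<close>, Frobenius turns the
  form into the trace \<open>z + z^r\<close>. So the weights are \<open>x i ^ r\<close>, and the
  trace kernel contributes the factor \<open>r\<close>.\<close>

lemma card_zeros_hermitian:
  assumes n: "n = 2 * m + 1" and q: "CARD('a) = r ^ 2"
  shows "card {t \<in> vecs (Suc n). mp_eval id t (hermitian_form r n :: 'a::{field,finite} mpoly) = 0} * CARD('a)
    = CARD('a) ^ (m+1) * CARD('a) + (CARD('a) ^ (m+1) - 1) * (r * CARD('a) ^ (m+1))"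
proof -
  have r0: "r > 0" using q two_le_card_field[where 'a = 'a] by (cases "r = 0") auto
  have "card {t \<in> vecs (2 * (m+1)). mp_eval id t (hermitian_form r n :: 'a mpoly) = 0} * CARD('a)
    = CARD('a) ^ (m+1) * CARD('a) + (CARD('a) ^ (m+1) - 1) * (card {z::'a. z + z ^ r = 0} * CARD('a) ^ (m+1))"
  proof (rule card_interleaved_zeros[where W = "\<lambda>x i. x i ^ r"])
    fix x y :: "nat \<Rightarrow> 'a"
    have "(x i ^ r) ^ r = x i" for i
      using finite_field_power_card[of "x i"] q by (simp add: power_mult[symmetric] power2_eq_square)
    then have "(\<Sum>i<m+1. x i ^ r * y i) ^ r = (\<Sum>i<m+1. x i * y i ^ r)"
      unfolding sqrt_card_frobenius_sum[OF q] by (simp add: power_mult_distrib)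
    then have "mp_eval id (interleave x y) (hermitian_form r n :: 'a mpoly)
       = (\<Sum>i<m+1. x i ^ r * y i) + (\<Sum>i<m+1. x i ^ r * y i) ^ r"
      unfolding mp_eval_hermitian[OF n] interleave_even interleave_odd sum.distrib by simp
    then show "mp_eval id (interleave x y) (hermitian_form r n :: 'a mpoly) = 0 \<longleftrightarrow>
       (\<Sum>i<m+1. x i ^ r * y i) \<in> {z. z + z ^ r = 0}" by simp
  qed (use r0 in \<open>simp_all add: zero_power\<close>)
  then show ?thesis using n by (simp add: card_trace_kernel[OF q])
qed

section \<open>Space-filling hypersurfaces\<close>

text \<open>In degree at most \<open>q\<close> only scalar multiples of \<open>X^q - X\<close>
  vanish on the whole field.\<close>

lemma coeff_antisymmetric_of_vanishing:
  fixes p :: "'a::{field,finite} poly"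
  assumes p: "degree p \<le> CARD('a)" and van: "\<And>s. poly p s = 0"
  shows "coeff p 1 = - coeff p CARD('a)"
proof -
  let ?q = "CARD('a)"
  have q2: "2 \<le> ?q" by (rule two_le_card_field)
  define r where "r = p - (monom (coeff p ?q) ?q - monom (coeff p ?q) 1)"
  have "coeff r i = 0" if "i \<ge> ?q" for i
    using that q2 p coeff_eq_0[of p i] by (cases "i = ?q") (auto simp: r_def)
  then have "degree r < ?q" using q2 by (intro degree_lessI) auto
  then have "r = 0"
    by (rule poly_zero_if_vanishing) (simp add: r_def van poly_monom finite_field_power_card)
  then have "coeff r 1 = 0" by simp
  then show ?thesis using q2 by (simp add: r_def eq_neg_iff_add_eq_0)
qed

text \<open>After differentiation in \<open>X\<^sub>j\<close>, evaluation at the \<open>i\<close>-th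
  unit vector kills every monomial other than \<open>X\<^sub>i^k X\<^sub>j\<close>. The mixed
  coefficients are thus Gram matrix entries of \<open>B\<close>.\<close>

lemma lookup_mixed_monomial:
  fixes G :: "'a::{field,finite} mpoly"
  assumes G: "form n (k + 1) G" and ij: "i \<le> n" "j \<le> n" "i \<noteq> j"
  shows "Poly_Mapping.lookup G (Poly_Mapping.single i k + Poly_Mapping.single j 1)
     = coeff (line_poly id G (\<lambda>l. if l = i then 1 else 0) (\<lambda>l. if l = j then 1 else 0)) 1"
proof -
  let ?e = "\<lambda>i l. if l = i then 1 else 0 :: 'a"
  let ?m0 = "Poly_Mapping.single i k + Poly_Mapping.single j (1::nat)"
  define g where "g m = Poly_Mapping.lookup G m * (of_nat (Poly_Mapping.lookup m j) * mon (?e i) (m - Poly_Mapping.single j 1))" for m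
  have g0: "g m = 0" if m: "m \<in> Poly_Mapping.keys G" "m \<noteq> ?m0" for m
  proof (rule ccontr)
    assume "g m \<noteq> 0"
    then have lk: "Poly_Mapping.lookup m j \<noteq> 0" and mn: "mon (?e i) (m - Poly_Mapping.single j 1) \<noteq> 0"
      by (auto simp: g_def intro: gr0I)
    define m' where "m' = m - Poly_Mapping.single j 1"
    have s: "m = Poly_Mapping.single j 1 + m'" unfolding m'_def using lk by (intro single_plus_diff) simp
    have ks: "Poly_Mapping.keys m' \<subseteq> {i}"
    proof
      fix l assume l: "l \<in> Poly_Mapping.keys m'"
      show "l \<in> {i}"
      proof (rule ccontr)
        assume "l \<notin> {i}"
        then have "mon (?e i) m' = 0" unfolding mon_def
          using l by (intro prod_zero) (auto simp: in_keys_iff intro!: bexI[of _ l])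
        then show False using mn by (simp add: m'_def)
      qed
    qed
    have "mdeg m = k + 1" using G m(1) by (simp add: form_def)
    then have "mdeg m' = k" using s by (metis add.commute add_left_cancel mdeg_plus mdeg_single)
    moreover have "mdeg m' = Poly_Mapping.lookup m' i" using ks by (subst mdeg_superset[of "{i}"]) auto
    ultimately have "m' = Poly_Mapping.single i k"
      using ks by (intro poly_mapping_eqI) (auto simp: lookup_single when_def in_keys_iff subset_iff)
    then show False using m(2) s by (simp add: add.commute)
  qed
  have "coeff (line_poly id G (?e i) (?e j)) 1 = (\<Sum>l\<le>n. ?e j l * mp_eval id (?e i) (mp_pderiv l G))"
    by (rule coeff_1_line_poly[OF ring_morphism_id G])
  also have "\<dots> = mp_eval id (?e i) (mp_pderiv j G)"
    using ij(2) by (simp add: if_distrib[of "\<lambda>x. x * _"] cong: if_cong)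
  also have "\<dots> = (\<Sum>m\<in>Poly_Mapping.keys G. g m)"
    unfolding mp_eval_pderiv[OF ring_morphism_id] g_def by simp
  also have "\<dots> = (\<Sum>m\<in>{?m0}. g m)"
    by (rule sum.mono_neutral_cong) (use g0 in \<open>auto simp: g_def in_keys_iff\<close>)
  also have "\<dots> = Poly_Mapping.lookup G ?m0"
    using ij(3) by (simp add: g_def lookup_add lookup_single)
  finally show ?thesis by simp
qed

text \<open>The Gram matrix is the standard alternating one; since \<open>r \<ge> 2\<close>, the
  factor that is raised to the power \<open>r\<close> contributes nothing to first order unless it
  is constant.\<close>

lemma coeff_1_space_filling:
  assumes n: "n = 2 * m + 1" and r: "r \<ge> 2" and ij: "i \<le> n" "j \<le> n" "i \<noteq> j"
  shows "coeff (line_poly id (space_filling_form r n :: 'a::field mpoly)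
       (\<lambda>l. if l = i then 1 else 0) (\<lambda>l. if l = j then 1 else 0)) 1
    = (if i div 2 = j div 2 then if even i then 1 else - 1 else 0)"
proof -
  define \<xi> :: "nat \<Rightarrow> 'a poly" where "\<xi> l = [:(if l = i then 1 else 0), (if l = j then 1 else 0):]" for l
  have \<xi>_ij: "\<xi> i = 1" "\<xi> j = [:0, 1:]" using ij(3) by (auto simp: \<xi>_def one_pCons)
  have \<xi>_0: "\<xi> l = 0" if "l \<noteq> i" "l \<noteq> j" for l using that by (simp add: \<xi>_def)
  have c1: "coeff ([:0, 1:] ^ r :: 'a poly) 1 = 0" using r by (simp add: monom_altdef[of "1 :: 'a", simplified, symmetric])
  have c1': "coeff ([:0, 1:] ^ r :: 'a poly) (Suc 0) = 0" using c1 by simp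
  define f where "f k = coeff (\<xi> (2*k) ^ r * \<xi> (2*k+1) - \<xi> (2*k) * \<xi> (2*k+1) ^ r) 1" for k
  have f0: "f k = 0" if "k \<noteq> i div 2 \<or> k \<noteq> j div 2" for k
  proof -
    have "\<not> (i \<in> {2*k, 2*k+1} \<and> j \<in> {2*k, 2*k+1})" using that by auto
    then have "\<xi> (2*k) = 0 \<or> \<xi> (2*k+1) = 0" using ij(3) \<xi>_0[of "2*k"] \<xi>_0[of "2*k+1"]
      by (cases "2*k = i"; cases "2*k = j"; auto)
    then show ?thesis using r by (auto simp: f_def zero_power)
  qed
  have "coeff (line_poly id (space_filling_form r n :: 'a mpoly)
       (\<lambda>l. if l = i then 1 else 0) (\<lambda>l. if l = j then 1 else 0)) 1 = (\<Sum>k<m+1. f k)"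
    unfolding line_poly_def mp_eval_space_filling[OF ring_morphism_poly_const[OF ring_morphism_id] n] coeff_sum
    by (simp only: f_def \<xi>_def)
  also have "\<dots> = (if i div 2 = j div 2 then if even i then 1 else - 1 else 0)"
  proof (cases "i div 2 = j div 2")
    case False
    then have "f k = 0" for k using f0[of k] by auto
    then show ?thesis using False by simp
  next
    case True
    have "i div 2 < m + 1" using ij(1) n by auto
    then have "(\<Sum>k<m+1. f k) = (\<Sum>k\<in>{i div 2}. f k)"
      using f0 by (intro sum.mono_neutral_right) auto
    also have "\<dots> = f (i div 2)" by simp
    also have "\<dots> = (if even i then 1 else - 1)"
    proof (cases "even i")
      case e: True
      then have "2 * (i div 2) = i" "2 * (i div 2) + 1 = j"
        using True ij(3) by presburger+
      then show ?thesis using e c1' by (simp add: f_def \<xi>_ij)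
    next
      case o: False
      then have "2 * (i div 2) = j" "2 * (i div 2) + 1 = i"
        using True ij(3) by presburger+
      then show ?thesis using o c1' by (simp add: f_def \<xi>_ij)
    qed
    finally show ?thesis using True by simp
  qed
  finally show ?thesis .
qed

lemma hyperbolic_basis_spans:
  assumes "finite_form F n d" "finite_form.hyperbolic_basis F (vecs (Suc n)) K b" "Suc n = 2 * K"
  shows "lincomb b (Suc n) ` vecs (Suc n) = vecs (Suc n)"
proof -
  interpret finite_form F n d by fact
  have b: "\<And>i. i < Suc n \<Longrightarrow> b i \<in> vecs (Suc n)" "\<And>w. w \<in> vecs (Suc n) \<Longrightarrow> \<exists>t. w = lincomb b (Suc n) t"
    using assms(2) unfolding hyperbolic_basis_def assms(3) by blast+
  show ?thesis
  proof
    show "lincomb b (Suc n) ` vecs (Suc n) \<subseteq> vecs (Suc n)"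
      by (intro image_subsetI lincomb_in_subspace[OF lin_subspace_vecs] b(1))
    show "vecs (Suc n) \<subseteq> lincomb b (Suc n) ` vecs (Suc n)"
    proof
      fix w :: "nat \<Rightarrow> 'a" assume "w \<in> vecs (Suc n)"
      then obtain t where "w = lincomb b (Suc n) t" using b(2) by blast
      then have "w = lincomb b (Suc n) (\<lambda>i. if i < Suc n then t i else 0)" by (simp only: lincomb_truncate)
      then show "w \<in> lincomb b (Suc n) ` vecs (Suc n)" using truncate_vecs by blast
    qed
  qed
qed

text \<open>On every line \<open>F\<close> restricts to a multiple of \<open>X^q - X\<close>, whose
  two coefficients are \<open>B P Q\<close> and \<open>B Q P\<close>; so \<open>B\<close> is skew
  and therefore bilinear. A symplectic basis fixes the Gram matrix, hence the mixed coefficients,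
  and these are all that the vanishing of the values leaves open.\<close>

lemma space_filling_classification:
  fixes F :: "'a::{field,finite} mpoly"
  assumes F: "form n (CARD('a) + 1) F" and sm: "smooth_at_points n F" and n: "n = 2 * m + 1"
    and van: "\<And>x. x \<in> vecs (Suc n) \<Longrightarrow> mp_eval id x F = 0"
  shows "proj_equivalent n F (space_filling_form CARD('a) n)"
proof -
  let ?q = "CARD('a)"
  have q2: "2 \<le> ?q" by (rule two_le_card_field)
  interpret finite_form F n "?q + 1" by standard (use F q2 in auto)
  have van': "mp_eval id x F = 0" for x
  proof -
    have "mp_eval id x F = mp_eval id (\<lambda>i. if i < Suc n then x i else 0) F"
      by (rule mp_eval_form_cong[OF F]) simp
    then show ?thesis using van truncate_vecs by metis
  qed
  then have v0: "val x = 0" for x by (simp add: val_def)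
  have skew: "B P Q = - B Q P" for P Q
  proof -
    have "coeff (L P Q) 1 = - coeff (L P Q) ?q"
      using degree_L_isotropic[OF v0, of P Q] by (intro coeff_antisymmetric_of_vanishing) (simp_all add: poly_L v0)
    moreover have "coeff (L P Q) ?q = B Q P" using coeff_d1_L[of P Q] by simp
    ultimately show ?thesis by (simp add: B_def)
  qed
  have "\<exists>b. hyperbolic_basis (vecs (Suc n)) (m + 1) b"
  proof (rule hyperbolic_basis_exists[where good = "\<lambda>_ _. True"])
    show "\<And>P Q. B P Q = 0 \<Longrightarrow> B Q P = 0" using skew by (metis add.inverse_neutral)
    show "\<And>P w. \<exists>s. val (w + s \<star> P) = 0" using v0 by blast
    fix W :: "(nat \<Rightarrow> 'a) set" and j :: nat
    assume W: "lin_subspace (Suc n) W" "card W = ?q ^ (2 * Suc j)"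
    have "1 < ?q ^ (2 * Suc j)" using q2 by (intro one_less_power) auto
    then have "W \<noteq> {0}" using W(2) by auto
    then show "\<exists>P\<in>W. P \<noteq> 0 \<and> val P = 0 \<and> (\<forall>Q\<in>W. val Q = 0 \<longrightarrow> B P Q \<noteq> 0 \<longrightarrow> True)"
      using lin_subspaceD(2)[OF W(1)] v0 by blast
  next
    show "card (vecs (Suc n) :: (nat \<Rightarrow> 'a) set) = ?q ^ (2 * (m + 1))" using n by (simp add: card_vecs)
  qed (use lin_subspace_vecs nondegenerate_of_smooth[OF sm] in auto)
  then obtain b where b: "hyperbolic_basis (vecs (Suc n)) (m + 1) b" by blast
  have span: "lincomb b (Suc n) ` vecs (Suc n) = vecs (Suc n)"
    by (rule hyperbolic_basis_spans[OF finite_form_axioms b]) (simp add: n)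
  let ?F = "linear_subst n (basis_mat n b) F"
  let ?G = "space_filling_form ?q n :: 'a mpoly"
  let ?e = "\<lambda>i l. if l = i then 1 else 0 :: 'a"
  have fF: "form n (?q + 1) ?F" by (rule form_linear_subst[OF F])
  have fG: "form n (?q + 1) ?G" by (rule form_space_filling[OF n])
  have "?F - ?G = 0"
  proof (rule form_eq_0_if_vanishing)
    show fH: "form n (?q + 1) (?F - ?G)" by (rule form_diff[OF fF fG])
    show "mp_eval id x (?F - ?G) = 0" for x
      by (simp add: mp_eval_diff[OF ring_morphism_id] val_basis_subst[OF F] van'
          mp_eval_space_filling[OF ring_morphism_id n] finite_field_power_card)
    fix i j :: nat assume ne: "i \<noteq> j"
    show "Poly_Mapping.lookup (?F - ?G) (Poly_Mapping.single i ?q + Poly_Mapping.single j 1) = 0"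
    proof (cases "i \<le> n \<and> j \<le> n")
      case False
      have "Poly_Mapping.single i ?q + Poly_Mapping.single j 1 \<notin> Poly_Mapping.keys (?F - ?G)"
      proof
        assume "Poly_Mapping.single i ?q + Poly_Mapping.single j 1 \<in> Poly_Mapping.keys (?F - ?G)"
        then have "Poly_Mapping.keys (Poly_Mapping.single i ?q + Poly_Mapping.single j (1::nat)) \<subseteq> {..n}"
          using fH by (simp add: form_def)
        then show False using False q2 by (auto simp: keys_plus_nat)
      qed
      then show ?thesis by (simp add: in_keys_iff)
    next
      case True
      have bE: "(\<lambda>l. \<Sum>k\<le>n. id (b k l) * ?e i k) = b i" if "i \<le> n" for i
        using that by (simp add: if_distrib[of "\<lambda>x. _ * x"] cong: if_cong)
      have "coeff (line_poly id ?F (?e i) (?e j)) 1 = B (b i) (b j)"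
        unfolding line_poly_basis_subst[OF ring_morphism_id F] B_def L_def using bE True by simp
      also have "\<dots> = (if i div 2 = j div 2 then if even i then 1 else - 1 else 0)"
      proof (cases "i div 2 = j div 2")
        case False
        have "i < 2 * (m + 1)" "j < 2 * (m + 1)" using True n by auto
        then show ?thesis using b False unfolding hyperbolic_basis_def by simp
      next
        case eq: True
        have k: "i div 2 < m + 1" using True n by auto
        have B1: "B (b (2 * (i div 2))) (b (2 * (i div 2) + 1)) = 1"
          using b k unfolding hyperbolic_basis_def by blast
        show ?thesis
        proof (cases "even i")
          case e: True
          then have "2 * (i div 2) = i" "2 * (i div 2) + 1 = j" using eq ne by presburger+
          then have "B (b i) (b j) = 1" using B1 by (simp only:)
          then show ?thesis using eq e by simp
        next
          case o: False
          then have "2 * (i div 2) = j" "2 * (i div 2) + 1 = i" using eq ne by presburger+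
          then have "B (b i) (b j) = - 1" using B1 skew[of "b i" "b j"] by (simp only:)
          then show ?thesis using eq o by simp
        qed
      qed
      also have "\<dots> = coeff (line_poly id ?G (?e i) (?e j)) 1"
        by (rule coeff_1_space_filling[OF n q2 _ _ ne, symmetric]) (use True in simp_all)
      finally have "coeff (line_poly id ?F (?e i) (?e j)) 1 = coeff (line_poly id ?G (?e i) (?e j)) 1" .
      moreover have "i \<le> n" "j \<le> n" using True by simp_all
      ultimately show ?thesis
        unfolding lookup_minus by (simp only: lookup_mixed_monomial[OF fF _ _ ne] lookup_mixed_monomial[OF fG _ _ ne] diff_self)
    qed
  qed simp
  then have "?F = mp_const 1 * ?G" by (simp add: mp_const_1)
  from proj_equivalent_basisI[OF span _ this] show ?thesis by simp
qed

section \<open>The bound and its extremal hypersurfaces\<close>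

lemma extremal_proj_equivalent:
  fixes F :: "'a::{field,finite} mpoly"
  assumes ex: "extremal_form F n d (m + 1)" and sm: "smooth_at_points n F" and n: "n = 2 * m + 1" and m: "m \<ge> 1"
  shows "(d = 2 \<and> proj_equivalent n F (hyperbolic_form n)) \<or>
     (CARD('a) = (d - 1) ^ 2 \<and> proj_equivalent n F (hermitian_form (d - 1) n))"
proof -
  interpret extremal_form F n d "m + 1" by fact
  obtain b where b: "hyperbolic_basis (vecs (Suc n)) (m + 1) b"
    by (rule extremal_hyperbolic_basis[OF nondegenerate_of_smooth[OF sm]]) (simp_all add: n)
  have span: "lincomb b (Suc n) ` vecs (Suc n) = vecs (Suc n)"
    by (rule hyperbolic_basis_spans[OF finite_form_axioms b]) (simp add: n)
  have n2: "2 * (m + 1) = Suc n" using n by simp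
  from extremal_normal_form[OF b] m
  consider "d = 2" "\<And>t. val (lincomb b (Suc n) t) = (\<Sum>i<m+1. t (2*i) * t (2*i+1))"
    | \<mu> where "CARD('a) = (d - 1) ^ 2" "\<mu> \<noteq> 0" "\<And>t. val (lincomb b (Suc n) t) =
       (\<Sum>i<m+1. t (2*i) ^ (d - 1) * t (2*i+1) + \<mu> ^ (d - 2) * (t (2*i) * t (2*i+1) ^ (d - 1)))"
    unfolding n2 by auto
  then show ?thesis
  proof cases
    case 1
    have "linear_subst n (basis_mat n b) F = mp_const 1 * hyperbolic_form n"
    proof (rule form_eqI)
      show "form n d (linear_subst n (basis_mat n b) F)" by (rule form_linear_subst[OF form])
      show "form n d (mp_const 1 * hyperbolic_form n)" using form_hyperbolic[OF n] 1(1) by (simp add: mp_const_1)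
      fix t :: "nat \<Rightarrow> 'a"
      show "mp_eval id t (linear_subst n (basis_mat n b) F) = mp_eval id t (mp_const 1 * hyperbolic_form n)"
        using 1(2)[of t] by (simp add: val_basis_subst[OF form] val_def mp_const_1 mp_eval_hyperbolic[OF n])
    qed (rule dq)
    then show ?thesis using proj_equivalent_basisI[OF span] 1(1) by (metis zero_neq_one)
  next
    case 2
    \<comment> \<open>Dividing the odd basis vectors by \<open>\<mu>\<close> turns both coefficients
      \<open>1\<close> and \<open>\<mu>^(d - 2)\<close> into \<open>1 / \<mu>\<close>, a common
      scalar.\<close>
    define b' where "b' j = (if odd j then (1 / \<mu>) \<star> b j else b j)" for j
    have b'b: "lincomb b' (Suc n) t = lincomb b (Suc n) (\<lambda>j. if odd j then t j / \<mu> else t j)" for t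
      unfolding lincomb_def by (rule ext, rule sum.cong) (simp_all add: b'_def)
    have span': "lincomb b' (Suc n) ` vecs (Suc n) = vecs (Suc n)"
    proof
      show "lincomb b' (Suc n) ` vecs (Suc n) \<subseteq> vecs (Suc n)"
      proof
        fix x assume "x \<in> lincomb b' (Suc n) ` vecs (Suc n)"
        then obtain t where t: "t \<in> vecs (Suc n)" "x = lincomb b' (Suc n) t" by blast
        have "(\<lambda>j. if odd j then t j / \<mu> else t j) \<in> vecs (Suc n)" using t(1) by (auto simp: vecs_def)
        then show "x \<in> vecs (Suc n)" using span t(2) b'b by blast
      qed
      show "vecs (Suc n) \<subseteq> lincomb b' (Suc n) ` vecs (Suc n)"
      proof
        fix x :: "nat \<Rightarrow> 'a" assume "x \<in> vecs (Suc n)"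
        then obtain t where t: "t \<in> vecs (Suc n)" "x = lincomb b (Suc n) t" using span by blast
        define u where "u = (\<lambda>j. if odd j then t j * \<mu> else t j)"
        have "(\<lambda>j. if odd j then u j / \<mu> else u j) = t" using 2(2) by (auto simp: u_def)
        then have "x = lincomb b' (Suc n) u" using t(2) b'b[of u] by simp
        moreover have "u \<in> vecs (Suc n)" using t(1) by (auto simp: u_def vecs_def)
        ultimately show "x \<in> lincomb b' (Suc n) ` vecs (Suc n)" by blast
      qed
    qed
    have d1: "d - 1 + 1 = d" "\<mu> ^ (d - 1) = \<mu> * \<mu> ^ (d - 2)"
      using d2 by (simp_all add: power_Suc[symmetric] Suc_diff_Suc numeral_2_eq_2 del: power_Suc)
    have "linear_subst n (basis_mat n b') F = mp_const (1 / \<mu>) * hermitian_form (d - 1) n"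
    proof (rule form_eqI)
      show "form n d (linear_subst n (basis_mat n b') F)" by (rule form_linear_subst[OF form])
      show "form n d (mp_const (1 / \<mu>) * hermitian_form (d - 1) n)"
        using form_mult[OF form_const form_hermitian[OF n, of "d - 1"]] d1(1) by simp
      fix t :: "nat \<Rightarrow> 'a"
      let ?u = "\<lambda>j. if odd j then t j / \<mu> else t j"
      have "mp_eval id t (linear_subst n (basis_mat n b') F) = val (lincomb b (Suc n) ?u)"
        by (simp only: val_basis_subst[OF form] val_def b'b)
      also have "\<dots> = (\<Sum>i<m+1. t (2*i) ^ (d - 1) * (t (2*i+1) / \<mu>)
          + \<mu> ^ (d - 2) * (t (2*i) * (t (2*i+1) / \<mu>) ^ (d - 1)))"
        unfolding 2(3) by simp
      also have "\<dots> = (\<Sum>i<m+1. (1 / \<mu>) * (t (2*i) ^ (d - 1) * t (2*i+1) + t (2*i) * t (2*i+1) ^ (d - 1)))"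
        using 2(2) by (intro sum.cong refl) (simp only: power_divide d1(2), simp add: field_simps)
      also have "\<dots> = mp_eval id t (mp_const (1 / \<mu>) * hermitian_form (d - 1) n)"
        by (simp only: mp_eval_mult_const[OF ring_morphism_id] mp_eval_hermitian[OF n] sum_distrib_left id_apply)
      finally show "mp_eval id t (linear_subst n (basis_mat n b') F) = mp_eval id t (mp_const (1 / \<mu>) * hermitian_form (d - 1) n)" .
    qed (rule dq)
    then have "proj_equivalent n F (hermitian_form (d - 1) n)"
      using 2(2) by (intro proj_equivalent_basisI[OF span', of "1 / \<mu>"]) auto
    then show ?thesis using 2(1) by blast
  qed
qed

lemma zeros_bound_small_degree:
  fixes F :: "'a::{field,finite} mpoly"
  assumes F: "form n d F" and d: "2 \<le> d" "d \<le> CARD('a)" and sm: "smooth_at_points n F"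
    and n: "n = 2 * m + 1"
  shows "card {x \<in> vecs (Suc n). mp_eval id x F = 0} * CARD('a)
      \<le> CARD('a) ^ (m+1) * CARD('a) + (CARD('a) ^ (m+1) - 1) * ((d - 1) * CARD('a) ^ (m+1))"
    and "card {x \<in> vecs (Suc n). mp_eval id x F = 0} * CARD('a)
      = CARD('a) ^ (m+1) * CARD('a) + (CARD('a) ^ (m+1) - 1) * ((d - 1) * CARD('a) ^ (m+1)) \<Longrightarrow>
      extremal_form F n d (m + 1)"
proof -
  let ?q = "CARD('a)"
  have q2: "2 \<le> ?q" by (rule two_le_card_field)
  interpret finite_form F n d by standard (use F d in auto)
  have Z: "{x \<in> vecs (Suc n). mp_eval id x F = 0} = zeros" by (simp add: zeros_def val_def)
  obtain S where S: "isotropic S" and max: "\<And>S'. isotropic S' \<Longrightarrow> card S' \<le> card S"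
    using maximal_isotropic_exists by blast
  have Sub: "lin_subspace (Suc n) S" using S by (simp add: isotropic_def)
  obtain k b where cS: "card S = ?q ^ k" by (rule basis_exists[OF Sub]) blast
  have k: "k \<le> m + 1" by (rule isotropic_dim_le[OF sm d(2) _ S cS]) (simp add: n)
  define s where "s = ?q ^ k"
  define w where "w = ?q ^ (m + 1 - k)"
  have sw: "?q ^ (m + 1) = s * w" unfolding s_def w_def using k by (simp add: power_add[symmetric])
  have pos: "s \<ge> 1" "w \<ge> 1" using q2 by (auto simp: s_def w_def)
  have tot: "?q ^ Suc n = (s * w) * (s * w)" unfolding sw[symmetric] n by (simp add: power_add[symmetric] mult_2)
  have rhs: "(s * w - 1) * ((d - 1) * (s * w)) = ((s * w) * (s * w) - s * w) * (d - 1)"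
  proof -
    have "(p - 1) * ((d - 1) * p) = (p * p - p) * (d - 1)" for p :: nat
    proof -
      have "p * p - p = (p - 1) * p" by (simp add: diff_mult_distrib)
      then show ?thesis by (simp only: mult_ac)
    qed
    then show ?thesis .
  qed
  have le: "s \<le> (s * w) * (s * w)" "s * w \<le> (s * w) * (s * w)" using pos by simp_all
  \<comment> \<open>With \<open>s = card S\<close> and \<open>s w = q^(m + 1)\<close>, the bound
    obtained from \<open>S\<close> falls short of the claimed one by exactly
    \<open>(q - (d - 1)) s (w - 1)\<close>. As \<open>d - 1 < q\<close>, equality forces
    \<open>w = 1\<close>.\<close>
  have bound: "s * ?q + ((s * w) * (s * w) - s) * (d - 1) + (?q - (d - 1)) * (s * (w - 1))
      = s * w * ?q + ((s * w) * (s * w) - s * w) * (d - 1)"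
  proof -
    have "d - 1 \<le> ?q" using d by simp
    from le_Suc_ex[OF this] obtain c where c: "?q = (d - 1) + c" ..
    obtain v where v: "w = v + 1" using pos by (metis add.commute le_Suc_ex)
    obtain z where z: "(s * w) * (s * w) = s * w + z" using le(2) le_Suc_ex by blast
    have z': "(s * w) * (s * w) - s = s * v + z"
    proof -
      have "(s * w) * (s * w) - s = s * w + z - s" by (simp only: z)
      then show ?thesis by (simp add: v)
    qed
    have z'': "(s * w) * (s * w) - s * w = z" unfolding z by simp
    have qc: "?q - (d - 1) = c" using c by simp
    define e where "e = d - 1"
    show ?thesis unfolding z' z'' qc unfolding c v e_def[symmetric] by (simp add: algebra_simps)
  qed
  have zb: "card zeros * ?q \<le> s * ?q + ((s * w) * (s * w) - s) * (d - 1)"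
    using zeros_bound(1)[OF S max] unfolding cS s_def[symmetric] tot .
  then show "card {x \<in> vecs (Suc n). mp_eval id x F = 0} * ?q
      \<le> ?q ^ (m+1) * ?q + (?q ^ (m+1) - 1) * ((d - 1) * ?q ^ (m+1))"
    unfolding Z sw rhs using bound by linarith
  assume "card {x \<in> vecs (Suc n). mp_eval id x F = 0} * ?q
      = ?q ^ (m+1) * ?q + (?q ^ (m+1) - 1) * ((d - 1) * ?q ^ (m+1))"
  then have eq: "card zeros * ?q = s * w * ?q + ((s * w) * (s * w) - s * w) * (d - 1)"
    unfolding Z sw rhs .
  then have "(?q - (d - 1)) * (s * (w - 1)) = 0" using bound zb by linarith
  then have "w = 1" using d pos by auto
  then have k_eq: "card S = ?q ^ (m + 1)" using sw cS s_def by simp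
  show "extremal_form F n d (m + 1)"
  proof
    show "\<exists>S. isotropic S \<and> card S = ?q ^ (m + 1)" using S k_eq by blast
    fix S' v assume S': "isotropic S'" "card S' = ?q ^ (m + 1)" and v: "v \<in> vecs (Suc n)" "v \<notin> S'"
    \<comment> \<open>Every isotropic space of this size is a largest one, so the equality statement
      holds for all of them and not only for \<open>S\<close>.\<close>
    have max': "card S'' \<le> card S'" if "isotropic S''" for S'' using max[OF that] k_eq S'(2) by simp
    have "card zeros * ?q = card S' * ?q + (?q ^ Suc n - card S') * (d - 1)"
      unfolding eq S'(2) tot sw ..
    from zeros_bound(2)[OF S'(1) max' this v] show "card {l \<in> S'. val (v + l) = 0} * ?q = (d - 1) * card S'" .
  qed (use d in auto)
qed

theorem theorem1p1:
  fixes F :: "'a::{field,finite} mpoly" and n d q :: nat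
  assumes "q = CARD('a)"
    and "n \<ge> 3" and "odd n" and "d \<ge> 2"
    and "hypersurface_form n d F"
    and "nonsingular_hypersurface n F"
  shows "num_points n F \<le> theta q ((n - 1) div 2) * ((d - 1) * q ^ ((n - 1) div 2) + 1) \<and>
    (num_points n F = theta q ((n - 1) div 2) * ((d - 1) * q ^ ((n - 1) div 2) + 1) \<longleftrightarrow>
       (d = 2 \<and> proj_equivalent n F (hyperbolic_form n)) \<or>
       (\<exists>r. q = r ^ 2 \<and> d = r + 1 \<and> proj_equivalent n F (hermitian_form r n)) \<or>
       (d = q + 1 \<and> proj_equivalent n F (space_filling_form q n)))"
proof -
  obtain m where n: "n = 2 * m + 1" using \<open>odd n\<close> by (rule oddE)
  have m1: "m \<ge> 1" "(n - 1) div 2 = m" using n \<open>n \<ge> 3\<close> by auto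
  have q2: "2 \<le> q" using two_le_card_field[where 'a = 'a] assms(1) by simp
  have F: "form n d F" using assms(5) by (simp add: hypersurface_form_iff)
  have sm: "smooth_at_points n F" using assms(6) smooth_at_points_iff[OF F] by simp
  define Z where "Z G = card {x \<in> vecs (Suc n). mp_eval id x G = 0}" for G :: "'a mpoly"
  define T where "T = theta q m * ((d - 1) * q ^ m + 1)"
  define Q where "Q = q ^ (m + 1)"
  have "q \<le> Q" unfolding Q_def by (rule self_le_power) (use q2 in auto)
  then have Q1: "Q \<ge> 2" using q2 by simp
  have N: "num_points n F * (q - 1) + 1 = Z F"
    unfolding Z_def assms(1) by (rule num_points_zeros[OF F]) (use \<open>d \<ge> 2\<close> in simp)
  have th: "theta q m * (q - 1) = Q - 1"
    using theta_geometric[of q m] q2 unfolding Q_def by simp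
  \<comment> \<open>The projective bound, passed to the affine cone and multiplied by
    \<open>q\<close>, takes the shape of \<open>zeros_bound_small_degree\<close> with
    \<open>Q = q^(m + 1)\<close>.\<close>
  have TQ: "(T * (q - 1) + 1) * q = Q * q + (Q - 1) * ((d - 1) * Q)"
  proof -
    have "T * (q - 1) = (theta q m * (q - 1)) * ((d - 1) * q ^ m + 1)" by (simp only: T_def mult_ac)
    then have "T * (q - 1) = (Q - 1) * ((d - 1) * q ^ m) + (Q - 1)" by (simp only: th distrib_left mult_1_right)
    then have "T * (q - 1) + 1 = (Q - 1) * ((d - 1) * q ^ m) + Q" using Q1 by linarith
    then have "(T * (q - 1) + 1) * q = ((Q - 1) * ((d - 1) * q ^ m) + Q) * q" by (simp only:)
    then have "(T * (q - 1) + 1) * q = (Q - 1) * ((d - 1) * (q ^ m * q)) + Q * q"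
      by (simp only: add_mult_distrib mult.assoc)
    moreover have "q ^ m * q = Q" by (simp add: Q_def)
    ultimately show ?thesis by simp
  qed
  have le_iff: "num_points n F \<le> T \<longleftrightarrow> Z F * q \<le> Q * q + (Q - 1) * ((d - 1) * Q)"
    unfolding TQ[symmetric] N[symmetric] using q2 by simp
  have eq_iff: "num_points n F = T \<longleftrightarrow> Z F * q = Q * q + (Q - 1) * ((d - 1) * Q)"
    unfolding TQ[symmetric] N[symmetric] using q2 by simp
  have card_all: "card (vecs (Suc n) :: (nat \<Rightarrow> 'a) set) = Q * Q"
    unfolding card_vecs assms(1)[symmetric] Q_def n by (simp add: power_add[symmetric] mult_2)
  have Z_all: "Z G \<le> Q * Q" for G
    unfolding Z_def card_all[symmetric] by (rule card_mono[OF finite_vecs]) auto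
  have QQ: "Q * Q * q = Q * q + (Q - 1) * (q * Q)"
  proof -
    have "Q * q + (Q - 1) * (q * Q) = (1 + (Q - 1)) * (q * Q)"
      by (simp only: add_mult_distrib mult_1_left mult.commute[of Q q])
    also have "1 + (Q - 1) = Q" using Q1 by simp
    finally show ?thesis by (simp only: mult_ac)
  qed
  have "num_points n F \<le> T \<and> (num_points n F = T \<longleftrightarrow>
       (d = 2 \<and> proj_equivalent n F (hyperbolic_form n)) \<or>
       (\<exists>r. q = r ^ 2 \<and> d = r + 1 \<and> proj_equivalent n F (hermitian_form r n)) \<or>
       (d = q + 1 \<and> proj_equivalent n F (space_filling_form q n)))" (is "_ \<and> (_ \<longleftrightarrow> ?H \<or> ?U \<or> ?S)")
  proof -
    \<comment> \<open>Since \<open>r \<ge> 2\<close> gives \<open>r + 1 \<le> r^2\<close>, the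
      Hermitian alternative belongs to the range \<open>d \<le> q\<close> and cannot occur in the
      other two.\<close>
    have herm_d: "d \<le> q" if "q = r ^ 2" "d = r + 1" for r
    proof -
      have "r \<ge> 2" using that(1) q2 by (cases "r = 0 \<or> r = 1") auto
      then have "2 * r \<le> r * r" by simp
      then have "r + 1 \<le> r * r" using \<open>r \<ge> 2\<close> by linarith
      then show ?thesis using that by (simp add: power2_eq_square)
    qed
    consider (small) "d \<le> q" | (fill) "d = q + 1" | (large) "d \<ge> q + 2" by linarith
    then show ?thesis
    proof cases
      case small
      note b = zeros_bound_small_degree[OF F \<open>d \<ge> 2\<close> small[unfolded assms(1)] sm n,
          folded assms(1), folded Z_def Q_def]
      have le: "num_points n F \<le> T" unfolding le_iff by (rule b(1))
      have "?H \<or> ?U \<or> ?S" if "num_points n F = T"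
      proof -
        have "extremal_form F n d (m + 1)" using that unfolding eq_iff by (rule b(2))
        from extremal_proj_equivalent[OF this sm n m1(1)] \<open>d \<ge> 2\<close> show ?thesis
          unfolding assms(1)[symmetric] by (metis Suc_eq_plus1 Suc_1 Suc_leD Suc_pred' less_eq_Suc_le One_nat_def)
      qed
      moreover have "num_points n F = T" if "?H \<or> ?U \<or> ?S"
      proof -
        from that small consider "d = 2" "proj_equivalent n F (hyperbolic_form n)"
          | r where "q = r ^ 2" "d = r + 1" "proj_equivalent n F (hermitian_form r n)" by auto
        then show ?thesis
        proof cases
          case 1
          then show ?thesis
            using card_zeros_hyperbolic[OF n, where 'a = 'a] card_zeros_proj_equivalent[OF F 1(2)]
            unfolding eq_iff by (simp add: Z_def Q_def assms(1))
        next
          case 2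
          then have "CARD('a) = r ^ 2" using assms(1) by simp
          from card_zeros_hermitian[OF n this] card_zeros_proj_equivalent[OF F 2(3)] 2(2)
          show ?thesis unfolding eq_iff by (simp add: Z_def Q_def assms(1))
        qed
      qed
      ultimately show ?thesis using le by blast
    next
      case fill
      \<comment> \<open>For \<open>d = q + 1\<close> the bound is the number of all vectors, so it
        holds trivially and equality means that \<open>F\<close> vanishes everywhere.\<close>
      have rhs: "Q * q + (Q - 1) * ((d - 1) * Q) = Q * Q * q" using QQ fill by simp
      have le: "num_points n F \<le> T" unfolding le_iff rhs using Z_all by simp
      have eq: "num_points n F = T \<longleftrightarrow> Z F = Q * Q" unfolding eq_iff rhs using q2 by simp
      have "?S" if "Z F = Q * Q"
      proof -
        have "{x \<in> vecs (Suc n). mp_eval id x F = 0} = vecs (Suc n)"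
          using that unfolding Z_def card_all[symmetric] by (intro card_subset_eq finite_vecs) auto
        then have van: "mp_eval id x F = 0" if "x \<in> vecs (Suc n)" for x using that by blast
        have "form n (CARD('a) + 1) F" using F fill assms(1) by simp
        from space_filling_classification[OF this sm n van] show ?thesis using fill assms(1) by simp
      qed
      moreover have "Z F = Q * Q" if "?H \<or> ?U \<or> ?S"
      proof -
        have "\<not> ?H" using fill q2 by simp
        moreover have "\<not> ?U" using herm_d fill by fastforce
        ultimately have "proj_equivalent n F (space_filling_form q n)" using that by blast
        then have "Z F = Z (space_filling_form q n)" unfolding Z_def by (rule card_zeros_proj_equivalent[OF F])
        also have "{x \<in> vecs (Suc n). mp_eval id x (space_filling_form q n :: 'a mpoly) = 0} = vecs (Suc n)"
          unfolding assms(1) by (simp add: mp_eval_space_filling[OF ring_morphism_id n] finite_field_power_card)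
        then have "Z (space_filling_form q n) = Q * Q" unfolding Z_def card_all[symmetric] by simp
        finally show ?thesis .
      qed
      ultimately show ?thesis using le eq by blast
    next
      case large
      \<comment> \<open>Beyond \<open>q + 1\<close> the bound exceeds the number of all vectors, so
        it is strict, and each of the three alternatives prescribes a smaller degree.\<close>
      have "(Q - 1) * (q * Q) < (Q - 1) * ((d - 1) * Q)" using large Q1 by simp
      then have lt: "Z F * q < Q * q + (Q - 1) * ((d - 1) * Q)"
        using Z_all[of F] QQ mult_right_mono[OF Z_all[of F], of q] by linarith
      have "\<not> (?H \<or> ?U \<or> ?S)"
        using herm_d large q2 by fastforce
      moreover have "num_points n F \<noteq> T" using lt eq_iff by simp
      moreover have "num_points n F \<le> T" using lt le_iff by simp
      ultimately show ?thesis by blast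
    qed
  qed
  then show ?thesis unfolding m1(2) T_def .
qed

end
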